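(* Let $\lambda/\mu$ be a shifted skew shape, $n\ge 1$, and $\mathcal{B}=\mathrm{ShST}(\lambda/\mu,n)$ (assumed nonempty). For each $i\in\{1,\ldots,n-1\}$, the operators $F_i,E_i,F'_i,E'_i$ on $\mathcal{B}$ commute whenever compositions are defined: for any two $A,B\in\{F_i,E_i,F'_i,E'_i\}$ and $T\in\mathcal B$, if $AB(T)$ and $BA(T)$ are both defined then $AB(T)=BA(T)$. Moreover, with the auxiliary functions $\mathrm{wt},\varphi_i,\varepsilon_i$ on $\mathcal{B}$ given in the context, the data $(e_i,f_i)=(E_i,F_i)$ satisfies the axioms of a $\mathrm{GL}_n$ Kashiwara crystal, and, with the same functions $\mathrm{wt},\varphi_i,\varepsilon_i$, the data $(e_i,f_i)=(E'_i,F'_i)$ also satisfies the axioms of a $\mathrm{GL}_n$ Kashiwara crystal.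
   Context: Words. Letters are $1'<1<2'<2<3'<3<\cdots$. The canonical form of a finite string of letters is obtained by replacing, for every $i$, the leftmost entry in $\{i,i'\}$ (if there is one) by $i$. Two strings are equivalent if they have the same canonical form; a word is an equivalence class of strings, its members are its representatives, and a word is identified with its representative in canonical form. The weight is $\mathrm{wt}(w)=(n_1,n_2,\ldots)$, where $n_i$ is the number of entries of $w$ equal to $i$ or $i'$. The standardization $\mathrm{std}(w)$ of a word of length $m$ is the permutation obtained by replacing its letters by $1,\ldots,m$ from least to greatest, breaking ties between equal unprimed letters from left to right and between equal primed letters from right to left (independent of the representative). Tableaux. A strict partition is a strictly decreasing finite (possibly empty) sequence $\lambda=(\lambda_1>\cdots>\lambda_k)$ of positive integers; its shifted diagram is the set of boxes $(r,c)$ (row $r$ counted from the top, column $c$ from the left) with $1\le r\le k$ and $r\le c\le r+\lambda_r-1$. A shifted skew shape $\lambda/\mu$ is the difference of two such diagrams, $\mu$ contained in $\lambda$. A shifted semistandard tableau of shape $\lambda/\mu$ is a filling of the boxes by letters, weakly increasing along rows (left to right) and down columns, with no primed letter repeated in a row and no unprimed letter repeated in a column, whose row reading word (rows read left to right, concatenated from the bottom row to the top row) is in canonical form. $\mathrm{wt}(T)$ is the weight of the reading word. $\mathrm{ShST}(\lambda/\mu,n)$ is the set of shifted semistandard tableaux of shape $\lambda/\mu$ in the alphabet $\{1',1,\ldots,n',n\}$. Lattice walk. For a word $w=w_1\cdots w_m$ in $\{1',1,2',2\}$ define $P_k=(x_k,y_k)\in\mathbb{N}\times\mathbb{N}$ by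 $P_0=(0,0)$ and $P_k=P_{k-1}+(\text{step of } w_k)$. If $x_{k-1}y_{k-1}=0$ the step is $(1,0)$ for $w_k\in\{1',1\}$ and $(0,1)$ for $w_k\in\{2',2\}$. If $x_{k-1}y_{k-1}\ne0$ the step is $(1,0)$ for $1'$, $(0,-1)$ for $1$, $(-1,0)$ for $2'$, $(0,1)$ for $2$. (Independent of the representative.) The endpoint is $P_m$. Operators on words in $\{1',1,2',2\}$ (undefined is written $\varnothing$). $E'(w)$ is the unique word with $\mathrm{std}(E'(w))=\mathrm{std}(w)$ and $\mathrm{wt}(E'(w))=\mathrm{wt}(w)+(1,-1)$ if such a word exists, else $\varnothing$; $F'(w)$ is defined in the same way with $(-1,1)$ in place of $(1,-1)$. A substring $u=v_k\cdots v_l$ of consecutive letters of some representative $v$ of $w$ has location $(x,y)=P_{k-1}$. Write $a(b)^*c$ for a string $ab\cdots bc$ with zero or more $b$'s. The substring $u$ is $F$-critical if it is of one of the types: (1F) $u=1(1')^*2'$ with $y=0$, or with $y=1,x\ge1$; transformation $u\to2'(1')^*2$. (2F) $u=1(2)^*1'$ with $x=0$, or with $x=1,y\ge1$; transformation $u\to2'(2)^*1$. (3F) $u=1$ with $y=0$; $u\to2$. (4F) $u=1'$ with $x=0$; $u\to2'$. (5F) $u=1$ or $u=2'$ with $x=1,y\ge1$; transformation undefined. (The number of repeated letters is kept.) The final $F$-critical substring is the one, over all representatives, with the largest starting index, taking the longest in case of a tie (the only remaining tie is 3F/4F at the first letter of $w$, and then both give the same word). $F(w)$ is obtained by applying the transformation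 to the final $F$-critical substring (in its representative); $F(w)=\varnothing$ if it is of type 5F or no $F$-critical substring exists. Let $\eta(w)$ be the word obtained by replacing the letters of any representative by $1'\mapsto2$, $1\mapsto2'$, $2'\mapsto1$, $2\mapsto1'$. Define $E=\eta\circ F\circ\eta$. General alphabets. $E_i,F_i,E'_i,F'_i$ act on a word by applying $E,F,E',F'$ to the subword of letters $i',i,(i+1)',i+1$ (treated as $1',1,2',2$), leaving the other letters in place. They act on a tableau by acting on its row reading word and changing the entries in the corresponding boxes; this gives well-defined partial operators on $\mathrm{ShST}(\lambda/\mu,n)$. Auxiliary functions. $\mathrm{wt}(T)\in\mathbb{Z}^n$ is the weight, and $(\varphi_i(T),\varepsilon_i(T))$ is the endpoint $(x,y)$ of the lattice walk of the subword of the reading word of $T$ formed by the letters $i',i,(i+1)',i+1$ (treated as $1',1,2',2$). Kashiwara crystal for $\mathrm{GL}_n$: a nonempty set $\mathcal{B}$ with maps $e_i,f_i:\mathcal{B}\to\mathcal{B}\cup\{\varnothing\}$, $\varepsilon_i,\varphi_i:\mathcal{B}\to\mathbb{Z}\cup\{-\infty\}$ ($1\le i\le n-1$) and $\mathrm{wt}:\mathcal{B}\to\mathbb{Z}^n$ such that, with $\alpha_i$ the vector having $1$ in position $i$, $-1$ in position $i+1$ and $0$ elsewhere: (K1) for $X,Y\in\mathcal{B}$, $e_i(X)=Y$ iff $f_i(Y)=X$, and in this case $\varepsilon_i(Y)=\varepsilon_i(X)-1$, $\varphi_i(Y)=\varphi_i(X)+1$, $\mathrm{wt}(Y)=\mathrm{wt}(X)+\alpha_i$;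 (K2) $\varphi_i(X)=\langle\mathrm{wt}(X),\alpha_i\rangle+\varepsilon_i(X)$ with the standard dot product; (K3) $\varphi_i(X)=-\infty$ iff $\varepsilon_i(X)=-\infty$, and in that case $e_i(X)=f_i(X)=\varnothing$. *)

theory Defs
  imports Main "HOL-Library.Extended"
begin

section \<open>Letters and words\<close>

datatype letter = Primed (val: nat) | Unprimed (val: nat)

text \<open>The order is $1' < 1 < 2' < 2 < \ldots$\<close>

fun letter_rank :: "letter \<Rightarrow> nat" where
  "letter_rank (Primed i) = 2 * i"
| "letter_rank (Unprimed i) = 2 * i + 1"

instantiation letter :: linorder
begin

definition less_eq_letter :: "letter \<Rightarrow> letter \<Rightarrow> bool" where
  "a \<le> b \<longleftrightarrow> letter_rank a \<le> letter_rank b"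

definition less_letter :: "letter \<Rightarrow> letter \<Rightarrow> bool" where
  "a < b \<longleftrightarrow> letter_rank a < letter_rank b"

instance
proof
  fix a b :: letter
  assume "a \<le> b" and "b \<le> a"
  then have "letter_rank a = letter_rank b"
    by (simp add: less_eq_letter_def)
  then show "a = b"
    by (cases a; cases b; simp; presburger)
qed (auto simp: less_eq_letter_def less_letter_def)

end

definition canon :: "letter list \<Rightarrow> letter list" where
  "canon w = map (\<lambda>k. if \<exists>j<k. val (w ! j) = val (w ! k) then w ! k
                       else Unprimed (val (w ! k))) [0..<length w]"

text \<open>A word is represented by its canonical form. Two strings v, w represent the same word
  iff canon v = canon w.\<close>

definition is_word :: "letter list \<Rightarrow> bool" where
  "is_word w \<longleftrightarrow> canon w = w"

definition weight :: "letter list \<Rightarrow> nat \<Rightarrow> int" where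
  "weight w = (\<lambda>j. int (length (filter (\<lambda>a. val a = j) w)))"

text \<open>The vector with 1 in position i, -1 in position i + 1 and 0 elsewhere.\<close>

definition alpha :: "nat \<Rightarrow> nat \<Rightarrow> int" where
  "alpha i = (\<lambda>j. if j = i then 1 else if j = i + 1 then -1 else 0)"

text \<open>Position j of w is numbered before position k in the standardization.\<close>

definition std_before :: "letter list \<Rightarrow> nat \<Rightarrow> nat \<Rightarrow> bool" where
  "std_before w j k \<longleftrightarrow>
     w ! j < w ! k \<or> (w ! j = w ! k \<and> (if is_Primed (w ! k) then k < j else j < k))"

definition std :: "letter list \<Rightarrow> nat list" where
  "std w = map (\<lambda>k. Suc (card {j. j < length w \<and> std_before w j k})) [0..<length w]"


section \<open>Lattice walk\<close>

text \<open>Only meant for letters of value 1 or 2. The truncated subtractions below are only used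
  on positive numbers.\<close>

fun walk_step :: "nat \<times> nat \<Rightarrow> letter \<Rightarrow> nat \<times> nat" where
  "walk_step (x, y) a =
     (if x * y = 0
      then (if val a = 1 then (x + 1, y) else (x, y + 1))
      else (if a = Primed 1 then (x + 1, y)
            else if a = Unprimed 1 then (x, y - 1)
            else if a = Primed 2 then (x - 1, y)
            else (x, y + 1)))"

definition walk_end :: "letter list \<Rightarrow> nat \<times> nat" where
  "walk_end w = foldl walk_step (0, 0) w"


section \<open>Operators on words in the letters of value 1 and 2\<close>

definition E'_cand :: "letter list \<Rightarrow> letter list \<Rightarrow> bool" where
  "E'_cand w v \<longleftrightarrow> is_word v \<and> std v = std w \<and> weight v = (\<lambda>j. weight w j + alpha 1 j)"

definition F'_cand :: "letter list \<Rightarrow> letter list \<Rightarrow> bool" where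
  "F'_cand w v \<longleftrightarrow> is_word v \<and> std v = std w \<and> weight v = (\<lambda>j. weight w j - alpha 1 j)"

definition opE' :: "letter list \<Rightarrow> letter list option" where
  "opE' w = (if \<exists>v. E'_cand w v then Some (THE v. E'_cand w v) else None)"

definition opF' :: "letter list \<Rightarrow> letter list option" where
  "opF' w = (if \<exists>v. F'_cand w v then Some (THE v. F'_cand w v) else None)"

text \<open>F_crit (x, y) u t: the substring u with location (x, y) is F-critical and its
  transformation is t, where None stands for the undefined transformation of type 5F.\<close>

inductive F_crit :: "nat \<times> nat \<Rightarrow> letter list \<Rightarrow> letter list option \<Rightarrow> bool" where
  F1: "y = 0 \<or> (y = 1 \<and> x \<ge> 1) \<Longrightarrow>
       F_crit (x, y) (Unprimed 1 # replicate m (Primed 1) @ [Primed 2])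
                     (Some (Primed 2 # replicate m (Primed 1) @ [Unprimed 2]))"
| F2: "x = 0 \<or> (x = 1 \<and> y \<ge> 1) \<Longrightarrow>
       F_crit (x, y) (Unprimed 1 # replicate m (Unprimed 2) @ [Primed 1])
                     (Some (Primed 2 # replicate m (Unprimed 2) @ [Unprimed 1]))"
| F3: "y = 0 \<Longrightarrow> F_crit (x, y) [Unprimed 1] (Some [Unprimed 2])"
| F4: "x = 0 \<Longrightarrow> F_crit (x, y) [Primed 1] (Some [Primed 2])"
| F5: "x = 1 \<Longrightarrow> y \<ge> 1 \<Longrightarrow> u = Unprimed 1 \<or> u = Primed 2 \<Longrightarrow> F_crit (x, y) [u] None"

text \<open>F-critical substrings u of representatives p @ u @ s of the word w; the starting index
  is determined by the length of p.\<close>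

definition F_occ ::
  "letter list \<Rightarrow> letter list \<Rightarrow> letter list \<Rightarrow> letter list \<Rightarrow> letter list option \<Rightarrow> bool" where
  "F_occ w p u s t \<longleftrightarrow> canon (p @ u @ s) = canon w \<and> F_crit (walk_end p) u t"

definition F_final ::
  "letter list \<Rightarrow> letter list \<Rightarrow> letter list \<Rightarrow> letter list \<Rightarrow> letter list option \<Rightarrow> bool" where
  "F_final w p u s t \<longleftrightarrow> F_occ w p u s t \<and>
     (\<forall>p' u' s' t'. F_occ w p' u' s' t' \<longrightarrow>
        length p' < length p \<or> (length p' = length p \<and> length u' \<le> length u))"

text \<open>The same final substring may occur in several representatives, but the resulting word
  does not depend on this choice.\<close>

definition F_result :: "letter list \<Rightarrow> letter list \<Rightarrow> bool" where
  "F_result w v \<longleftrightarrow> (\<exists>p u s t. F_final w p u s (Some t) \<and> v = canon (p @ t @ s))"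

definition opF :: "letter list \<Rightarrow> letter list option" where
  "opF w = (if \<exists>v. F_result w v then Some (THE v. F_result w v) else None)"

text \<open>Only meant for letters of value 1 or 2.\<close>

definition eta_letter :: "letter \<Rightarrow> letter" where
  "eta_letter a =
     (if a = Primed 1 then Unprimed 2
      else if a = Unprimed 1 then Primed 2
      else if a = Primed 2 then Unprimed 1
      else Primed 1)"

definition eta :: "letter list \<Rightarrow> letter list" where
  "eta w = canon (map eta_letter w)"

definition opE :: "letter list \<Rightarrow> letter list option" where
  "opE w = map_option eta (opF (eta w))"


section \<open>General alphabets\<close>

fun shift_down :: "nat \<Rightarrow> letter \<Rightarrow> letter" where
  "shift_down i (Primed k) = Primed (k + 1 - i)"
| "shift_down i (Unprimed k) = Unprimed (k + 1 - i)"

fun shift_up :: "nat \<Rightarrow> letter \<Rightarrow> letter" where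
  "shift_up i (Primed k) = Primed (k + i - 1)"
| "shift_up i (Unprimed k) = Unprimed (k + i - 1)"

text \<open>The subword of the letters of value i and i + 1, relabelled to have values 1 and 2.\<close>

definition subword :: "nat \<Rightarrow> letter list \<Rightarrow> letter list" where
  "subword i w = map (shift_down i) (filter (\<lambda>a. val a \<in> {i, i + 1}) w)"

text \<open>The inverse operation: the letters of value i and i + 1 of w are replaced, in order,
  by the relabelled letters of v, and the other letters of w are kept.\<close>

fun replace_subword :: "nat \<Rightarrow> letter list \<Rightarrow> letter list \<Rightarrow> letter list" where
  "replace_subword i [] v = []"
| "replace_subword i (a # w) v =
     (if val a \<in> {i, i + 1} then shift_up i (hd v) # replace_subword i w (tl v)
      else a # replace_subword i w v)"

definition word_op ::
  "(letter list \<Rightarrow> letter list option) \<Rightarrow> nat \<Rightarrow> letter list \<Rightarrow> letter list option" where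
  "word_op A i w = map_option (replace_subword i w) (A (subword i w))"


section \<open>Shifted tableaux\<close>

definition strict_partition :: "nat list \<Rightarrow> bool" where
  "strict_partition l \<longleftrightarrow> sorted_wrt (>) l \<and> (\<forall>k\<in>set l. k > 0)"

text \<open>Boxes are pairs (row, column). Parts of a partition are numbered from 1, list entries
  from 0.\<close>

definition shifted_diagram :: "nat list \<Rightarrow> (nat \<times> nat) set" where
  "shifted_diagram l =
     {(r, c). 1 \<le> r \<and> r \<le> length l \<and> r \<le> c \<and> c \<le> r + l ! (r - 1) - 1}"

definition shifted_skew_shape :: "nat list \<Rightarrow> nat list \<Rightarrow> bool" where
  "shifted_skew_shape lam mu \<longleftrightarrow>
     strict_partition lam \<and> strict_partition mu \<and> shifted_diagram mu \<subseteq> shifted_diagram lam"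

definition skew_diagram :: "nat list \<Rightarrow> nat list \<Rightarrow> (nat \<times> nat) set" where
  "skew_diagram lam mu = shifted_diagram lam - shifted_diagram mu"

text \<open>The boxes of the skew diagram in reading order: rows from bottom to top, each row from
  left to right.\<close>

definition reading_boxes :: "nat list \<Rightarrow> nat list \<Rightarrow> (nat \<times> nat) list" where
  "reading_boxes lam mu =
     concat (map (\<lambda>r. filter (\<lambda>b. b \<in> skew_diagram lam mu)
                        (map (\<lambda>c. (r, c)) [r..<r + lam ! (r - 1)]))
                 (rev [1..<length lam + 1]))"

type_synonym filling = "nat \<times> nat \<Rightarrow> letter option"

definition reading_word :: "nat list \<Rightarrow> nat list \<Rightarrow> filling \<Rightarrow> letter list" where
  "reading_word lam mu T = map (\<lambda>b. the (T b)) (reading_boxes lam mu)"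

definition semistandard :: "nat list \<Rightarrow> nat list \<Rightarrow> filling \<Rightarrow> bool" where
  "semistandard lam mu T \<longleftrightarrow>
     dom T = skew_diagram lam mu \<and>
     (\<forall>r c c' a a'. T (r, c) = Some a \<and> T (r, c') = Some a' \<and> c < c' \<longrightarrow>
        a \<le> a' \<and> (a = a' \<longrightarrow> \<not> is_Primed a)) \<and>
     (\<forall>r r' c a a'. T (r, c) = Some a \<and> T (r', c) = Some a' \<and> r < r' \<longrightarrow>
        a \<le> a' \<and> (a = a' \<longrightarrow> is_Primed a)) \<and>
     is_word (reading_word lam mu T)"

definition ShST :: "nat list \<Rightarrow> nat list \<Rightarrow> nat \<Rightarrow> filling set" where
  "ShST lam mu n = {T. semistandard lam mu T \<and> (\<forall>a\<in>ran T. 1 \<le> val a \<and> val a \<le> n)}"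

definition tab_weight :: "nat list \<Rightarrow> nat list \<Rightarrow> filling \<Rightarrow> nat \<Rightarrow> int" where
  "tab_weight lam mu T = weight (reading_word lam mu T)"

definition tab_op ::
  "(letter list \<Rightarrow> letter list option) \<Rightarrow> nat list \<Rightarrow> nat list \<Rightarrow> nat \<Rightarrow> filling \<Rightarrow> filling option" where
  "tab_op A lam mu i T =
     map_option (\<lambda>v. map_of (zip (reading_boxes lam mu) v)) (word_op A i (reading_word lam mu T))"

definition tabE :: "nat list \<Rightarrow> nat list \<Rightarrow> nat \<Rightarrow> filling \<Rightarrow> filling option" where
  "tabE = tab_op opE"

definition tabF :: "nat list \<Rightarrow> nat list \<Rightarrow> nat \<Rightarrow> filling \<Rightarrow> filling option" where
  "tabF = tab_op opF"

definition tabE' :: "nat list \<Rightarrow> nat list \<Rightarrow> nat \<Rightarrow> filling \<Rightarrow> filling option" where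
  "tabE' = tab_op opE'"

definition tabF' :: "nat list \<Rightarrow> nat list \<Rightarrow> nat \<Rightarrow> filling \<Rightarrow> filling option" where
  "tabF' = tab_op opF'"

definition tab_phi :: "nat list \<Rightarrow> nat list \<Rightarrow> nat \<Rightarrow> filling \<Rightarrow> int extended" where
  "tab_phi lam mu i T = Fin (int (fst (walk_end (subword i (reading_word lam mu T)))))"

definition tab_eps :: "nat list \<Rightarrow> nat list \<Rightarrow> nat \<Rightarrow> filling \<Rightarrow> int extended" where
  "tab_eps lam mu i T = Fin (int (snd (walk_end (subword i (reading_word lam mu T)))))"


section \<open>Kashiwara crystals\<close>

text \<open>Vectors in $Z^n$ are functions vanishing outside of {1..n}, the undefined value of the
  partial maps is None, and the integers together with minus infinity are the elements of
  int extended other than Pinf.\<close>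

definition kashiwara_crystal_GL ::
  "nat \<Rightarrow> 'b set \<Rightarrow> (nat \<Rightarrow> 'b \<Rightarrow> 'b option) \<Rightarrow> (nat \<Rightarrow> 'b \<Rightarrow> 'b option) \<Rightarrow>
   (nat \<Rightarrow> 'b \<Rightarrow> int extended) \<Rightarrow> (nat \<Rightarrow> 'b \<Rightarrow> int extended) \<Rightarrow> ('b \<Rightarrow> nat \<Rightarrow> int) \<Rightarrow> bool" where
  "kashiwara_crystal_GL n \<B> e f eps phi wt \<longleftrightarrow>
     \<B> \<noteq> {} \<and>
     \<comment> \<open>the maps have the required codomains\<close>
     (\<forall>X\<in>\<B>. \<forall>j. j \<notin> {1..n} \<longrightarrow> wt X j = 0) \<and>
     (\<forall>i\<in>{1..<n}. \<forall>X\<in>\<B>. set_option (e i X) \<subseteq> \<B> \<and> set_option (f i X) \<subseteq> \<B> \<and>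
        eps i X \<noteq> Pinf \<and> phi i X \<noteq> Pinf) \<and>
     \<comment> \<open>(K1)\<close>
     (\<forall>i\<in>{1..<n}. \<forall>X\<in>\<B>. \<forall>Y\<in>\<B>.
        (e i X = Some Y \<longleftrightarrow> f i Y = Some X) \<and>
        (e i X = Some Y \<longrightarrow>
           eps i Y = eps i X - 1 \<and> phi i Y = phi i X + 1 \<and> wt Y = (\<lambda>j. wt X j + alpha i j))) \<and>
     \<comment> \<open>(K2)\<close>
     (\<forall>i\<in>{1..<n}. \<forall>X\<in>\<B>. phi i X = Fin (\<Sum>j\<in>{1..n}. wt X j * alpha i j) + eps i X) \<and>
     \<comment> \<open>(K3)\<close>
     (\<forall>i\<in>{1..<n}. \<forall>X\<in>\<B>. (phi i X = Minf \<longleftrightarrow> eps i X = Minf) \<and>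
        (phi i X = Minf \<longrightarrow> e i X = None \<and> f i X = None))"

end

(* The operators act on words only, so everything is reduced to words in 1', 1, 2', 2.

   Reading the letters after the final F-critical substring, the walks of w and of F(w) stay
   displaced by (-1, 1) (relation chain). A chain for (w, v) is turned by eta into a chain for
   (eta v, eta w); since a chain conversely determines the final critical substring, E inverts F.
   F' replaces a letter 1 by 2' when only letters 1' and 2 follow; comparing the position of this
   letter with the final critical substring shows that F and F' commute when both are defined,
   or else that both composites are undefined, and the commutation of the other pairs follows by
   inverting or by eta.

   A filling is semistandard iff the standardization of its reading word increases along rows and
   down columns. This is automatic for F'. For F only the one or two changed boxes have to be
   inspected; the one dangerous configuration is two adjacent rows in which 2's lie below 1's, and
   there counting the 2's of the lower row against the 1's of the upper row forces the height of
   the walk to be incompatible with the critical location. *)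

theory Submission
  imports Defs
begin

text \<open>The letters 1' and 2 make the same step at every point. The letters 1 and 2' make the
  same step at (x, y) and (x - 1, y + 1) once both points are off the axes, that is for x \<ge> 2
  and y \<ge> 1. This is the origin of the bounds in \<open>ext_ok\<close> and of the recurring set
  \<open>{P1, L2}\<close>; type 5F catches a letter that would tear the displaced walks apart. The
  obstacle on words is that a critical substring may be visible only in one of several
  representatives. The operators are therefore replaced by their graphs \<open>Rel\<close> and
  \<open>FP\<close>, which are invariant under \<open>canon\<close>, and each argument picks its
  representative. Among the letters that keep the walks displaced, only a first letter of value 2,
  or dually a first letter of value 1 of the image, makes another substring the final one. The
  obstacle on tableaux is that eta does not act on fillings. So nothing about E follows from F by
  symmetry there, and each type of critical substring is examined twice: once for applying the
  transformation and once for undoing it.\<close>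

declare One_nat_def [simp del]

section \<open>Words and canonical forms\<close>

abbreviation P1 :: letter where "P1 \<equiv> Primed 1"
abbreviation L1 :: letter where "L1 \<equiv> Unprimed 1"
abbreviation P2 :: letter where "P2 \<equiv> Primed 2"
abbreviation L2 :: letter where "L2 \<equiv> Unprimed 2"

definition letters12 :: "letter set" where "letters12 = {P1, L1, P2, L2}"

lemma letters12_iff: "a \<in> letters12 \<longleftrightarrow> val a \<in> {1, 2}"
  by (cases a) (auto simp: letters12_def)

lemma val_letters12: "set w \<subseteq> letters12 \<longleftrightarrow> val ` set w \<subseteq> {1, 2}"
  by (auto simp: letters12_iff)

text \<open>\<open>S\<close> holds the values that have occurred further left. This makes the
  canonical form compositional: a suffix needs to know only the value set of its prefix, which is
  the same for all representatives.\<close>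

fun canon_from :: "nat set \<Rightarrow> letter list \<Rightarrow> letter list" where
  "canon_from S [] = []"
| "canon_from S (a # w) =
     (if val a \<in> S then a else Unprimed (val a)) # canon_from (insert (val a) S) w"

lemma length_canon_from [simp]: "length (canon_from S w) = length w"
  by (induction w arbitrary: S) auto

lemma nth_canon_from:
  "k < length w \<Longrightarrow> canon_from S w ! k =
     (if val (w ! k) \<in> S \<or> (\<exists>j<k. val (w ! j) = val (w ! k)) then w ! k
      else Unprimed (val (w ! k)))"
proof (induction w arbitrary: S k)
  case (Cons a w)
  show ?case
  proof (cases k)
    case (Suc k')
    then show ?thesis using Cons.IH[of k' "insert (val a) S"] Cons.prems
      by (auto simp: Ex_less_Suc2)
  qed auto
qed simp

lemma canon_conv: "canon w = canon_from {} w"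
  by (rule nth_equalityI) (auto simp: canon_def nth_canon_from)

lemma canon_from_append:
  "canon_from S (u @ v) = canon_from S u @ canon_from (S \<union> val ` set u) v"
  by (induction u arbitrary: S) auto

lemma map_val_canon_from [simp]: "map val (canon_from S w) = map val w"
  by (induction w arbitrary: S) auto

lemma val_set_canon_from [simp]: "val ` set (canon_from S w) = val ` set w"
  by (metis list.set_map map_val_canon_from)

lemma canon_from_full: "val ` set w \<subseteq> S \<Longrightarrow> canon_from S w = w"
proof (induction w arbitrary: S)
  case (Cons a w)
  then have "canon_from (insert (val a) S) w = w" by (intro Cons.IH) auto
  with Cons.prems show ?case by simp
qed simp

lemma canon_from_canon_from: "S \<subseteq> S' \<Longrightarrow> canon_from S (canon_from S' w) = canon_from S w"
proof (induction w arbitrary: S S')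
  case (Cons a w)
  then have "canon_from (insert (val a) S) (canon_from (insert (val a) S') w)
      = canon_from (insert (val a) S) w"
    by (intro Cons.IH) auto
  with Cons.prems show ?case by auto
qed simp

lemma canon_idem [simp]: "canon (canon w) = canon w"
  by (simp add: canon_conv canon_from_canon_from)

lemma length_canon [simp]: "length (canon w) = length w"
  by (simp add: canon_conv)

lemma map_val_canon [simp]: "map val (canon w) = map val w"
  by (simp add: canon_conv)

lemma val_set_canon [simp]: "val ` set (canon w) = val ` set w"
  by (simp add: canon_conv)

lemma is_word_canon [simp]: "is_word (canon w)"
  by (simp add: is_word_def)

lemma canon_length_eq: "canon w = canon v \<Longrightarrow> length w = length v"
  by (metis length_canon)

lemma canon_val_eq: "canon w = canon v \<Longrightarrow> map val w = map val v"
  by (metis map_val_canon)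

lemma canon_val_set_eq: "canon w = canon v \<Longrightarrow> val ` set w = val ` set v"
  by (metis val_set_canon)

lemma canon_letters12: "canon w = canon v \<Longrightarrow> set w \<subseteq> letters12 \<Longrightarrow> set v \<subseteq> letters12"
  by (metis canon_val_set_eq val_letters12)

text \<open>The two halves can be tested separately because equivalent prefixes have the same set of
  values, and nothing else of the prefix matters for the suffix.\<close>

lemma canon_append_iff:
  assumes "length u = length u'"
  shows "canon (u @ v) = canon (u' @ v') \<longleftrightarrow>
    canon u = canon u' \<and> canon_from (val ` set u) v = canon_from (val ` set u) v'"
proof -
  have "canon u = canon u' \<Longrightarrow> val ` set u = val ` set u'"
    by (rule canon_val_set_eq)
  with assms show ?thesis by (auto simp: canon_conv canon_from_append)
qed

lemma canon_append_cong: "canon u = canon u' \<Longrightarrow> canon (u @ v) = canon (u' @ v)"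
  using canon_append_iff[OF canon_length_eq, of u u'] canon_val_set_eq[of u u'] by auto

text \<open>The elementary change of representative, at the first letter of some value.\<close>

lemma canon_letter_cong:
  "val a = val b \<Longrightarrow> val a \<notin> val ` set u \<Longrightarrow> canon (u @ a # v) = canon (u @ b # v)"
  by (simp add: canon_append_iff)

lemma canon_split_last:
  assumes "canon (u @ [a]) = canon (v @ [b])"
  shows "canon u = canon v" "val a = val b" "val a \<in> val ` set u \<Longrightarrow> a = b"
proof -
  have l: "length u = length v" using canon_length_eq[OF assms] by simp
  show "canon u = canon v" using assms l by (simp add: canon_append_iff)
  have "canon_from (val ` set u) [a] = canon_from (val ` set u) [b]"
    using assms l by (simp add: canon_append_iff)
  then show "val a = val b" "val a \<in> val ` set u \<Longrightarrow> a = b"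
    by (auto split: if_splits)
qed

lemma canon_nth_eq:
  assumes "canon w = canon v" "k < length w" "j < k" "val (w ! j) = val (w ! k)"
  shows "v ! k = w ! k"
proof -
  have l: "length w = length v" using canon_length_eq[OF assms(1)] .
  have mv: "map val w = map val v" using canon_val_eq[OF assms(1)] .
  then have vi: "val (v ! i) = val (w ! i)" if "i < length w" for i
    using that l by (metis nth_map)
  have "canon w ! k = w ! k" using assms(2-) by (auto simp: canon_conv nth_canon_from)
  moreover have "canon v ! k = v ! k"
    using assms(2-) vi[of j] vi[of k] l by (auto simp: canon_conv nth_canon_from)
  ultimately show ?thesis using assms(1) by metis
qed

lemma canon_nth_val:
  assumes "canon w = canon v" "k < length w"
  shows "val (v ! k) = val (w ! k)"
  using canon_val_eq[OF assms(1)] canon_length_eq[OF assms(1)] assms(2) by (metis nth_map)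

lemma canon_take: "canon w = canon v \<Longrightarrow> canon (take k w) = canon (take k v)"
  using canon_append_iff[of "take k w" "take k v" "drop k w" "drop k v"] canon_length_eq[of w v]
  by simp

section \<open>The walk\<close>

lemma walk_end_Nil [simp]: "walk_end [] = (0, 0)"
  by (simp add: walk_end_def)

lemma walk_end_append: "walk_end (u @ v) = foldl walk_step (walk_end u) v"
  by (simp add: walk_end_def)

lemma foldl_walk_P1 [simp]: "foldl walk_step (x, y) (replicate m P1) = (x + m, y)"
  by (induction m arbitrary: x) auto

lemma foldl_walk_L2 [simp]: "foldl walk_step (x, y) (replicate m L2) = (x, y + m)"
  by (induction m arbitrary: y) auto

text \<open>Representatives differ only at the first letter of a value. Before it is read the
  corresponding coordinate is 0, and on an axis the step depends on the value alone. The hypotheses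
  on \<open>S\<close> and \<open>P\<close> carry this through the induction.\<close>

lemma foldl_walk_canon:
  assumes "set w \<subseteq> letters12" "1 \<notin> S \<longrightarrow> fst P = 0" "2 \<notin> S \<longrightarrow> snd P = 0"
  shows "foldl walk_step P (canon_from S w) = foldl walk_step P w"
  using assms
proof (induction w arbitrary: S P)
  case (Cons a w)
  obtain x y where P: "P = (x, y)" by (cases P)
  have a: "a \<in> letters12" using Cons.prems by simp
  have s: "walk_step P (if val a \<in> S then a else Unprimed (val a)) = walk_step P a"
    using a Cons.prems by (auto simp: P letters12_def)
  have "foldl walk_step (walk_step P a) (canon_from (insert (val a) S) w)
      = foldl walk_step (walk_step P a) w"
    using Cons.prems a by (intro Cons.IH) (auto simp: P letters12_def)
  with s show ?case by simp
qed simp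

lemma walk_end_canon: "set w \<subseteq> letters12 \<Longrightarrow> walk_end (canon w) = walk_end w"
  by (simp add: canon_conv walk_end_def foldl_walk_canon)

lemma walk_end_eqv: "canon w = canon v \<Longrightarrow> set w \<subseteq> letters12 \<Longrightarrow> walk_end v = walk_end w"
  by (metis canon_letters12 walk_end_canon)

lemma walk_end_val:
  assumes "set w \<subseteq> letters12"
  shows "fst (walk_end w) > 0 \<Longrightarrow> 1 \<in> val ` set w"
    and "snd (walk_end w) > 0 \<Longrightarrow> 2 \<in> val ` set w"
proof -
  have "(fst (walk_end w) > 0 \<longrightarrow> 1 \<in> val ` set w) \<and> (snd (walk_end w) > 0 \<longrightarrow> 2 \<in> val ` set w)"
    using assms
  proof (induction w rule: rev_induct)
    case (snoc a w)
    obtain x y where P: "walk_end w = (x, y)" by (cases "walk_end w")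
    show ?case using snoc by (auto simp: walk_end_append P letters12_def)
  qed simp
  then show "fst (walk_end w) > 0 \<Longrightarrow> 1 \<in> val ` set w"
    and "snd (walk_end w) > 0 \<Longrightarrow> 2 \<in> val ` set w" by auto
qed

text \<open>The walk cannot return to the origin: a decreasing step starts off the axes and changes
  only one coordinate. Later this turns the location (0, 0) into an empty prefix.\<close>

lemma walk_end_origin: "set w \<subseteq> letters12 \<Longrightarrow> walk_end w = (0, 0) \<longleftrightarrow> w = []"
proof (induction w rule: rev_induct)
  case (snoc a w)
  obtain x y where P: "walk_end w = (x, y)" by (cases "walk_end w")
  show ?case using snoc by (auto simp: walk_end_append P letters12_def)
qed simp

lemma walk_end_no_val:
  assumes "set w \<subseteq> letters12"
  shows "1 \<notin> val ` set w \<Longrightarrow> fst (walk_end w) = 0"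
    and "2 \<notin> val ` set w \<Longrightarrow> snd (walk_end w) = 0"
  using walk_end_val[OF assms] by auto

section \<open>The involution eta\<close>

lemma eta_letter_simps [simp]:
  "eta_letter P1 = L2" "eta_letter L1 = P2" "eta_letter P2 = L1" "eta_letter L2 = P1"
  by (auto simp: eta_letter_def)

abbreviation etas :: "letter list \<Rightarrow> letter list" where "etas \<equiv> map eta_letter"

lemma eta_letter_invol: "a \<in> letters12 \<Longrightarrow> eta_letter (eta_letter a) = a"
  by (auto simp: letters12_def)

lemma eta_letter_letters12 [simp]: "eta_letter a \<in> letters12"
  by (auto simp: letters12_def eta_letter_def)

lemma etas_letters12 [simp]: "set (etas w) \<subseteq> letters12"
  by auto

lemma etas_invol: "set w \<subseteq> letters12 \<Longrightarrow> etas (etas w) = w"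
  by (induction w) (auto simp: eta_letter_invol)

text \<open>\<open>eta_letter\<close> exchanges the values 1 and 2, so the set of values seen is
  mapped by \<open>(-) 3\<close>. Re-priming a first letter becomes re-priming a first letter of the
  other value, which the outer canonical form undoes.\<close>

lemma canon_from_etas:
  assumes "set w \<subseteq> letters12" "S \<subseteq> {1, 2}"
  shows "canon_from ((-) 3 ` S) (etas (canon_from S w)) = canon_from ((-) 3 ` S) (etas w)"
  using assms
proof (induction w arbitrary: S)
  case (Cons a w)
  have a: "a \<in> letters12" using Cons.prems by simp
  then have S': "insert (val a) S \<subseteq> {1, 2}" using Cons.prems by (simp add: letters12_iff)
  have IH: "canon_from ((-) 3 ` insert (val a) S) (etas (canon_from (insert (val a) S) w))
    = canon_from ((-) 3 ` insert (val a) S) (etas w)"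
    using Cons.IH[OF _ S'] Cons.prems by simp
  have v: "val (eta_letter (Unprimed (val a))) = 3 - val a" "val (eta_letter a) = 3 - val a"
    using a by (auto simp: letters12_def)
  show ?case
  proof (cases "val a \<in> S")
    case True
    then show ?thesis using IH v by simp
  next
    case False
    then have "3 - val a \<notin> (-) 3 ` S"
      using Cons.prems(2) a by (auto simp: letters12_iff)
    with False show ?thesis using IH v by simp
  qed
qed simp

lemma canon_etas: "set w \<subseteq> letters12 \<Longrightarrow> canon (etas (canon w)) = canon (etas w)"
  using canon_from_etas[of w "{}"] by (simp add: canon_conv)

lemma canon_etas_cong:
  "canon w = canon v \<Longrightarrow> set w \<subseteq> letters12 \<Longrightarrow> canon (etas w) = canon (etas v)"
  by (metis canon_etas canon_letters12)

lemma eta_letters12: "set (eta w) \<subseteq> letters12"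
  unfolding eta_def by (rule canon_letters12[OF canon_idem[symmetric] etas_letters12])

lemma is_word_eta [simp]: "is_word (eta w)"
  by (simp add: eta_def)

lemma eta_invol: "set w \<subseteq> letters12 \<Longrightarrow> is_word w \<Longrightarrow> eta (eta w) = w"
  using canon_etas[OF etas_letters12, of w] by (simp add: eta_def etas_invol is_word_def del: map_map)

lemma walk_end_etas:
  "set w \<subseteq> letters12 \<Longrightarrow> walk_end (etas w) = (snd (walk_end w), fst (walk_end w))"
proof (induction w rule: rev_induct)
  case (snoc a w)
  obtain x y where P: "walk_end w = (x, y)" by (cases "walk_end w")
  show ?case using snoc by (auto simp: walk_end_append P letters12_def)
qed simp

section \<open>Chains\<close>

text \<open>The letter a can follow the representative w, which F has turned into v, without ending a
  new critical substring. The conditions on the values of w and v take care of a first letter of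
  value 2 that can also be read as primed, and of substrings of type 2F starting with the only
  letter of value 1.\<close>

definition ext_ok :: "letter list \<Rightarrow> letter list \<Rightarrow> letter \<Rightarrow> bool" where
  "ext_ok w v a \<longleftrightarrow>
     a = L2 \<and> (snd (walk_end w) \<ge> 1 \<or> 2 \<in> val ` set w)
   \<or> a = P1 \<and> (fst (walk_end w) \<ge> 2 \<or> 1 \<in> val ` set v)
   \<or> (a = L1 \<or> a = P2) \<and> fst (walk_end w) \<ge> 2 \<and> snd (walk_end w) \<ge> 1"

text \<open>The critical substring u of p @ u @ s, with transformation t, is the final one.\<close>

inductive chain :: "letter list \<Rightarrow> letter list \<Rightarrow> letter list \<Rightarrow> letter list \<Rightarrow> bool" where
  chain_base: "set p \<subseteq> letters12 \<Longrightarrow> F_crit (walk_end p) u (Some t) \<Longrightarrow> chain p u t []"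
| chain_ext: "chain p u t s \<Longrightarrow> ext_ok (p @ u @ s) (p @ t @ s) a \<Longrightarrow> chain p u t (s @ [a])"

lemma chain_snoc_iff:
  "chain p u t (s @ [a]) \<longleftrightarrow> chain p u t s \<and> ext_ok (p @ u @ s) (p @ t @ s) a"
  by (auto intro: chain_ext elim: chain.cases)

lemma chain_prefix: "chain p u t (s @ s') \<Longrightarrow> chain p u t s"
proof (induction s' rule: rev_induct)
  case (snoc a s')
  then show ?case using chain_snoc_iff[of p u t "s @ s'" a] by simp
qed simp

lemma chain_ext_ok: "chain p u t (s @ a # s') \<Longrightarrow> ext_ok (p @ u @ s) (p @ t @ s) a"
  using chain_prefix[of p u t "s @ [a]" s'] by (simp add: chain_snoc_iff)

lemma chain_crit: "chain p u t s \<Longrightarrow> set p \<subseteq> letters12 \<and> F_crit (walk_end p) u (Some t)"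
  by (induction rule: chain.induct) auto

lemma F_crit_cases [consumes 1, case_names F1 F2 F3 F4]:
  assumes "F_crit P u (Some t)"
  obtains m where "snd P = 0 \<or> snd P = 1 \<and> fst P \<ge> 1"
      "u = L1 # replicate m P1 @ [P2]" "t = P2 # replicate m P1 @ [L2]"
  | m where "fst P = 0 \<or> fst P = 1 \<and> snd P \<ge> 1"
      "u = L1 # replicate m L2 @ [P1]" "t = P2 # replicate m L2 @ [L1]"
  | "snd P = 0" "u = [L1]" "t = [L2]"
  | "fst P = 0" "u = [P1]" "t = [P2]"
  using assms by (cases rule: F_crit.cases) (auto simp: One_nat_def)

lemma F_crit_intros:
  "snd P = 0 \<or> snd P = 1 \<and> fst P \<ge> 1 \<Longrightarrow>
     F_crit P (L1 # replicate m P1 @ [P2]) (Some (P2 # replicate m P1 @ [L2]))"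
  "fst P = 0 \<or> fst P = 1 \<and> snd P \<ge> 1 \<Longrightarrow>
     F_crit P (L1 # replicate m L2 @ [P1]) (Some (P2 # replicate m L2 @ [L1]))"
  "snd P = 0 \<Longrightarrow> F_crit P [L1] (Some [L2])"
  "fst P = 0 \<Longrightarrow> F_crit P [P1] (Some [P2])"
  "fst P = 1 \<Longrightarrow> snd P \<ge> 1 \<Longrightarrow> a = L1 \<or> a = P2 \<Longrightarrow> F_crit P [a] None"
  by (cases P; simp add: F_crit.intros)+

lemma F_crit_length: "F_crit P u (Some t) \<Longrightarrow> length t = length u \<and> u \<noteq> []"
  by (cases rule: F_crit_cases) auto

lemma F_crit_letters12:
  "F_crit P u (Some t) \<Longrightarrow> set u \<subseteq> letters12 \<and> set t \<subseteq> letters12"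
  by (cases rule: F_crit_cases) (auto simp: letters12_def)

lemma F_crit_val1: "F_crit P u (Some t) \<Longrightarrow> 1 \<in> val ` set u"
  by (cases rule: F_crit_cases) auto

lemma ext_ok_letters12: "ext_ok w v a \<Longrightarrow> a \<in> letters12"
  by (auto simp: ext_ok_def letters12_def)

lemma chain_letters12:
  "chain p u t s \<Longrightarrow> set p \<subseteq> letters12 \<and> set u \<subseteq> letters12 \<and> set t \<subseteq> letters12 \<and> set s \<subseteq> letters12"
proof (induction rule: chain.induct)
  case (chain_base p u t)
  then show ?case using F_crit_letters12 by auto
next
  case (chain_ext p u t s a)
  then show ?case using ext_ok_letters12 by auto
qed

lemma F_crit_walk:
  assumes "F_crit P u (Some t)"
  shows "\<exists>x y. foldl walk_step P u = (Suc x, y) \<and> foldl walk_step P t = (x, Suc y)"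
proof -
  obtain x y where P: "P = (x, y)" by (cases P)
  from assms show ?thesis
  proof (cases rule: F_crit_cases)
    case (F1 m)
    then consider "y = 0" | x' where "y = 1" "x = Suc x'" by (cases x) (auto simp: P)
    then show ?thesis by cases (auto simp: P F1)
  next
    case (F2 m)
    then consider "x = 0" | y' where "x = 1" "y = Suc y'" by (cases y) (auto simp: P)
    then show ?thesis by cases (auto simp: P F2)
  next
    case F3
    then show ?thesis by (auto simp: P)
  next
    case F4
    then show ?thesis by (auto simp: P)
  qed
qed

text \<open>The part of \<open>ext_ok\<close> that concerns the walk alone: for x > 0 the letter
  makes the same step at \<open>P\<close> = (x, y) and at the point displaced by (-1, 1).\<close>

definition wide :: "nat \<times> nat \<Rightarrow> letter \<Rightarrow> bool" where
  "wide P a \<longleftrightarrow> a = L2 \<or> a = P1 \<or> (a = L1 \<or> a = P2) \<and> fst P \<ge> 2 \<and> snd P \<ge> 1"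

lemma ext_ok_wide: "ext_ok w v a \<Longrightarrow> wide (walk_end w) a"
  by (auto simp: ext_ok_def wide_def)

lemma wide_walk:
  assumes "wide (Suc x, y) a"
  shows "\<exists>x' y'. walk_step (Suc x, y) a = (Suc x', y') \<and> walk_step (x, Suc y) a = (x', Suc y')"
  using assms unfolding wide_def by (cases x; cases y) auto

lemma chain_walk:
  "chain p u t s \<Longrightarrow>
     \<exists>x y. walk_end (p @ u @ s) = (Suc x, y) \<and> walk_end (p @ t @ s) = (x, Suc y)"
proof (induction rule: chain.induct)
  case (chain_base p u t)
  then show ?case using F_crit_walk by (simp add: walk_end_append)
next
  case (chain_ext p u t s a)
  then obtain x y where *: "walk_end (p @ u @ s) = (Suc x, y)" "walk_end (p @ t @ s) = (x, Suc y)"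
    by blast
  have "wide (Suc x, y) a" using ext_ok_wide[OF chain_ext.hyps(2)] * by simp
  from wide_walk[OF this] * show ?case
    by (simp add: walk_end_append)
qed

text \<open>Conjugation exchanges the types 1F and 2F, and the types 3F and 4F, with substring and
  transformation trading places; reflecting the location matches their conditions.\<close>

lemma F_crit_eta:
  assumes "F_crit (x, y) u (Some t)"
  shows "F_crit (y, x) (etas t) (Some (etas u))"
  using assms
proof (cases rule: F_crit_cases)
  case (F1 m)
  then show ?thesis using F_crit.F2[of y x m] by (auto simp: map_replicate)
next
  case (F2 m)
  then show ?thesis using F_crit.F1[of x y m] by (auto simp: map_replicate)
next
  case F3
  then show ?thesis using F_crit.F4[of y x] by simp
next
  case F4
  then show ?thesis using F_crit.F3[of x y] by simp
qed

lemma val_etas: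
  assumes "set w \<subseteq> letters12"
  shows "1 \<in> val ` set w \<Longrightarrow> 2 \<in> val ` set (etas w)"
    and "2 \<in> val ` set w \<Longrightarrow> 1 \<in> val ` set (etas w)"
proof -
  have "(1 \<in> val ` set w \<longrightarrow> 2 \<in> val ` set (etas w)) \<and> (2 \<in> val ` set w \<longrightarrow> 1 \<in> val ` set (etas w))"
    using assms by (induction w) (auto simp: letters12_def)
  then show "1 \<in> val ` set w \<Longrightarrow> 2 \<in> val ` set (etas w)"
    and "2 \<in> val ` set w \<Longrightarrow> 1 \<in> val ` set (etas w)" by blast+
qed

text \<open>The unequal bounds, 2 for x and 1 for y, refer to the walk of \<open>w\<close>; at the
  displaced walk of \<open>v\<close> they are interchanged by the reflection. So are the two
  conditions on values, which is why one of them refers to \<open>w\<close> and the other to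
  \<open>v\<close>.\<close>

lemma ext_ok_eta:
  assumes l: "set w \<subseteq> letters12" "set v \<subseteq> letters12"
    and walks: "walk_end w = (Suc x, y)" "walk_end v = (x, Suc y)"
    and ok: "ext_ok w v a"
  shows "ext_ok (etas v) (etas w) (eta_letter a)"
proof -
  have e: "walk_end (etas v) = (Suc y, x)" using walk_end_etas[OF l(2)] walks by simp
  from ok consider "a = L2" "y \<ge> 1 \<or> 2 \<in> val ` set w" | "a = P1" "x \<ge> 1 \<or> 1 \<in> val ` set v"
    | "a = L1 \<or> a = P2" "x \<ge> 1" "y \<ge> 1"
    unfolding ext_ok_def walks by fastforce
  then show ?thesis
  proof cases
    case 1
    then show ?thesis unfolding ext_ok_def e using val_etas[OF l(1)] by fastforce
  next
    case 2
    then show ?thesis unfolding ext_ok_def e using val_etas[OF l(2)] by fastforce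
  next
    case 3
    then show ?thesis unfolding ext_ok_def e by auto
  qed
qed

text \<open>Conjugation by eta exchanges the two words of a chain: this is why E inverts F.\<close>

lemma chain_eta: "chain p u t s \<Longrightarrow> chain (etas p) (etas t) (etas u) (etas s)"
proof (induction rule: chain.induct)
  case (chain_base p u t)
  then show ?case
    using F_crit_eta[of "fst (walk_end p)" "snd (walk_end p)" u t]
    by (auto intro!: chain.chain_base simp: walk_end_etas)
next
  case (chain_ext p u t s a)
  have l: "set (p @ u @ s) \<subseteq> letters12" "set (p @ t @ s) \<subseteq> letters12"
    using chain_letters12[OF chain_ext.hyps(1)] by auto
  obtain x y where "walk_end (p @ u @ s) = (Suc x, y)" "walk_end (p @ t @ s) = (x, Suc y)"
    using chain_walk[OF chain_ext.hyps(1)] by blast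
  from ext_ok_eta[OF l this chain_ext.hyps(2)] chain_ext.IH show ?case
    using chain.chain_ext[of "etas p" "etas t" "etas u" "etas s"] by simp
qed

section \<open>The operators F and E\<close>

text \<open>Once the first letter of a critical substring has been read, the walk is off the y-axis.
  So no substring that needs a location on this axis can start inside it.\<close>

lemma F_crit_take_pos:
  assumes "F_crit P u (Some t)" "k \<ge> 1"
  shows "fst (foldl walk_step P (take k u)) \<ge> 1"
proof -
  obtain x y where P: "P = (x, y)" by (cases P)
  obtain j where k: "k = Suc j" using assms(2) by (cases k) auto
  from assms(1) show ?thesis
  proof (cases rule: F_crit_cases)
    case (F1 m)
    have "take k u = L1 # replicate (min j m) P1 @ take (j - m) [P2]"
      by (simp add: k F1(2))
    moreover have "take (j - m) [P2] = [] \<or> take (j - m) [P2] = [P2]" by (cases "j - m") auto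
    ultimately show ?thesis using F1(1) by (auto simp: P)
  next
    case (F2 m)
    have "take k u = L1 # replicate (min j m) L2 @ take (j - m) [P1]"
      by (simp add: k F2(2))
    moreover have "take (j - m) [P1] = [] \<or> take (j - m) [P1] = [P1]" by (cases "j - m") auto
    ultimately show ?thesis using F2(1) by (auto simp: P)
  next
    case F3
    then show ?thesis by (simp add: P k)
  next
    case F4
    then show ?thesis by (simp add: P k)
  qed
qed

lemma chain_take_pos:
  assumes "chain p u t s" "length p < k"
  shows "fst (walk_end (take k (p @ u @ s))) \<ge> 1"
proof (cases "k \<le> length p + length u")
  case True
  then have "take k (p @ u @ s) = p @ take (k - length p) u" using assms(2) by simp
  moreover have "fst (walk_end (p @ take (k - length p) u)) \<ge> 1"
    using F_crit_take_pos[of "walk_end p" u t "k - length p"] chain_crit[OF assms(1)] assms(2)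
    by (simp add: walk_end_append)
  ultimately show ?thesis by metis
next
  case False
  define j where "j = k - length p - length u"
  have "chain p u t (take j s)" using chain_prefix[of p u t "take j s" "drop j s"] assms(1) by simp
  from chain_walk[OF this] have "fst (walk_end (p @ u @ take j s)) \<ge> 1" by auto
  moreover have "take k (p @ u @ s) = p @ u @ take j s" using False by (simp add: j_def)
  ultimately show ?thesis by metis
qed

lemma F_crit_start:
  assumes "F_crit (x, y) (c # r) t"
  shows "c = L1 \<or> c = P1 \<and> x = 0 \<or> c = P2 \<and> x = 1 \<and> y \<ge> 1"
  using assms by (cases rule: F_crit.cases) auto

lemma canon_middle:
  assumes "canon (p @ c # r) = canon (q @ b # r')" "length p = length q"
  shows "canon p = canon q" "val c = val b" "val c \<in> val ` set q \<Longrightarrow> c = b"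
proof -
  have "canon (p @ [c]) = canon (q @ [b])"
    using canon_take[OF assms(1), of "Suc (length p)"] assms(2) by simp
  note s = canon_split_last[OF this]
  show "canon p = canon q" "val c = val b" by (rule s)+
  show "val c \<in> val ` set q \<Longrightarrow> c = b" using s(3) canon_val_set_eq[OF s(1)] by blast
qed

text \<open>Locates the critical substrings of all representatives by the letters of a fixed one. At
  x \<ge> 1 the value 1 has occurred, so a letter of value 1 is the same in both; a starting 2'
  belongs to type 5F, where y \<ge> 1 shows that the value 2 has occurred as well.\<close>

lemma F_crit_no_start:
  assumes "canon (p @ c # r) = canon (q @ b # r')" "length p = length q"
    and "set q \<subseteq> letters12" "fst (walk_end q) \<ge> 1"
    and "F_crit (walk_end p) (c # r0) t"
  shows "b = L1 \<or> b = P2 \<and> snd (walk_end q) \<ge> 1"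
proof -
  note m = canon_middle[OF assms(1,2)]
  have w: "walk_end p = walk_end q" using walk_end_eqv[OF m(1)[symmetric] assms(3)] .
  have v1: "1 \<in> val ` set q" using walk_end_val(1)[OF assms(3)] assms(4) by auto
  obtain x y where xy: "walk_end q = (x, y)" by (cases "walk_end q")
  have "c = L1 \<or> c = P1 \<and> x = 0 \<or> c = P2 \<and> x = 1 \<and> y \<ge> 1"
    using F_crit_start[of x y] assms(5) w xy by simp
  then show ?thesis
    using m(3) v1 walk_end_val(2)[OF assms(3)] assms(4) xy by force
qed

lemma F_final_cong: "canon w = canon w' \<Longrightarrow> F_final w p u s t = F_final w' p u s t"
  by (simp add: F_final_def F_occ_def)

lemma F_crit_nonempty: "F_crit P u t \<Longrightarrow> u \<noteq> []"
  by (cases rule: F_crit.cases) auto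

text \<open>The word ends with \<open>u\<close>, so a competitor could only start strictly inside
  \<open>u\<close>. The letters there are 1' or 2, or the closing letter 2' of type 1F or 1' of type
  2F, and none of these can start a critical substring at its place.\<close>

lemma F_crit_base_final:
  assumes "set p \<subseteq> letters12" "F_crit (walk_end p) u (Some t)"
    and occ: "F_occ (p @ u) p' u' s' t'"
  shows "length p' < length p \<or> length p' = length p \<and> length u' \<le> length u"
proof (rule ccontr)
  assume neg: "\<not> ?thesis"
  have c: "canon (p' @ u' @ s') = canon (p @ u)" and cr: "F_crit (walk_end p') u' t'"
    using occ by (auto simp: F_occ_def)
  have len: "length p' + length u' + length s' = length p + length u"
    using canon_length_eq[OF c] by simp
  then have lt: "length p < length p'" using neg by auto
  define d where "d = length p' - length p"
  have d: "d \<ge> 1" "length p' = length p + d" using lt by (auto simp: d_def)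
  obtain a r where u': "u' = a # r" using F_crit_nonempty[OF cr] by (cases u') auto
  have du: "d < length u" using len d u' by simp
  have uspl: "u = take d u @ u ! d # drop (Suc d) u" using du by (rule id_take_nth_drop)
  have "canon (p' @ a # (r @ s')) = canon ((p @ take d u) @ u ! d # drop (Suc d) u)"
    using c u' uspl by simp
  moreover have "length p' = length (p @ take d u)" using d du by simp
  moreover have "set (p @ take d u) \<subseteq> letters12"
    using assms(1) F_crit_letters12[OF assms(2)] by (auto dest: in_set_takeD)
  moreover have "fst (walk_end (p @ take d u)) \<ge> 1"
    using F_crit_take_pos[OF assms(2) d(1)] by (simp add: walk_end_append)
  ultimately have b: "u ! d = L1 \<or> u ! d = P2 \<and> snd (walk_end (p @ take d u)) \<ge> 1"
    using F_crit_no_start[of p' a "r @ s'" "p @ take d u" "u ! d" "drop (Suc d) u" r t'] cr u'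
    by auto
  obtain j where j: "d = Suc j" using d(1) by (cases d) auto
  from assms(2) show False
  proof (cases rule: F_crit_cases)
    case (F1 m)
    have jm: "j \<le> m" using du by (simp add: F1(2) j)
    then have tk: "take d u = L1 # replicate j P1" by (simp add: F1(2) j min_def)
    obtain x y where xy: "walk_end p = (x, y)" by (cases "walk_end p")
    \<comment> \<open>The initial 1 of type 1F brings the walk to the x-axis from either admissible
      height, and the letters 1' keep it there.\<close>
    have "snd (walk_end (p @ take d u)) = 0"
      using F1(1) unfolding walk_end_append tk xy by auto
    then have "u ! d = L1" using b by simp
    then show False using jm by (auto simp: F1(2) j nth_append nth_Cons' split: if_splits)
  next
    case (F2 m)
    have jm: "j \<le> m" using du by (simp add: F2(2) j)
    then show False using b by (auto simp: F2(2) j nth_append nth_Cons' split: if_splits)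
  qed (use du d in auto)
qed

text \<open>Needed when an appended 1' completes a substring of type 2F. If that substring started
  after \<open>p\<close>, its letter 1 alone would already be of type 5F. If it started together
  with \<open>u\<close>, then \<open>u @ s\<close> would have a single letter of value 1, which
  \<open>t\<close> changes, so by \<open>v1\<close> there is a letter of value 1 in
  \<open>p\<close>; but every type of \<open>u\<close> then either forces \<open>p\<close> to be
  empty or contradicts the letters read there.\<close>

lemma no_late_F2:
  assumes ch: "chain p u t s" and fin: "F_final (p @ u @ s) p u s (Some t)"
    and c: "canon (p' @ L1 # replicate m L2) = canon (p @ u @ s)"
    and st: "fst (walk_end p') = 0 \<or> fst (walk_end p') = 1 \<and> snd (walk_end p') \<ge> 1"
    and v1: "1 \<in> val ` set (p @ t @ s)"
  shows "length p' < length p"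
proof (rule ccontr)
  assume neg: "\<not> ?thesis"
  have lw: "set (p @ u @ s) \<subseteq> letters12" using chain_letters12[OF ch] by simp
  have tk: "canon p' = canon (take (length p') (p @ u @ s))"
    using canon_take[OF c, of "length p'"] by simp
  have lt: "set (take (length p') (p @ u @ s)) \<subseteq> letters12"
    using lw by (meson order_trans set_take_subset)
  have wp': "walk_end p' = walk_end (take (length p') (p @ u @ s))"
    using walk_end_eqv[OF tk[symmetric] lt] .
  show False
  proof (cases "length p' = length p")
    case False
    then have l: "length p < length p'" using neg by simp
    have "fst (walk_end p') \<ge> 1" using chain_take_pos[OF ch l] wp' by simp
    then have x: "fst (walk_end p') = 1" "snd (walk_end p') \<ge> 1" using st by auto
    have "F_crit (walk_end p') [L1] None"
      using x by (intro F_crit_intros) auto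
    then have "F_occ (p @ u @ s) p' [L1] (replicate m L2) None"
      using c by (simp add: F_occ_def)
    then show False using fin l unfolding F_final_def by force
  next
    case True
    have wpe: "walk_end p' = walk_end p" using wp' True by simp
    have cp: "canon p' = canon p" using tk True by simp
    have mv: "map val (u @ s) = 1 # replicate m 2"
      using canon_val_eq[OF c] True by (simp add: map_replicate)
    have s2: "val ` set s \<subseteq> {2} \<and> (length u = 1 \<or> u ! 1 = hd (tl u) \<and> val (hd (tl u)) = 2)"
    proof -
      obtain a r where u: "u = a # r"
        using F_crit_nonempty[of "walk_end p" u "Some t"] chain_crit[OF ch] by (cases u) auto
      then have r: "map val (r @ s) = replicate m 2" using mv by simp
      then have "val ` set (r @ s) \<subseteq> {2}"
        by (metis list.set_map set_replicate_conv_if subset_refl empty_subsetI)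
      then show ?thesis using u by (cases r) auto
    qed
    have last1: "u \<noteq> L1 # replicate k L2 @ [P1]" for k
    proof
      assume "u = L1 # replicate k L2 @ [P1]"
      then have "replicate m 2 = replicate k 2 @ (1::nat) # map val s"
        using mv by (simp add: map_replicate)
      then have "(1::nat) \<in> set (replicate m 2)" by (metis in_set_conv_decomp)
      then show False by simp
    qed
    have cr: "F_crit (walk_end p) u (Some t)" using chain_crit[OF ch] by simp
    from cr show False
    proof (cases rule: F_crit_cases)
      case (F1 k)
      have k: "k = 0" using s2 by (cases k) (auto simp: F1(2))
      have c2: "canon ((p' @ [L1]) @ replicate m L2) = canon ((p @ [L1]) @ P2 # s)"
        using c by (simp add: F1(2) k)
      have p0: "1 \<in> val ` set p" using v1 s2 by (auto simp: F1(3) k)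
      obtain m' where m: "m = Suc m'" using mv by (cases m) (auto simp: F1(2))
      have "canon ((p' @ [L1]) @ L2 # replicate m' L2) = canon ((p @ [L1]) @ P2 # s)"
        using c2 m by simp
      from canon_middle(3)[OF this] True have "2 \<notin> val ` set p" by auto
      then have "snd (walk_end p) = 0" using walk_end_no_val(2)[of p] lw by auto
      then have "walk_end p = (0, 0)" using F1(1) st wpe by (cases "walk_end p") auto
      then have "p = []" using walk_end_origin[of p] lw by simp
      then show False using p0 by simp
    next
      case (F2 k)
      then show False using last1 by blast
    next
      case F3
      then have "walk_end p = (0, 0)" using st wpe by (cases "walk_end p") auto
      then have "p = []" using walk_end_origin[of p] lw by simp
      then show False using v1 s2 by (auto simp: F3)
    next
      case F4
      have p0: "1 \<in> val ` set p" using v1 s2 by (auto simp: F4)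
      have "canon (p' @ L1 # replicate m L2) = canon (p @ P1 # s)" using c by (simp add: F4)
      from canon_middle(3)[OF this True] p0 show False by simp
    qed
  qed
qed

lemma chain_F_final: "chain p u t s \<Longrightarrow> F_final (p @ u @ s) p u s (Some t)"
proof (induction rule: chain.induct)
  case (chain_base p u t)
  then show ?case using F_crit_base_final[of p u t]
    by (fastforce simp: F_final_def F_occ_def)
next
  case (chain_ext p u t s a)
  note ch = chain_ext.hyps(1) and ok = chain_ext.hyps(2) and fin = chain_ext.IH
  let ?w = "p @ u @ s"
  have lw: "set ?w \<subseteq> letters12" using chain_letters12[OF ch] by simp
  obtain x y where w: "walk_end ?w = (Suc x, y)" using chain_walk[OF ch] by blast
  have w1: "1 \<in> val ` set ?w" using walk_end_val(1)[OF lw] w by simp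
  have "length p' < length p \<or> length p' = length p \<and> length u' \<le> length u"
    if occ: "F_occ (?w @ [a]) p' u' s' t'" for p' u' s' t'
  proof -
    have c: "canon (p' @ u' @ s') = canon (?w @ [a])" and cr: "F_crit (walk_end p') u' t'"
      using occ by (auto simp: F_occ_def)
    show ?thesis
    proof (cases s' rule: rev_cases)
      case (snoc s'' b)
      \<comment> \<open>A competitor that does not reach the new letter already competes in the
        shorter word.\<close>
      then have "canon ((p' @ u' @ s'') @ [b]) = canon (?w @ [a])" using c by simp
      from canon_split_last(1)[OF this] have "F_occ ?w p' u' s'' t'"
        using cr by (simp add: F_occ_def)
      then show ?thesis using fin unfolding F_final_def by blast
    next
      case Nil
      \<comment> \<open>Otherwise it ends with the new letter, up to the choice of representative.
        Type 4F fails because x > 0, type 2F starts too early, and the others contradict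
        \<open>ext_ok\<close>.\<close>
      obtain u'' b where u': "u' = u'' @ [b]" using F_crit_nonempty[OF cr] by (cases u' rule: rev_cases) auto
      have "canon ((p' @ u'') @ [b]) = canon (?w @ [a])" using c Nil u' by simp
      note sp = canon_split_last[OF this]
      have wu: "walk_end (p' @ u'') = (Suc x, y)" using walk_end_eqv[OF sp(1)[symmetric] lw] w by simp
      have vs: "val ` set (p' @ u'') = val ` set ?w" using canon_val_set_eq[OF sp(1)] .
      have b1: "b = a" if "val b = 1" using sp(3) vs w1 that by simp
      have b2: "b = a" if "y \<ge> 1" using sp(3) vs w1 walk_end_val(2)[OF lw] w that sp(2)
          ext_ok_letters12[OF ok] by (auto simp: letters12_iff)
      from cr show ?thesis
      proof (cases rule: F_crit.cases)
        case (F1 y' x' m)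
        then have "u'' = L1 # replicate m P1" "b = P2" using u' by auto
        then have "y = 0" using wu F1 by (cases x') (auto simp: walk_end_append)
        moreover have "a = P2 \<or> a = L2 \<and> 2 \<notin> val ` set ?w"
          using sp(2,3) vs \<open>b = P2\<close> by (cases a) auto
        ultimately show ?thesis using ok w by (auto simp: ext_ok_def)
      next
        case (F2 x' y' m)
        then have e: "u'' = L1 # replicate m L2" "b = P1" using u' by auto
        then have "x = 0" using wu F2(1,4) by (cases y') (auto simp: walk_end_append)
        moreover have "a = P1" using b1 e by simp
        ultimately have "1 \<in> val ` set (p @ t @ s)" using ok w by (auto simp: ext_ok_def)
        then show ?thesis using no_late_F2[OF ch fin, of p' m] sp(1) e F2(1,4) by auto
      next
        case (F3 y' x')
        then have "b = L1" "u'' = []" using u' by auto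
        then show ?thesis using ok w b1 wu F3 by (auto simp: ext_ok_def)
      next
        case (F4 x' y')
        then have "u'' = []" using u' by auto
        then show ?thesis using wu F4 by auto
      next
        case (F5 x' y' c)
        then have "b = c" "u'' = []" using u' by auto
        then show ?thesis using ok w b2 wu F5 by (auto simp: ext_ok_def)
      qed
    qed
  qed
  moreover have "F_occ (?w @ [a]) p u (s @ [a]) (Some t)"
    using chain_crit[OF ch] by (simp add: F_occ_def)
  ultimately show ?case by (simp add: F_final_def)
qed

text \<open>The graph of F, up to the choice of representatives.\<close>

definition Rel :: "letter list \<Rightarrow> letter list \<Rightarrow> bool" where
  "Rel w v \<longleftrightarrow> (\<exists>p u t s. chain p u t s \<and> canon (p @ u @ s) = canon w \<and> canon (p @ t @ s) = canon v)"

lemma Rel_chain: "chain p u t s \<Longrightarrow> Rel (p @ u @ s) (p @ t @ s)"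
  by (auto simp: Rel_def)

lemma Rel_cong: "canon w = canon w' \<Longrightarrow> canon v = canon v' \<Longrightarrow> Rel w v = Rel w' v'"
  by (simp add: Rel_def)

lemma RelE:
  assumes "Rel w v"
  obtains p u t s where "chain p u t s" "canon (p @ u @ s) = canon w" "canon (p @ t @ s) = canon v"
  using assms by (auto simp: Rel_def)

lemma Rel_letters12:
  assumes "Rel w v" shows "set w \<subseteq> letters12 \<and> set v \<subseteq> letters12"
  using assms
proof (rule RelE)
  fix p u t s
  assume ch: "chain p u t s" and c: "canon (p @ u @ s) = canon w" "canon (p @ t @ s) = canon v"
  show ?thesis
    using canon_letters12[OF c(1)] canon_letters12[OF c(2)] chain_letters12[OF ch] by simp
qed

lemma Rel_walk: "Rel w v \<Longrightarrow> \<exists>x y. walk_end w = (Suc x, y) \<and> walk_end v = (x, Suc y)"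
  unfolding Rel_def
proof (elim exE conjE)
  fix p u t s
  assume ch: "chain p u t s" and c: "canon (p @ u @ s) = canon w" "canon (p @ t @ s) = canon v"
  have "walk_end w = walk_end (p @ u @ s)" "walk_end v = walk_end (p @ t @ s)"
    using walk_end_eqv[OF c(1)] walk_end_eqv[OF c(2)] chain_letters12[OF ch] by auto
  then show ?thesis using chain_walk[OF ch] by simp
qed

lemma Rel_length:
  assumes "Rel w v" shows "length v = length w"
  using assms
proof (rule RelE)
  fix p u t s
  assume ch: "chain p u t s" and c: "canon (p @ u @ s) = canon w" "canon (p @ t @ s) = canon v"
  have "length t = length u" using F_crit_length chain_crit[OF ch] by blast
  then show ?thesis using canon_length_eq[OF c(1)] canon_length_eq[OF c(2)] by simp
qed

lemma Rel_etas: "Rel w v \<Longrightarrow> Rel (etas v) (etas w)"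
  unfolding Rel_def
proof (elim exE conjE)
  fix p u t s
  assume ch: "chain p u t s" and c: "canon (p @ u @ s) = canon w" "canon (p @ t @ s) = canon v"
  have "canon (etas (p @ u @ s)) = canon (etas w)" "canon (etas (p @ t @ s)) = canon (etas v)"
    using canon_etas_cong[OF c(1)] canon_etas_cong[OF c(2)] chain_letters12[OF ch] by auto
  then show "\<exists>p u t s. chain p u t s \<and> canon (p @ u @ s) = canon (etas v) \<and>
      canon (p @ t @ s) = canon (etas w)"
    using chain_eta[OF ch] by (metis map_append)
qed

text \<open>The first letter of value 2 can be read as 2', and then it ends a substring of type 1F
  that supersedes the old final one. Without letters of value 2 the word stays on the x-axis and
  \<open>s\<close> consists of letters 1', so the new substring is explicit. Its image is the old
  image with the 2 appended, after re-priming first letters where necessary.\<close>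

lemma chain_first_2:
  assumes ch: "chain p u t s" and no2: "2 \<notin> val ` set (p @ u @ s)"
  shows "\<exists>p' u' t'. chain p' u' t' [] \<and> canon (p' @ u') = canon (p @ u @ s @ [L2])
    \<and> canon (p' @ t') = canon (p @ t @ s @ [L2])"
proof -
  have lp: "set p \<subseteq> letters12" and ls: "set s \<subseteq> letters12" and lw: "set (p @ u @ s) \<subseteq> letters12"
    using chain_letters12[OF ch] by auto
  have sP: "set s \<subseteq> {P1}"
  proof
    fix a assume "a \<in> set s"
    then obtain s1 s2 where s: "s = s1 @ a # s2" by (auto simp: in_set_conv_decomp)
    have ok: "ext_ok (p @ u @ s1) (p @ t @ s1) a" using chain_ext_ok ch s by simp
    have "snd (walk_end (p @ u @ s1)) = 0"
      using walk_end_no_val(2)[of "p @ u @ s1"] lw no2 s by auto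
    then show "a \<in> {P1}" using ok no2 s by (auto simp: ext_ok_def)
  qed
  then obtain k where s: "s = replicate k P1"
    by (metis replicate_length_same singletonD subsetD)
  have cr: "F_crit (walk_end p) u (Some t)" using chain_crit[OF ch] by simp
  have y0: "snd (walk_end p) = 0" using walk_end_no_val(2)[OF lp] no2 by auto
  then have new: "chain p (L1 # replicate j P1 @ [P2]) (P2 # replicate j P1 @ [L2]) []" for j
    using lp by (intro chain.chain_base F_crit_intros) auto
  have p0: "p = []" if "fst (walk_end p) = 0"
    using that y0 walk_end_origin[OF lp] by (metis prod.collapse)
  have p2: "2 \<notin> val ` set p" using no2 by auto
  have e: "canon (p @ L1 # replicate k P1 @ [P2]) = canon (p @ L1 # replicate k P1 @ [L2])"
    using canon_letter_cong[of P2 L2 "p @ L1 # replicate k P1" "[]"] p2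
    by (auto simp: set_replicate_conv_if)
  have f: "canon (p @ P2 # q) = canon (p @ L2 # q)" for q
    using canon_letter_cong[of P2 L2 p q] p2 by simp
  from cr show ?thesis
  proof (cases rule: F_crit_cases)
    case (F1 m)
    then show ?thesis using no2 by auto
  next
    case (F2 m)
    have m: "m = 0" using no2 F2(2) by (cases m) auto
    have p: "p = []" using F2(1) y0 p0 by auto
    have "chain [] (L1 # replicate (Suc k) P1 @ [P2]) (P2 # replicate (Suc k) P1 @ [L2]) []"
      using new[of "Suc k"] p by simp
    moreover have "canon (L1 # replicate (Suc k) P1 @ [P2]) = canon (L1 # replicate (Suc k) P1 @ [L2])"
      using canon_letter_cong[of P2 L2 "L1 # replicate (Suc k) P1" "[]"]
      by (auto simp: set_replicate_conv_if)
    moreover have "canon ([P2] @ P1 # replicate k P1 @ [L2]) = canon ([P2] @ L1 # replicate k P1 @ [L2])"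
      by (rule canon_letter_cong) auto
    ultimately show ?thesis using F2 m p s
      by (intro exI[of _ "[]"] exI[of _ "L1 # replicate (Suc k) P1 @ [P2]"]
          exI[of _ "P2 # replicate (Suc k) P1 @ [L2]"]) auto
  next
    case F3
    then show ?thesis using new[of k] e f[of "replicate k P1 @ [L2]"] s
      by (intro exI[of _ p] exI[of _ "L1 # replicate k P1 @ [P2]"]
          exI[of _ "P2 # replicate k P1 @ [L2]"]) auto
  next
    case F4
    then have p: "p = []" using p0 by simp
    have "canon ([] @ L1 # replicate k P1 @ [L2]) = canon ([] @ P1 # replicate k P1 @ [L2])"
      by (rule canon_letter_cong) auto
    then show ?thesis using new[of k] e F4 p s
      by (intro exI[of _ p] exI[of _ "L1 # replicate k P1 @ [P2]"]
          exI[of _ "P2 # replicate k P1 @ [L2]"]) auto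
  qed
qed

text \<open>The mirror image of \<open>chain_first_2\<close> under eta, which is why the hypothesis
  concerns the image and not the word.\<close>

lemma chain_first_1:
  assumes ch: "chain p u t s" and no1: "1 \<notin> val ` set (p @ t @ s)"
  shows "Rel (p @ u @ s @ [P1]) (p @ t @ s @ [P1])"
proof -
  have l: "set (p @ u @ s) \<subseteq> letters12" "set (p @ t @ s) \<subseteq> letters12"
    using chain_letters12[OF ch] by auto
  have le: "set (p @ u @ s @ [P1]) \<subseteq> letters12" "set (p @ t @ s @ [P1]) \<subseteq> letters12"
    using l by (auto simp: letters12_def)
  have "2 \<notin> val ` set (etas (p @ t @ s))"
  proof
    assume "2 \<in> val ` set (etas (p @ t @ s))"
    from val_etas(2)[OF etas_letters12 this] show False
      using no1 unfolding etas_invol[OF l(2)] by blast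
  qed
  then have "2 \<notin> val ` set (etas p @ etas t @ etas s)" by simp
  from chain_first_2[OF chain_eta[OF ch] this]
  obtain p' u' t' where n: "chain p' u' t' []"
    "canon (p' @ u') = canon (etas (p @ t @ s @ [P1]))"
    "canon (p' @ t') = canon (etas (p @ u @ s @ [P1]))" by auto
  then have "Rel (etas (p @ t @ s @ [P1])) (etas (p @ u @ s @ [P1]))"
    using Rel_chain[OF n(1)] Rel_cong[OF n(2,3)] by simp
  from Rel_etas[OF this] show ?thesis unfolding etas_invol[OF le(1)] etas_invol[OF le(2)] .
qed

text \<open>For words, unlike for chains, the walk alone decides: when a condition on values in
  \<open>ext_ok\<close> fails, another final critical substring with the same effect takes
  over.\<close>

lemma Rel_ext:
  assumes r: "Rel w v" and wd: "wide (walk_end w) a"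
  shows "Rel (w @ [a]) (v @ [a])"
proof -
  obtain p u t s where ch: "chain p u t s" and c: "canon (p @ u @ s) = canon w" "canon (p @ t @ s) = canon v"
    using r by (auto simp: Rel_def)
  have c': "canon (p @ u @ s @ [a]) = canon (w @ [a])" "canon (p @ t @ s @ [a]) = canon (v @ [a])"
    using canon_append_cong[OF c(1), of "[a]"] canon_append_cong[OF c(2), of "[a]"] by auto
  have ww: "walk_end w = walk_end (p @ u @ s)"
    using walk_end_eqv[OF c(1)] chain_letters12[OF ch] by auto
  have "Rel (p @ u @ s @ [a]) (p @ t @ s @ [a])"
  proof (cases "ext_ok (p @ u @ s) (p @ t @ s) a")
    case True
    from Rel_chain[OF chain_ext[OF ch this]] show ?thesis by simp
  next
    case False
    then consider "a = L2" "2 \<notin> val ` set (p @ u @ s)" | "a = P1" "1 \<notin> val ` set (p @ t @ s)"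
      using wd ww unfolding wide_def ext_ok_def by force
    then show ?thesis
    proof cases
      case 1
      obtain p' u' t' where n: "chain p' u' t' []" "canon (p' @ u') = canon (p @ u @ s @ [L2])"
        "canon (p' @ t') = canon (p @ t @ s @ [L2])"
        using chain_first_2[OF ch 1(2)] by blast
      then show ?thesis using 1 Rel_chain[OF n(1)] Rel_cong[OF n(2,3)] by simp
    next
      case 2
      then show ?thesis using chain_first_1[OF ch 2(2)] by simp
    qed
  qed
  then show ?thesis using Rel_cong[OF c'] by simp
qed

lemma Rel_ext_free: "Rel w v \<Longrightarrow> set r \<subseteq> {P1, L2} \<Longrightarrow> Rel (w @ r) (v @ r)"
proof (induction r rule: rev_induct)
  case (snoc a r)
  then show ?case using Rel_ext[of "w @ r" "v @ r" a] by (auto simp: wide_def)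
qed simp

text \<open>Reading backwards, letters 1' keep the walk on the axis, and a letter 1 arrives there
  from the axis or from height 1 off the axes, which are the locations of type 1F. If no 1 is met,
  the first letter is read as 1. So a 2' appended at such a point always completes a substring of
  type 1F.\<close>

lemma walk_x_axis:
  assumes "set q \<subseteq> letters12" "fst (walk_end q) \<ge> 1" "snd (walk_end q) = 0"
  shows "\<exists>p m. canon (p @ L1 # replicate m P1) = canon q \<and>
    (snd (walk_end p) = 0 \<or> snd (walk_end p) = 1 \<and> fst (walk_end p) \<ge> 1)"
  using assms
proof (induction q rule: rev_induct)
  case (snoc b q)
  obtain x y where xy: "walk_end q = (x, y)" by (cases "walk_end q")
  have lq: "set q \<subseteq> letters12" using snoc.prems by simp
  from snoc.prems have "b = L1 \<or> b = P1"
    by (auto simp: walk_end_append xy letters12_def split: if_splits)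
  then show ?case
  proof
    assume b: "b = L1"
    then have "snd (walk_end q) = 0 \<or> snd (walk_end q) = 1 \<and> fst (walk_end q) \<ge> 1"
      using snoc.prems by (auto simp: walk_end_append xy split: if_splits)
    then show ?thesis using b by (intro exI[of _ q] exI[of _ 0]) simp
  next
    assume b: "b = P1"
    then have y: "y = 0" using snoc.prems by (auto simp: walk_end_append xy split: if_splits)
    show ?thesis
    proof (cases "x = 0")
      case True
      then have "q = []" using xy y walk_end_origin[OF lq] by simp
      then show ?thesis using b by (intro exI[of _ "[]"] exI[of _ 0]) (simp add: canon_conv)
    next
      case False
      then obtain p m where pm: "canon (p @ L1 # replicate m P1) = canon q"
        "snd (walk_end p) = 0 \<or> snd (walk_end p) = 1 \<and> fst (walk_end p) \<ge> 1"
        using snoc.IH[OF lq] xy y by auto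
      have "canon (p @ L1 # replicate (Suc m) P1) = canon (q @ [b])"
        using canon_append_cong[OF pm(1), of "[P1]"] b by (simp add: replicate_append_same)
      then show ?thesis using pm(2) by blast
    qed
  qed
qed simp

text \<open>By \<open>walk_x_axis\<close> such a letter would end a substring of type 1F that
  reaches beyond \<open>u\<close>. Finality makes it start before \<open>u\<close>, so
  \<open>u\<close> starts within its run of 1'; but no critical substring can start at such a
  1'.\<close>

lemma F_final_no_later_F1:
  assumes fin: "F_final w p u s (Some t)" and lw: "set w \<subseteq> letters12"
    and s: "s = s1 @ a # s2" and x: "fst (walk_end (p @ u @ s1)) \<ge> 1" and y: "snd (walk_end (p @ u @ s1)) = 0"
  shows "\<not> (a = P2 \<or> a = L2 \<and> 2 \<notin> val ` set (p @ u @ s1))"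
proof
  assume a: "a = P2 \<or> a = L2 \<and> 2 \<notin> val ` set (p @ u @ s1)"
  let ?q = "p @ u @ s1"
  have cw: "canon (p @ u @ s) = canon w" and cr: "F_crit (walk_end p) u (Some t)"
    using fin by (auto simp: F_final_def F_occ_def)
  have lq: "set ?q \<subseteq> letters12" using canon_letters12[OF cw[symmetric] lw] s by auto
  obtain p1 m where pm: "canon (p1 @ L1 # replicate m P1) = canon ?q"
    "snd (walk_end p1) = 0 \<or> snd (walk_end p1) = 1 \<and> fst (walk_end p1) \<ge> 1"
    using walk_x_axis[OF lq x y] by blast
  have len: "length p1 + Suc m = length ?q" using canon_length_eq[OF pm(1)] by simp
  let ?u = "L1 # replicate m P1 @ [P2]"
  have "canon (?q @ a # s2) = canon (?q @ P2 # s2)"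
    using a canon_letter_cong[of L2 P2 ?q s2] by auto
  then have "canon (p1 @ ?u @ s2) = canon w"
    using canon_append_cong[OF pm(1), of "P2 # s2"] cw s by simp
  then have "F_occ w p1 ?u s2 (Some (P2 # replicate m P1 @ [L2]))"
    using F_crit_intros(1)[OF pm(2)] by (auto simp: F_occ_def)
  then have "length p1 < length p \<or> length p1 = length p \<and> length ?u \<le> length u"
    using fin unfolding F_final_def by blast
  then have lt: "length p1 < length p" using len by auto
  define j where "j = length p - length p1 - 1"
  have j: "length p = length (p1 @ L1 # replicate j P1)" "j < m"
    using lt len F_crit_nonempty[OF cr] by (cases u; simp add: j_def)+
  obtain m' where m': "m = j + Suc m'" using less_imp_Suc_add[OF j(2)] by auto
  obtain c r where u: "u = c # r" using F_crit_nonempty[OF cr] by (cases u) auto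
  have lp1: "set (p1 @ L1 # replicate j P1) \<subseteq> letters12"
    using canon_letters12[OF pm(1)[symmetric] lq] by (auto simp: letters12_def)
  have rep: "replicate m P1 = replicate j P1 @ P1 # replicate m' P1"
    using replicate_add[of j "Suc m'" P1] m' by simp
  have "canon (p @ c # (r @ s1)) = canon ((p1 @ L1 # replicate j P1) @ P1 # replicate m' P1)"
    using pm(1) u rep by simp
  moreover have "fst (walk_end (p1 @ L1 # replicate j P1)) \<ge> 1"
    using pm(2) by (cases "walk_end p1") (auto simp: walk_end_append)
  ultimately show False
    using F_crit_no_start[of p c "r @ s1" "p1 @ L1 # replicate j P1" P1 _ r "Some t"] j(1) lp1 cr u
    by auto
qed

text \<open>Every letter after a final critical substring is wide: otherwise it would itself be of
  type 3F or 5F, or would end one of type 1F. The second conjunct, which excludes a first letter of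
  value 2 after \<open>u\<close>, serves uniqueness: it makes the remainder \<open>s\<close>
  independent of the representative.\<close>

lemma F_final_Rel:
  assumes fin: "F_final w p u s (Some t)" and lw: "set w \<subseteq> letters12"
  shows "s = s1 @ s2 \<Longrightarrow> Rel (p @ u @ s1) (p @ t @ s1) \<and> (2 \<in> val ` set (p @ u) \<or> 2 \<notin> val ` set s1)"
proof (induction s1 arbitrary: s2 rule: rev_induct)
  case Nil
  have "set p \<subseteq> letters12" using fin canon_letters12[of w "p @ u @ s"] lw
    by (auto simp: F_final_def F_occ_def)
  then show ?case using chain_base[of p u t] Rel_chain[of p u t "[]"] fin
    by (auto simp: F_final_def F_occ_def)
next
  case (snoc a s1)
  have s: "s = s1 @ a # s2" using snoc.prems by simp
  from snoc.IH[OF s] have r: "Rel (p @ u @ s1) (p @ t @ s1)"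
    and n2: "2 \<in> val ` set (p @ u) \<or> 2 \<notin> val ` set s1" by auto
  let ?q = "p @ u @ s1"
  obtain x y where xy: "walk_end ?q = (Suc x, y)" using Rel_walk[OF r] by blast
  have cw: "canon (p @ u @ s) = canon w" using fin by (auto simp: F_final_def F_occ_def)
  have lq: "set (?q @ [a]) \<subseteq> letters12" using canon_letters12[OF cw[symmetric] lw] s by auto
  have later: "\<not> F_crit (walk_end ?q) [a] t'" for t'
  proof
    assume "F_crit (walk_end ?q) [a] t'"
    then have "F_occ w ?q [a] s2 t'" using cw s by (simp add: F_occ_def)
    then have "length ?q < length p \<or> length ?q = length p \<and> length [a] \<le> length u"
      using fin unfolding F_final_def by blast
    moreover have "u \<noteq> []"
      using fin F_crit_nonempty[of "walk_end p" u "Some t"] by (simp add: F_final_def F_occ_def)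
    ultimately show False by simp
  qed
  have no: "\<not> (a = P2 \<or> a = L2 \<and> 2 \<notin> val ` set ?q)" if "y = 0"
    using F_final_no_later_F1[OF fin lw s] xy that by simp
  have "wide (walk_end ?q) a"
  proof (rule ccontr)
    assume "\<not> ?thesis"
    then have a: "a = L1 \<or> a = P2" "x = 0 \<or> y = 0"
      using lq xy by (auto simp: wide_def letters12_def)
    show False
    proof (cases "y = 0")
      case True
      then show False using a no later[of "Some [L2]"] F_crit_intros(3)[of "walk_end ?q"] xy by auto
    next
      case False
      then show False using a later[of None] F_crit_intros(5)[of "walk_end ?q" a] xy by auto
    qed
  qed
  from Rel_ext[OF r this] have "Rel (p @ u @ s1 @ [a]) (p @ t @ s1 @ [a])" by simp
  moreover have "2 \<in> val ` set (p @ u) \<or> 2 \<notin> val ` set (s1 @ [a])"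
  proof (rule ccontr)
    assume neg: "\<not> ?thesis"
    then have n: "2 \<notin> val ` set ?q" "val a = 2" using n2 by auto
    have "set ?q \<subseteq> letters12" using lq by simp
    from walk_end_no_val(2)[OF this n(1)] have "y = 0" using xy by simp
    from no[OF this] n show False by (cases a) auto
  qed
  ultimately show ?case by blast
qed

text \<open>Maximality fixes the start and the length. All values of \<open>s\<close> occur before
  it, so \<open>s\<close> is fixed as well, and \<open>u\<close> can only vary between 1 and 1' at
  the origin, where the images 2 and 2' are equivalent as first letters.\<close>

lemma F_final_unique:
  assumes fin: "F_final w p u s (Some t)" and fin': "F_final w p' u' s' (Some t')"
    and lw: "set w \<subseteq> letters12"
  shows "canon (p @ t @ s) = canon (p' @ t' @ s')"
proof -
  have occ: "F_occ w p u s (Some t)" "F_occ w p' u' s' (Some t')"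
    using fin fin' by (auto simp: F_final_def)
  then have cr: "F_crit (walk_end p) u (Some t)" "F_crit (walk_end p') u' (Some t')"
    and cw: "canon (p @ u @ s) = canon w" "canon (p' @ u' @ s') = canon w"
    by (auto simp: F_occ_def)
  have "(length p < length p' \<or> length p = length p' \<and> length u \<le> length u') \<and>
    (length p' < length p \<or> length p' = length p \<and> length u' \<le> length u)"
    using fin fin' occ unfolding F_final_def by blast
  then have len: "length p = length p'" "length u = length u'" by auto
  have "canon (p @ u @ s) = canon (p' @ u' @ s')" using cw by simp
  then have cp: "canon p = canon p'"
    and cs: "canon (p @ u) = canon (p' @ u')"
      "canon_from (val ` set (p @ u)) s = canon_from (val ` set (p @ u)) s'"
    using canon_append_iff[of p p' "u @ s" "u' @ s'"] canon_append_iff[of "p @ u" "p' @ u'" s s'] len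
    by auto
  have lp: "set p \<subseteq> letters12" and ls: "set s \<subseteq> letters12"
    using canon_letters12[OF cw(1)[symmetric] lw] by auto
  have wp: "walk_end p' = walk_end p" using walk_end_eqv[OF cp lp] .
  have "2 \<in> val ` set (p @ u) \<or> 2 \<notin> val ` set s"
    using F_final_Rel[OF fin lw, of s "[]"] by simp
  then have vs: "val ` set s \<subseteq> val ` set (p @ u)"
    using F_crit_val1[OF cr(1)] ls by (force simp: val_letters12)
  have "val ` set s' = val ` set s"
    using val_set_canon_from[of "val ` set (p @ u)" s] val_set_canon_from[of "val ` set (p @ u)" s']
    unfolding cs(2) by (rule trans[OF sym, rotated])
  then have "canon_from (val ` set (p @ u)) s' = s'"
    using vs by (intro canon_from_full) blast
  moreover have "canon_from (val ` set (p @ u)) s = s" by (rule canon_from_full[OF vs])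
  ultimately have ss: "s' = s" using cs(2) by metis
  have mu: "map val u = map val u'"
    using canon_val_eq[OF cs(1)] len by simp
  have "canon (p @ t) = canon (p' @ t')"
  proof (cases "u = u'")
    case True
    have "t = t'"
      using cr(1)
    proof (cases rule: F_crit_cases)
      case (F1 m)
      from cr(2) show ?thesis by (cases rule: F_crit_cases) (use F1 True in auto)
    next
      case (F2 m)
      from cr(2) show ?thesis by (cases rule: F_crit_cases) (use F2 True in auto)
    next
      case F3
      from cr(2) show ?thesis by (cases rule: F_crit_cases) (use F3 True in auto)
    next
      case F4
      from cr(2) show ?thesis by (cases rule: F_crit_cases) (use F4 True in auto)
    qed
    then show ?thesis using canon_append_cong[OF cp] by simp
  next
    case False
    have "walk_end p = (0, 0) \<and> (t = [L2] \<and> t' = [P2] \<or> t = [P2] \<and> t' = [L2])"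
      using cr(1)
    proof (cases rule: F_crit_cases)
      case (F1 m)
      from cr(2) show ?thesis
        by (cases rule: F_crit_cases) (use F1 mu False in \<open>auto simp: map_replicate\<close>)
    next
      case (F2 m)
      from cr(2) show ?thesis
        by (cases rule: F_crit_cases) (use F2 mu False in \<open>auto simp: map_replicate\<close>)
    next
      case F3
      from cr(2) show ?thesis
        by (cases rule: F_crit_cases) (use F3 mu False wp in \<open>auto simp: prod_eq_iff\<close>)
    next
      case F4
      from cr(2) show ?thesis
        by (cases rule: F_crit_cases) (use F4 mu False wp in \<open>auto simp: prod_eq_iff\<close>)
    qed
    moreover from this have "p = []" "p' = []" using walk_end_origin[OF lp] len by auto
    ultimately show ?thesis by (auto simp: canon_conv)
  qed
  from canon_append_cong[OF this, of s] ss show ?thesis by simp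
qed

lemma opF_iff:
  assumes lw: "set w \<subseteq> letters12"
  shows "opF w = Some v \<longleftrightarrow> Rel w v \<and> is_word v"
proof -
  have uniq: "v1 = v2" if "F_result w v1" "F_result w v2" for v1 v2
    using that F_final_unique[OF _ _ lw] unfolding F_result_def by blast
  have "opF w = Some v \<longleftrightarrow> F_result w v"
    unfolding opF_def using uniq by (auto intro: the_equality simp: theI)
  also have "\<dots> \<longleftrightarrow> Rel w v \<and> is_word v"
  proof
    assume "F_result w v"
    then obtain p u s t where fin: "F_final w p u s (Some t)" and v: "v = canon (p @ t @ s)"
      by (auto simp: F_result_def)
    have "Rel (p @ u @ s) (p @ t @ s)" using F_final_Rel[OF fin lw, of s "[]"] by simp
    moreover have "canon (p @ u @ s) = canon w" using fin by (simp add: F_final_def F_occ_def)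
    ultimately show "Rel w v \<and> is_word v"
      using Rel_cong[of "p @ u @ s" w "p @ t @ s" v] v by simp
  next
    assume rv: "Rel w v \<and> is_word v"
    then obtain p u t s where ch: "chain p u t s" and c: "canon (p @ u @ s) = canon w"
      "canon (p @ t @ s) = canon v" by (auto simp: Rel_def)
    have "F_final w p u s (Some t)" using chain_F_final[OF ch] F_final_cong[OF c(1)] by simp
    moreover have "v = canon (p @ t @ s)" using rv c(2) by (simp add: is_word_def)
    ultimately show "F_result w v" by (auto simp: F_result_def)
  qed
  finally show ?thesis .
qed

lemma opE_iff:
  assumes lw: "set w \<subseteq> letters12" and "is_word w"
  shows "opE w = Some v \<longleftrightarrow> Rel v w \<and> is_word v"
proof -
  have ce: "canon (eta b) = canon (etas b)" for b by (simp add: eta_def)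
  have "opE w = Some v \<longleftrightarrow> (\<exists>b. Rel (eta w) b \<and> is_word b \<and> v = eta b)"
    using opF_iff[OF eta_letters12, of w] by (auto simp: opE_def)
  also have "\<dots> \<longleftrightarrow> Rel v w \<and> is_word v"
  proof
    assume "\<exists>b. Rel (eta w) b \<and> is_word b \<and> v = eta b"
    then obtain b where b: "Rel (eta w) b" "is_word b" "v = eta b" by blast
    have "Rel (etas b) (etas (eta w))" using Rel_etas[OF b(1)] .
    moreover have "canon (etas (eta w)) = canon w"
      using eta_invol[OF assms] by (metis canon_idem eta_def)
    ultimately show "Rel v w \<and> is_word v"
      using Rel_cong[of "etas b" v "etas (eta w)" w] b ce by simp
  next
    assume r: "Rel v w \<and> is_word v"
    have "Rel (etas w) (etas v)" using Rel_etas r by blast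
    then have "Rel (eta w) (eta v)" using Rel_cong[of "etas w" "eta w" "etas v" "eta v"] ce by simp
    moreover have "v = eta (eta v)" using eta_invol r Rel_letters12 by metis
    ultimately show "\<exists>b. Rel (eta w) b \<and> is_word b \<and> v = eta b" using is_word_eta by blast
  qed
  finally show ?thesis .
qed

section \<open>Standardization and the primed operators\<close>

lemma val_less: "val a < val b \<Longrightarrow> a < b"
  by (cases a; cases b) (auto simp: less_letter_def)

lemma less_val: "a < b \<Longrightarrow> val a \<le> val b"
  by (cases a; cases b) (auto simp: less_letter_def)

lemma same_val_less: "val a = val b \<Longrightarrow> a < b \<longleftrightarrow> is_Primed a \<and> \<not> is_Primed b"
  by (cases a; cases b) (auto simp: less_letter_def)

lemma same_val_eq: "a = b \<longleftrightarrow> val a = val b \<and> is_Primed a = is_Primed b"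
  by (cases a; cases b) auto

text \<open>A tie in value is decided by a single prime, that of the letter further right. This
  letter is the same in all representatives, hence so is the standardization.\<close>

lemma std_before_alt:
  assumes "j \<noteq> k"
  shows "std_before w j k \<longleftrightarrow> val (w ! j) < val (w ! k) \<or>
    val (w ! j) = val (w ! k) \<and> (if j < k then \<not> is_Primed (w ! k) else is_Primed (w ! j))"
proof (cases "val (w ! j) = val (w ! k)")
  case True
  then show ?thesis using assms same_val_less[OF True] same_val_eq[of "w ! j" "w ! k"]
    by (auto simp: std_before_def)
next
  case False
  then show ?thesis using val_less[of "w ! j" "w ! k"] less_val[of "w ! j" "w ! k"]
    by (auto simp: std_before_def)
qed

lemma std_before_irrefl: "\<not> std_before w j j"
  by (simp add: std_before_def)

lemma std_before_total: "j \<noteq> k \<Longrightarrow> std_before w j k \<or> std_before w k j"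
  by (auto simp: std_before_def)

lemma std_before_trans: "std_before w i j \<Longrightarrow> std_before w j k \<Longrightarrow> std_before w i k"
  by (auto simp: std_before_def split: if_splits)

lemma length_std [simp]: "length (std w) = length w"
  by (simp add: std_def)

lemma std_before_iff_less:
  assumes "j < length w" "k < length w"
  shows "std_before w j k \<longleftrightarrow> std w ! j < std w ! k"
proof -
  have mono: "std w ! a < std w ! b" if "std_before w a b" "a < length w" "b < length w" for a b
  proof -
    have "{j. j < length w \<and> std_before w j a} \<subset> {j. j < length w \<and> std_before w j b}"
      using that std_before_trans std_before_irrefl by blast
    then show ?thesis using that by (simp add: std_def psubset_card_mono)
  qed
  show ?thesis
  proof (cases "j = k")
    case False
    then show ?thesis using mono[of j k] mono[of k j] std_before_total[OF False, of w] assms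
      by (meson less_asym)
  qed (simp add: std_before_irrefl)
qed

text \<open>\<open>std\<close> lists the ranks in the linear order \<open>std_before\<close>, so it
  carries the same information as this order.\<close>

lemma std_eq_iff:
  "std v = std w \<longleftrightarrow> length v = length w \<and>
     (\<forall>j<length w. \<forall>k<length w. std_before v j k = std_before w j k)"
proof
  assume e: "std v = std w"
  then have l: "length v = length w" by (metis length_std)
  then show "length v = length w \<and>
     (\<forall>j<length w. \<forall>k<length w. std_before v j k = std_before w j k)"
    using std_before_iff_less[of _ v] std_before_iff_less[of _ w] e by auto
next
  assume a: "length v = length w \<and>
     (\<forall>j<length w. \<forall>k<length w. std_before v j k = std_before w j k)"
  then have "{j. j < length v \<and> std_before v j k} = {j. j < length w \<and> std_before w j k}"
    if "k < length w" for k using that by auto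
  then show "std v = std w" using a by (auto simp: std_def)
qed

lemma std_before_canon:
  assumes "j < length w" "k < length w"
  shows "std_before (canon w) j k = std_before w j k"
proof (cases "j = k")
  case False
  have v: "val (canon w ! i) = val (w ! i)" if "i < length w" for i
    using canon_nth_val[of w "canon w" i] that by simp
  have e: "canon w ! b = w ! b" if "a < b" "b < length w" "val (w ! a) = val (w ! b)" for a b
    using canon_nth_eq[of w "canon w" b a] that by simp
  show ?thesis
  proof (cases "val (w ! j) = val (w ! k)")
    case True
    then show ?thesis using False e[of j k] e[of k j] v assms by (auto simp: std_before_alt)
  next
    case F: False
    then show ?thesis using False v assms by (auto simp: std_before_alt)
  qed
qed (simp add: std_before_irrefl)

lemma std_canon: "std (canon w) = std w"
  by (simp add: std_eq_iff std_before_canon)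

lemma weight_canon: "weight (canon w) = weight w"
proof -
  have "weight w = (\<lambda>j. int (length (filter (\<lambda>n. n = j) (map val w))))" for w
    by (simp add: weight_def filter_map comp_def)
  then show ?thesis by (simp only: map_val_canon)
qed

lemma weight_conv_card: "weight w j = int (card {k. k < length w \<and> val (w ! k) = j})"
  by (simp add: weight_def length_filter_conv_card)

lemma weight_zero_iff: "weight w j = 0 \<longleftrightarrow> j \<notin> val ` set w"
  by (auto simp: weight_def filter_empty_conv)

lemma letters12_weight: "set w \<subseteq> letters12 \<longleftrightarrow> (\<forall>j. j \<notin> {1, 2} \<longrightarrow> weight w j = 0)"
  by (auto simp: weight_zero_iff val_letters12)

text \<open>Both sets are initial segments of the common standardization order.\<close>

lemma ones_nested:
  assumes "std v = std w" "set v \<subseteq> letters12" "set w \<subseteq> letters12" "weight v 1 \<le> weight w 1"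
  shows "{k. k < length v \<and> val (v ! k) = 1} \<subseteq> {k. k < length w \<and> val (w ! k) = 1}"
    (is "?A v \<subseteq> ?A w")
proof (rule ccontr)
  assume "\<not> ?thesis"
  then obtain k where k: "k \<in> ?A v" "k \<notin> ?A w" by blast
  have len: "length v = length w"
    and sb: "\<And>i j. i < length w \<Longrightarrow> j < length w \<Longrightarrow> std_before v i j = std_before w i j"
    using assms(1) by (auto simp: std_eq_iff)
  have vals: "val (u ! j) \<in> {1, 2}" if "set u \<subseteq> letters12" "j < length u" for u j
    using that by (metis letters12_iff nth_mem subsetD)
  have "?A w \<subseteq> ?A v - {k}"
  proof
    fix j assume j: "j \<in> ?A w"
    then have jk: "j \<noteq> k" using k by auto
    have "val (w ! k) = 2" using k vals[OF assms(3), of k] len by auto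
    then have "std_before w j k" using j jk by (simp add: std_before_alt)
    then have "std_before v j k" using sb j k len by simp
    then have "val (v ! j) \<le> val (v ! k)" using jk by (auto simp: std_before_alt)
    then show "j \<in> ?A v - {k}" using j k jk len vals[OF assms(2), of j] by auto
  qed
  then have "card (?A w) \<le> card (?A v - {k})" by (intro card_mono) auto
  also have "\<dots> < card (?A v)" using k by (intro card_Diff1_less) auto
  finally show False using assms(4) by (simp add: weight_conv_card)
qed

text \<open>The weight determines which initial segment of the standardization order has value 1.
  The order then determines all primes except at the first letter of each value, which is unprimed
  in canonical form.\<close>

lemma word_unique:
  assumes "is_word v" "is_word w" "std v = std w" "weight v = weight w"
    and "set v \<subseteq> letters12" "set w \<subseteq> letters12"
  shows "v = w"
proof -
  have len: "length v = length w"
    and sb: "\<And>i j. i < length w \<Longrightarrow> j < length w \<Longrightarrow> std_before v i j = std_before w i j"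
    using assms(3) by (auto simp: std_eq_iff)
  have "{k. k < length v \<and> val (v ! k) = 1} = {k. k < length w \<and> val (w ! k) = 1}"
    using ones_nested[OF assms(3,5,6)] ones_nested[OF assms(3)[symmetric] assms(6,5)] assms(4)
    by simp
  then have one: "val (v ! k) = 1 \<longleftrightarrow> val (w ! k) = 1" if "k < length w" for k
    using that len unfolding set_eq_iff mem_Collect_eq by metis
  have vals: "val (u ! j) = 1 \<or> val (u ! j) = 2" if "set u \<subseteq> letters12" "j < length u" for u j
    using that by (metis letters12_iff nth_mem subsetD insertE singletonD)
  have val: "val (v ! k) = val (w ! k)" if "k < length w" for k
    using one[OF that] vals[OF assms(5), of k] vals[OF assms(6), of k] that len by auto
  show ?thesis
  proof (rule nth_equalityI)
    fix k assume "k < length v"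
    then have k: "k < length w" using len by simp
    show "v ! k = w ! k"
    proof (cases "\<exists>j<k. val (w ! j) = val (w ! k)")
      case True
      then obtain j where j: "j < k" "val (w ! j) = val (w ! k)" by blast
      then have "val (v ! j) = val (v ! k)" using val k by simp
      then have "std_before v j k \<longleftrightarrow> \<not> is_Primed (v ! k)" "std_before w j k \<longleftrightarrow> \<not> is_Primed (w ! k)"
        using j by (auto simp: std_before_alt)
      then show ?thesis using sb[of j k] j k val by (auto simp: same_val_eq)
    next
      case False
      then have "\<not> (\<exists>j<k. val (v ! j) = val (v ! k))" using val k by auto
      then have "canon v ! k = Unprimed (val (v ! k))" "canon w ! k = Unprimed (val (w ! k))"
        using False k len by (auto simp: canon_conv nth_canon_from)
      then show ?thesis using assms(1,2) val k by (simp add: is_word_def)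
    qed
  qed (rule len)
qed

text \<open>The graph of F', up to the choice of representatives.\<close>

definition FP :: "letter list \<Rightarrow> letter list \<Rightarrow> bool" where
  "FP w v \<longleftrightarrow> (\<exists>q r. set q \<subseteq> letters12 \<and> set r \<subseteq> {P1, L2} \<and>
     canon w = canon (q @ L1 # r) \<and> canon v = canon (q @ P2 # r))"

lemma FP_cong: "canon w = canon w' \<Longrightarrow> canon v = canon v' \<Longrightarrow> FP w v = FP w' v'"
  by (simp add: FP_def)

lemma FP_I: "set q \<subseteq> letters12 \<Longrightarrow> set r \<subseteq> {P1, L2} \<Longrightarrow> FP (q @ L1 # r) (q @ P2 # r)"
  by (auto simp: FP_def)

lemma canon_FP: "set r \<subseteq> {P1, L2} \<Longrightarrow> canon (q @ L1 # r) = canon q @ L1 # r"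
proof -
  assume r: "set r \<subseteq> {P1, L2}"
  have "1 \<in> S \<Longrightarrow> canon_from S r = r" for S
    using r by (induction r arbitrary: S) auto
  then show ?thesis by (simp add: canon_conv canon_from_append)
qed

lemma FP_set: "set r \<subseteq> {P1, L2} \<Longrightarrow> set r \<subseteq> letters12"
  by (auto simp: letters12_def)

lemma FP_letters12: "FP w v \<Longrightarrow> set w \<subseteq> letters12 \<and> set v \<subseteq> letters12"
  unfolding FP_def
proof (elim exE conjE)
  fix q r
  assume q: "set q \<subseteq> letters12" and r: "set r \<subseteq> {P1, L2}"
    and c: "canon w = canon (q @ L1 # r)" "canon v = canon (q @ P2 # r)"
  show ?thesis
    using canon_letters12[OF c(1)[symmetric]] canon_letters12[OF c(2)[symmetric]] q FP_set[OF r]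
    by (auto simp: letters12_def)
qed

lemma FP_length: "FP w v \<Longrightarrow> length v = length w"
  unfolding FP_def
proof (elim exE conjE)
  fix q r
  assume c: "canon w = canon (q @ L1 # r)" "canon v = canon (q @ P2 # r)"
  show ?thesis using canon_length_eq[OF c(1)] canon_length_eq[OF c(2)] by simp
qed

lemma wide_free:
  "set r \<subseteq> {P1, L2} \<Longrightarrow>
     \<exists>x' y'. foldl walk_step (Suc x, y) r = (Suc x', y') \<and> foldl walk_step (x, Suc y) r = (x', Suc y')"
proof (induction r arbitrary: x y)
  case (Cons a r)
  have "wide (Suc x, y) a" using Cons.prems by (auto simp: wide_def)
  from wide_walk[OF this] Cons show ?case by force
qed simp

text \<open>From any common point the steps of 1 and 2' end at points displaced by (-1, 1), and the
  letters 1' and 2 that follow keep this displacement everywhere.\<close>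

lemma FP_walk: "FP w v \<Longrightarrow> \<exists>x y. walk_end w = (Suc x, y) \<and> walk_end v = (x, Suc y)"
  unfolding FP_def
proof (elim exE conjE)
  fix q r
  assume q: "set q \<subseteq> letters12" and r: "set r \<subseteq> {P1, L2}"
    and c: "canon w = canon (q @ L1 # r)" "canon v = canon (q @ P2 # r)"
  have "set (q @ L1 # r) \<subseteq> letters12" "set (q @ P2 # r) \<subseteq> letters12"
    using q FP_set[OF r] by (auto simp: letters12_def)
  then have w: "walk_end w = walk_end (q @ L1 # r)" "walk_end v = walk_end (q @ P2 # r)"
    using walk_end_eqv[OF c(1)[symmetric]] walk_end_eqv[OF c(2)[symmetric]] by auto
  obtain x y where xy: "walk_end q = (x, y)" by (cases "walk_end q")
  have "\<exists>x' y'. walk_step (x, y) L1 = (Suc x', y') \<and> walk_step (x, y) P2 = (x', Suc y')"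
    by (cases x; cases y) auto
  then obtain x' y' where "walk_step (x, y) L1 = (Suc x', y')" "walk_step (x, y) P2 = (x', Suc y')"
    by blast
  then show ?thesis using wide_free[OF r, of x' y'] by (simp add: w walk_end_append xy)
qed

text \<open>\<open>eta_letter\<close> exchanges 1 with 2' and 1' with 2, so the form of the
  decomposition is kept and its two words trade places.\<close>

lemma FP_etas: "FP w v \<Longrightarrow> FP (etas v) (etas w)"
  unfolding FP_def
proof (elim exE conjE)
  fix q r
  assume q: "set q \<subseteq> letters12" and r: "set r \<subseteq> {P1, L2}"
    and c: "canon w = canon (q @ L1 # r)" "canon v = canon (q @ P2 # r)"
  have l: "set (q @ L1 # r) \<subseteq> letters12" "set (q @ P2 # r) \<subseteq> letters12"
    using q FP_set[OF r] by (auto simp: letters12_def)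
  have e: "canon (etas w) = canon (etas q @ P2 # etas r)" "canon (etas v) = canon (etas q @ L1 # etas r)"
    using canon_etas_cong[OF c(1)[symmetric] l(1)] canon_etas_cong[OF c(2)[symmetric] l(2)] by auto
  have "set (etas r) \<subseteq> {P1, L2}" using r by auto
  with e show "\<exists>q r. set q \<subseteq> letters12 \<and> set r \<subseteq> {P1, L2} \<and>
      canon (etas v) = canon (q @ L1 # r) \<and> canon (etas w) = canon (q @ P2 # r)"
    using etas_letters12[of q] by blast
qed

text \<open>If only 1' and 2 follow, the letter 1 is the greatest among the letters of value 1, and
  a 2' in its place is the least among those of value 2. So its rank is the same in both
  words.\<close>

lemma std_FP:
  assumes "set q \<subseteq> letters12" "set r \<subseteq> {P1, L2}"
  shows "std (q @ P2 # r) = std (q @ L1 # r)"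
proof -
  let ?v = "q @ P2 # r" and ?w = "q @ L1 # r" and ?i = "length q"
  have i: "?v ! ?i = P2" "?w ! ?i = L1" by auto
  have o: "?v ! k = ?w ! k" if "k \<noteq> ?i" for k
    using that by (auto simp: nth_append nth_Cons')
  have r: "?w ! k = P1 \<or> ?w ! k = L2" if "?i < k" "k < length ?w" for k
  proof -
    have "?w ! k = r ! (k - ?i - 1)" using that by (simp add: nth_append nth_Cons')
    moreover have "k - ?i - 1 < length r" using that by auto
    ultimately show ?thesis using assms(2) nth_mem by fastforce
  qed
  have "set ?w \<subseteq> letters12" using assms FP_set by (auto simp: letters12_def)
  then have v: "val (?w ! k) = 1 \<or> val (?w ! k) = 2" if "k < length ?w" for k
    using that by (metis letters12_iff nth_mem subsetD insertE singletonD)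
  have "std_before ?v j k = std_before ?w j k" if jk: "j < length ?w" "k < length ?w" for j k
  proof (cases "j = k")
    case False
    consider "j \<noteq> ?i" "k \<noteq> ?i" | "j = ?i" "k \<noteq> ?i" | "j \<noteq> ?i" "k = ?i"
      using False by blast
    then show ?thesis
    proof cases
      case 1
      then show ?thesis using False by (simp add: std_before_alt o)
    next
      case 2
      then show ?thesis
        using False o[of k] i r[of k] v[of k] jk by (cases "j < k") (auto simp: std_before_alt)
    next
      case 3
      then show ?thesis
        using False o[of j] i r[of j] v[of j] jk by (cases "j < k") (auto simp: std_before_alt)
    qed
  qed (simp add: std_before_irrefl)
  then show ?thesis by (simp add: std_eq_iff)
qed

lemma FP_F'_cand:
  assumes "FP w v" "is_word v"
  shows "F'_cand w v"
proof -
  obtain q r where q: "set q \<subseteq> letters12" and r: "set r \<subseteq> {P1, L2}"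
    and c: "canon w = canon (q @ L1 # r)" "canon v = canon (q @ P2 # r)"
    using assms(1) by (auto simp: FP_def)
  have "std v = std w"
    using std_canon[of v] std_canon[of w] c std_canon[of "q @ P2 # r"] std_canon[of "q @ L1 # r"]
      std_FP[OF q r] by metis
  moreover have "weight v = weight (q @ P2 # r)" "weight w = weight (q @ L1 # r)"
    using weight_canon c by metis+
  then have "weight v = (\<lambda>j. weight w j - alpha 1 j)"
    by (auto simp: weight_def alpha_def)
  ultimately show ?thesis using assms(2) by (simp add: F'_cand_def)
qed

text \<open>Removing one letter of value 1 without changing the order must move the greatest such
  position, the last letter 1, to value 2, where it becomes the least position. A 2' to its right is
  incompatible with this.\<close>

lemma F'_cand_split:
  assumes w: "is_word w" "set w \<subseteq> letters12" and v: "F'_cand w v" "set v \<subseteq> letters12"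
  shows "\<exists>p s. w = p @ L1 # s \<and> set s \<subseteq> {P1, L2}"
proof -
  have sv: "std v = std w" and wv: "weight v = (\<lambda>j. weight w j - alpha 1 j)" and "is_word v"
    using v by (auto simp: F'_cand_def)
  have len: "length v = length w"
    and sb: "\<And>i j. i < length w \<Longrightarrow> j < length w \<Longrightarrow> std_before v i j = std_before w i j"
    using sv by (auto simp: std_eq_iff)
  have first: "\<exists>j<k. val (w ! j) = val (w ! k)" if "k < length w" "is_Primed (w ! k)" for k
  proof (rule ccontr)
    assume "\<not> ?thesis"
    then have "canon w ! k = Unprimed (val (w ! k))"
      unfolding canon_conv using that by (subst nth_canon_from) auto
    then show False using w that by (metis is_word_def letter.disc(2))
  qed
  have w1: "weight v 1 = weight w 1 - 1" using wv by (simp add: alpha_def)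
  then have "weight w 1 \<noteq> 0" by (auto simp: weight_def)
  then obtain k0 where k0: "k0 < length w" "val (w ! k0) = 1"
    by (auto simp: weight_zero_iff in_set_conv_nth)
  \<comment> \<open>In canonical form the first letter of value 1 is unprimed, so there is a letter
    1, and hence a last one.\<close>
  define k where "k = (LEAST k. k < length w \<and> val (w ! k) = 1)"
  have k: "k < length w" "val (w ! k) = 1"
    using LeastI[of "\<lambda>k. k < length w \<and> val (w ! k) = 1" k0] k0 by (auto simp: k_def)
  have "\<not> (\<exists>j<k. val (w ! j) = val (w ! k))"
    using not_less_Least[of _ "\<lambda>k. k < length w \<and> val (w ! k) = 1"] k by (auto simp: k_def[symmetric])
  then have "w ! k = L1" using first[of k] k by (cases "w ! k") auto
  then have "L1 \<in> set w" using k by (metis nth_mem)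
  then obtain p s where ps: "w = p @ L1 # s" "L1 \<notin> set s" by (meson split_list_last)
  let ?A = "\<lambda>u. {k. k < length u \<and> val (u ! k) = 1}" and ?i = "length p"
  have i: "?i < length w" "w ! ?i = L1" using ps by auto
  have sub: "?A v \<subseteq> ?A w" using ones_nested[OF sv v(2) w(2)] w1 by simp
  have vals: "val (u ! j) = 1 \<or> val (u ! j) = 2" if "set u \<subseteq> letters12" "j < length u" for u j
    using that by (metis letters12_iff nth_mem subsetD insertE singletonD)
  \<comment> \<open>All other letters of value 1 precede the last 1 in the order; if it kept its
    value, so would they, against the weight.\<close>
  have vi: "val (v ! ?i) = 2"
  proof (rule ccontr)
    assume "val (v ! ?i) \<noteq> 2"
    then have i1: "val (v ! ?i) = 1" using vals[OF v(2), of ?i] i len by auto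
    have "?A w \<subseteq> ?A v"
    proof
      fix j assume j: "j \<in> ?A w"
      show "j \<in> ?A v"
      proof (cases "j = ?i")
        case False
        have "std_before w j ?i"
        proof (cases "j < ?i")
          case True
          then show ?thesis using j i by (simp add: std_before_alt)
        next
          case F: False
          then have "w ! j \<in> set s" using j ps False by (auto simp: nth_append nth_Cons')
          then have "w ! j \<noteq> L1" using ps(2) by metis
          moreover have "val (w ! j) = 1" using j by simp
          ultimately have "w ! j = P1" by (cases "w ! j") auto
          then show ?thesis using F False i by (simp add: std_before_alt)
        qed
        then have "std_before v j ?i" using sb j i by simp
        then have "val (v ! j) \<le> 1" using False i1 by (auto simp: std_before_alt)
        then show ?thesis using j len vals[OF v(2), of j] by auto
      qed (use i1 i len in auto)
    qed
    then have "card (?A w) \<le> card (?A v)" by (intro card_mono) auto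
    then show False using w1 by (simp add: weight_conv_card)
  qed
  \<comment> \<open>A 2' at \<open>l\<close> comes after \<open>?i\<close> in the order, so
    \<open>v ! l\<close> is unprimed and comes after the position \<open>m\<close> of value 2 to its
    left. In \<open>w\<close>, however, the primed letter at \<open>l\<close> comes before
    \<open>m\<close>.\<close>
  have "P2 \<notin> set s"
  proof
    assume "P2 \<in> set s"
    then obtain l' where l': "l' < length s" "s ! l' = P2" by (auto simp: in_set_conv_nth)
    define l where "l = Suc (?i + l')"
    have l: "l < length w" "w ! l = P2" "?i < l" using l' ps by (auto simp: l_def nth_append)
    obtain m where m: "m < l" "val (w ! m) = 2" using first[of l] l by auto
    have nl: "val (v ! j) = 2" if "val (w ! j) = 2" "j < length w" for j
      using that sub len vals[OF v(2), of j] by auto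
    have "std_before w ?i l" using l i by (simp add: std_before_alt)
    then have "std_before v ?i l" using sb l i by simp
    then have "\<not> is_Primed (v ! l)" using vi nl[of l] l by (simp add: std_before_alt)
    then have "std_before v m l" using nl[of m] nl[of l] m l by (simp add: std_before_alt)
    then have "std_before w m l" using sb m l by simp
    then show False using m l by (simp add: std_before_alt)
  qed
  then have "set s \<subseteq> {P1, L2}" using w(2) ps by (auto simp: letters12_def)
  then show ?thesis using ps(1) by blast
qed

lemma F'_cand_iff:
  assumes "is_word w" "set w \<subseteq> letters12"
  shows "F'_cand w v \<longleftrightarrow> FP w v \<and> is_word v"
proof
  assume c: "F'_cand w v"
  then have iv: "is_word v" by (simp add: F'_cand_def)
  have lv: "set v \<subseteq> letters12"
    using assms(2) c by (auto simp: letters12_weight F'_cand_def alpha_def)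
  obtain p s where ps: "w = p @ L1 # s" "set s \<subseteq> {P1, L2}"
    using F'_cand_split[OF assms c lv] by blast
  have lp: "set p \<subseteq> letters12" using assms ps by auto
  have f: "FP w (canon (p @ P2 # s))"
    using FP_I[OF lp ps(2)] FP_cong[of w w "p @ P2 # s" "canon (p @ P2 # s)"] ps by simp
  have c': "F'_cand w (canon (p @ P2 # s))" by (rule FP_F'_cand[OF f]) simp
  have "v = canon (p @ P2 # s)"
    using c c' lv FP_letters12[OF f] by (intro word_unique) (auto simp: F'_cand_def)
  then show "FP w v \<and> is_word v" using f iv by simp
qed (simp add: FP_F'_cand)

lemma F'_cand_unique:
  assumes "F'_cand w v" "F'_cand w v'" "set w \<subseteq> letters12"
  shows "v = v'"
proof -
  have "set v \<subseteq> letters12" "set v' \<subseteq> letters12"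
    using assms by (auto simp: letters12_weight F'_cand_def alpha_def)
  then show ?thesis using assms by (intro word_unique) (auto simp: F'_cand_def)
qed

lemma E'_cand_unique:
  assumes "E'_cand w v" "E'_cand w v'" "set w \<subseteq> letters12"
  shows "v = v'"
proof -
  have "set v \<subseteq> letters12" "set v' \<subseteq> letters12"
    using assms by (auto simp: letters12_weight E'_cand_def alpha_def)
  then show ?thesis using assms by (intro word_unique) (auto simp: E'_cand_def)
qed

lemma opF'_iff:
  assumes "is_word w" "set w \<subseteq> letters12"
  shows "opF' w = Some v \<longleftrightarrow> FP w v \<and> is_word v"
proof -
  have "opF' w = Some v \<longleftrightarrow> F'_cand w v"
    unfolding opF'_def using F'_cand_unique[OF _ _ assms(2)] by (auto intro: the_equality theI)
  then show ?thesis using F'_cand_iff[OF assms] by simp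
qed

lemma opE'_iff:
  assumes "is_word w" "set w \<subseteq> letters12"
  shows "opE' w = Some v \<longleftrightarrow> FP v w \<and> is_word v"
proof -
  have "opE' w = Some v \<longleftrightarrow> E'_cand w v"
    unfolding opE'_def using E'_cand_unique[OF _ _ assms(2)] by (auto intro: the_equality theI)
  also have "\<dots> \<longleftrightarrow> is_word v \<and> set v \<subseteq> letters12 \<and> F'_cand v w"
    using assms by (auto simp: E'_cand_def F'_cand_def letters12_weight alpha_def fun_eq_iff)
  also have "\<dots> \<longleftrightarrow> FP v w \<and> is_word v"
    using F'_cand_iff[of v w] FP_letters12 assms(1) by auto
  finally show ?thesis .
qed

section \<open>Commutation\<close>

lemma chain_cong: "chain p u t s \<Longrightarrow> canon p = canon p' \<Longrightarrow> chain p' u t s"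
proof (induction rule: chain.induct)
  case (chain_base p u t)
  then show ?case
    using walk_end_eqv[of p p'] canon_letters12[of p p'] chain.chain_base[of p' u t] by simp
next
  case (chain_ext p u t s a)
  have c: "canon (p @ u @ s) = canon (p' @ u @ s)" "canon (p @ t @ s) = canon (p' @ t @ s)"
    using canon_append_cong[OF chain_ext.prems] by auto
  have "walk_end (p' @ u @ s) = walk_end (p @ u @ s)"
    using walk_end_eqv[OF c(1)] chain_letters12[OF chain_ext.hyps(1)] by simp
  then have "ext_ok (p' @ u @ s) (p' @ t @ s) a"
    using chain_ext.hyps(2) canon_val_set_eq[OF c(1)] canon_val_set_eq[OF c(2)]
    unfolding ext_ok_def by simp
  then show ?case using chain_ext.IH[OF chain_ext.prems] by (rule chain.chain_ext[rotated])
qed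

text \<open>The value 1 occurs in \<open>u\<close>, and \<open>ext_ok\<close> rejects a first letter
  of value 2. Taking the canonical form therefore leaves \<open>s\<close> untouched.\<close>

lemma chain_val_subset: "chain p u t s \<Longrightarrow> val ` set s \<subseteq> val ` set (p @ u)"
proof (induction rule: chain.induct)
  case (chain_ext p u t s a)
  let ?w = "p @ u @ s"
  have lw: "set ?w \<subseteq> letters12" using chain_letters12[OF chain_ext.hyps(1)] by simp
  have "1 \<in> val ` set ?w" using chain_walk[OF chain_ext.hyps(1)] walk_end_val(1)[OF lw] by auto
  then have "val a \<in> val ` set ?w"
    using chain_ext.hyps(2) walk_end_val(2)[OF lw] unfolding ext_ok_def by auto
  moreover have "val ` set ?w \<subseteq> val ` set (p @ u)" using chain_ext.IH by auto
  ultimately show ?case using chain_ext.IH by auto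
qed simp

text \<open>Only \<open>u\<close> can be affected by taking the canonical form: \<open>p\<close> may
  be chosen canonical and \<open>s\<close> contains no first letters. The decomposition can then be
  compared with that of \<open>FP\<close> inside one and the same list.\<close>

lemma Rel_canonE:
  assumes "Rel w v"
  obtains p u t s where "chain p u t s" "canon p = p"
    "canon w = p @ canon_from (val ` set p) u @ s" "canon (p @ u @ s) = canon w" "canon v = canon (p @ t @ s)"
proof -
  obtain p0 u t s where ch: "chain p0 u t s" and c: "canon (p0 @ u @ s) = canon w"
    "canon (p0 @ t @ s) = canon v"
    using assms by (rule RelE)
  let ?p = "canon p0"
  have ch': "chain ?p u t s" by (rule chain_cong[OF ch]) simp
  have "canon_from (val ` set (?p @ u)) s = s" by (rule canon_from_full[OF chain_val_subset[OF ch']])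
  then have e: "canon (?p @ u @ s) = ?p @ canon_from (val ` set ?p) u @ s"
    by (simp add: canon_conv canon_from_append canon_from_canon_from image_Un)
  have "canon (?p @ u @ s) = canon w" "canon (?p @ t @ s) = canon v"
    using canon_append_cong[of ?p p0] c by simp_all
  then show ?thesis using that[OF ch'] e by simp
qed

lemma Rel_base_free:
  assumes "set p \<subseteq> letters12" "F_crit (walk_end p) u (Some t)" "set r \<subseteq> {P1, L2}"
  shows "Rel (p @ u @ r) (p @ t @ r)"
  using Rel_ext_free[OF Rel_chain[OF chain_base[OF assms(1,2)]] assms(3)] by simp

text \<open>Used with v the image of a word under F and z its image under F'.\<close>

definition compatible :: "letter list \<Rightarrow> letter list \<Rightarrow> bool" where
  "compatible v z \<longleftrightarrow> (\<exists>b. Rel z b \<and> FP v b) \<or> (\<nexists>b. Rel z b) \<and> (\<nexists>b. FP v b)"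

lemma compatible_cong:
  "canon v = canon v' \<Longrightarrow> canon z = canon z' \<Longrightarrow> compatible v z = compatible v' z'"
  unfolding compatible_def using Rel_cong[of z z'] FP_cong[of v v'] by simp

lemma compatibleI: "Rel z b \<Longrightarrow> FP v b \<Longrightarrow> compatible v z"
  by (auto simp: compatible_def)

lemma FP_val: "FP w v \<Longrightarrow> 1 \<in> val ` set w"
  using FP_walk[of w v] walk_end_val(1)[of w] FP_letters12[of w v] by auto

lemma Rel_val: "Rel w v \<Longrightarrow> 1 \<in> val ` set w"
  using Rel_walk[of w v] walk_end_val(1)[of w] Rel_letters12[of w v] by auto

text \<open>Here the images under F and F' coincide, and both operators agree on this word too: its
  first letter of value 1, if there is one, is a 1' in \<open>r\<close> that can be read as 1, and
  both turn it into 2'.\<close>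

lemma compatible_collapse:
  assumes p: "set p \<subseteq> letters12" "1 \<notin> val ` set p" and r: "set r \<subseteq> {P1, L2}"
  shows "compatible (p @ P2 # r) (p @ P2 # r)"
proof (cases "P1 \<in> set r")
  case False
  then have "1 \<notin> val ` set (p @ P2 # r)" using p r by auto
  then show ?thesis using FP_val Rel_val unfolding compatible_def by blast
next
  case True
  then obtain r1 r2 where r12: "r = r1 @ P1 # r2" "P1 \<notin> set r1" by (meson split_list_first)
  let ?q = "p @ P2 # r1"
  have q: "set ?q \<subseteq> letters12" "1 \<notin> val ` set ?q"
    using p r r12 by (auto simp: letters12_def)
  have r2: "set r2 \<subseteq> {P1, L2}" using r r12 by auto
  have "canon (?q @ P1 # r2) = canon (?q @ L1 # r2)"
    using canon_letter_cong[of P1 L1 ?q r2] q(2) by simp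
  then have "FP (?q @ P1 # r2) (?q @ P2 # r2)"
    using FP_I[OF q(1) r2] FP_cong[of "?q @ P1 # r2" "?q @ L1 # r2"] by simp
  moreover have "fst (walk_end ?q) = 0" using walk_end_no_val(1)[OF q] .
  then have "Rel (?q @ P1 # r2) (?q @ P2 # r2)"
    using Rel_base_free[OF q(1) F_crit_intros(4) r2] by simp
  ultimately show ?thesis using compatibleI[of _ "?q @ P2 # r2"] r12 by simp
qed

text \<open>F has turned a letter into 2 and F' has turned it into 2'. The run 1 1' ... 1' at the
  end of \<open>p\<close> supplies the second operation: F' changes its 1 to 2' in the first word,
  while in the second word the run and the 2' form a substring of type 1F whose transformation gives
  the same result.\<close>

lemma compatible_axis:
  assumes p: "set p \<subseteq> letters12" "snd (walk_end p) = 0" and r: "set r \<subseteq> {P1, L2}"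
  shows "compatible (p @ L2 # r) (p @ P2 # r)"
proof (cases "fst (walk_end p) = 0")
  case True
  then have p0: "p = []" using p walk_end_origin[OF p(1)] by (metis prod.collapse)
  have "canon (L2 # r) = canon (P2 # r)" by (simp add: canon_conv)
  then show ?thesis using compatible_collapse[of "[]" r] r p0
      compatible_cong[of "L2 # r" "P2 # r" "P2 # r" "P2 # r"] by simp
next
  case False
  then obtain p1 m where pm: "canon (p1 @ L1 # replicate m P1) = canon p"
    "snd (walk_end p1) = 0 \<or> snd (walk_end p1) = 1 \<and> fst (walk_end p1) \<ge> 1"
    using walk_x_axis[OF p(1)] p(2) by auto
  have p1: "set p1 \<subseteq> letters12" using canon_letters12[OF pm(1)[symmetric] p(1)] by simp
  have c: "canon (p1 @ L1 # replicate m P1 @ L2 # r) = canon (p @ L2 # r)"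
    "canon (p1 @ L1 # replicate m P1 @ P2 # r) = canon (p @ P2 # r)"
    using canon_append_cong[OF pm(1), of "L2 # r"] canon_append_cong[OF pm(1), of "P2 # r"] by auto
  let ?b = "p1 @ P2 # replicate m P1 @ L2 # r"
  have "Rel (p1 @ L1 # replicate m P1 @ P2 # r) ?b"
    using Rel_base_free[OF p1 F_crit_intros(1)[OF pm(2)] r, of m] by simp
  moreover have "FP (p1 @ L1 # replicate m P1 @ L2 # r) ?b"
    using r by (intro FP_I[OF p1]) (auto simp: set_replicate_conv_if)
  ultimately show ?thesis using compatibleI compatible_cong[OF c] by simp
qed

lemma walk_after_L1_pos:
  assumes "set r \<subseteq> {P1, L2}"
  shows "fst (walk_end (q @ L1 # r)) \<ge> 1"
proof -
  obtain x y where xy: "walk_end q = (x, y)" by (cases "walk_end q")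
  have "\<exists>x' y'. walk_step (x, y) L1 = (Suc x', y')" by (cases x) auto
  then obtain x' y' where s: "walk_step (x, y) L1 = (Suc x', y')" by blast
  then show ?thesis using wide_free[OF assms, of x' y'] unfolding walk_end_append xy by fastforce
qed

lemma append_eq_append_Cons:
  assumes "a @ b = q @ c # r"
  shows "(\<exists>x. a = q @ c # x \<and> r = x @ b) \<or> (\<exists>x. q = a @ x \<and> b = x @ c # r)"
  using assms by (auto simp: append_eq_append_conv2 append_eq_Cons_conv Cons_eq_append_conv)

lemma append3_cases:
  assumes "p @ u @ s = q @ c # r"
  obtains (before) p2 where "p = q @ c # p2" "r = p2 @ u @ s"
    | (inside) u1 u2 where "u = u1 @ c # u2" "q = p @ u1" "r = u2 @ s"
    | (after) s1 where "s = s1 @ c # r" "q = p @ u @ s1"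
proof -
  from append_eq_append_Cons[OF assms] show ?thesis
  proof (elim disjE exE conjE)
    fix x assume x: "q = p @ x" "u @ s = x @ c # r"
    from append_eq_append_Cons[OF x(2)] show ?thesis
      using x(1) inside after by blast
  qed (rule before)
qed

lemma Rel_FP_compatible:
  assumes "Rel w v" "FP w z"
  shows "compatible v z"
proof -
  obtain p u t s where ch: "chain p u t s" and cp: "canon p = p"
    and cw: "canon w = p @ canon_from (val ` set p) u @ s"
    and cw': "canon (p @ u @ s) = canon w" and cv: "canon v = canon (p @ t @ s)"
    using assms(1) by (rule Rel_canonE)
  let ?u = "canon_from (val ` set p) u"
  obtain q0 r where q0: "set q0 \<subseteq> letters12" and r: "set r \<subseteq> {P1, L2}"
    and cq: "canon w = canon (q0 @ L1 # r)" and cz0: "canon z = canon (q0 @ P2 # r)"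
    using assms(2) by (auto simp: FP_def)
  let ?q = "canon q0"
  have wq: "canon w = ?q @ L1 # r" using cq canon_FP[OF r] by simp
  have cz: "canon z = canon (?q @ P2 # r)" using cz0 canon_append_cong[of ?q q0] by simp
  have q: "set ?q \<subseteq> letters12" using canon_letters12[of q0 ?q] q0 by simp
  have lp: "set p \<subseteq> letters12" using chain_letters12[OF ch] by simp
  have cr: "F_crit (walk_end p) u (Some t)" using chain_crit[OF ch] by simp
  have eq: "p @ ?u @ s = ?q @ L1 # r" using cw wq by simp
  consider (before) p2 where "p = ?q @ L1 # p2" "r = p2 @ ?u @ s"
    | (inside) u1 u2 where "?u = u1 @ L1 # u2" "?q = p @ u1" "r = u2 @ s"
    | (after) s1 where "s = s1 @ L1 # r" "?q = p @ ?u @ s1"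
    using eq by (rule append3_cases)
  then show ?thesis
  proof cases
    case after
    \<comment> \<open>The operators act on different letters. At a letter 1 after \<open>u\<close>
      the walk has x \<ge> 2 and y \<ge> 1, so a 2' is equally admissible there.\<close>
    have ch1: "chain p u t s1" and ok: "ext_ok (p @ u @ s1) (p @ t @ s1) L1"
      using ch chain_prefix chain_ext_ok unfolding after(1) by blast+
    have "wide (walk_end (p @ u @ s1)) P2" using ok by (auto simp: ext_ok_def wide_def)
    then have "Rel ((p @ u @ s1) @ [P2]) ((p @ t @ s1) @ [P2])"
      by (intro Rel_ext Rel_chain ch1)
    from Rel_ext_free[OF this r]
    have rel: "Rel ((p @ u @ s1) @ P2 # r) ((p @ t @ s1) @ P2 # r)" by simp
    have "canon ((p @ u @ s1) @ L1 # r) = canon (?q @ L1 # r)"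
      using cw' wq after(1) by (metis append.assoc canon_idem)
    then have "canon (p @ u @ s1) = canon ?q"
      using canon_middle(1)[of "p @ u @ s1" L1 r ?q L1 r] after(2) by simp
    from canon_append_cong[OF this] have "canon ((p @ u @ s1) @ P2 # r) = canon z" using cz by simp
    then have "Rel z ((p @ t @ s1) @ P2 # r)" using rel Rel_cong by blast
    moreover have "FP ((p @ t @ s1) @ L1 # r) ((p @ t @ s1) @ P2 # r)"
      using chain_letters12[OF ch1] by (intro FP_I r) auto
    then have "FP v ((p @ t @ s1) @ P2 # r)"
      using FP_cong[of "(p @ t @ s1) @ L1 # r" v] cv after(1) by simp
    ultimately show ?thesis by (rule compatibleI)
  next
    case before
    \<comment> \<open>This cannot happen: \<open>?u\<close> would consist of letters 1' and 2, but
      type 4F, the only one without a letter 1, requires x = 0.\<close>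
    have p2: "set p2 \<subseteq> {P1, L2}" and u: "set ?u \<subseteq> {P1, L2}" using r before(2) by auto
    have "fst (walk_end p) \<ge> 1"
      using walk_after_L1_pos[OF p2, of ?q] before(1) by simp
    with cr show ?thesis by (cases rule: F_crit_cases) (use u in \<open>auto split: if_splits\<close>)
  next
    case inside
    have rs: "set u2 \<subseteq> {P1, L2}" "set s \<subseteq> {P1, L2}" using r inside(3) by auto
    have u1: "u1 = [] \<or> hd ?u = hd u1 \<and> L1 \<in> set (tl ?u)" using inside(1) by (cases u1) auto
    from cr show ?thesis
    proof (cases rule: F_crit_cases)
      case (F1 m)
      let ?c = "if 2 \<in> val ` set p then P2 else L2"
      have cu: "?u = L1 # replicate m P1 @ [?c]"
        by (simp add: F1(2) canon_from_append canon_from_full set_replicate_conv_if)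
      then have "u1 = []" using u1 by (auto split: if_splits)
      then have u2: "u2 = replicate m P1 @ [?c]" "?q = p" using inside cu by auto
      \<comment> \<open>Only 1' and 2 may follow the letter 1, so the closing 2' is a 2 in canonical
        form, that is, a first letter of value 2.\<close>
      then have no2: "2 \<notin> val ` set p" using rs(1) by (auto split: if_splits)
      then have re: "r = replicate m P1 @ L2 # s" using inside(3) u2 by simp
      have "canon v = canon (p @ L2 # r)"
        using cv F1(3) re canon_letter_cong[of P2 L2 p "replicate m P1 @ L2 # s"] no2 by simp
      moreover have "canon z = canon (p @ P2 # r)" using cz u2 by simp
      moreover have "snd (walk_end p) = 0" using walk_end_no_val(2)[OF lp no2] .
      ultimately show ?thesis using compatible_axis[OF lp _ r] compatible_cong by blast
    next
      case (F2 m)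
      have cu: "?u = L1 # replicate m L2 @ [P1]"
      proof -
        have "canon_from S (replicate m L2) = replicate m L2" for S
          by (induction m arbitrary: S) auto
        then show ?thesis by (simp add: F2(2) canon_from_append)
      qed
      then have "u1 = []" using u1 by (auto simp: set_replicate_conv_if split: if_splits)
      then have u2: "u2 = replicate m L2 @ [P1]" "?q = p" using inside cu by auto
      \<comment> \<open>After this prefix the image under F continues with 1 and the one under F'
        with 1'. As x = 0 here, F turns this 1' into 2' by type 4F, as F' does with the 1.\<close>
      let ?p = "p @ P2 # replicate m L2"
      have lp': "set ?p \<subseteq> letters12" using lp by (auto simp: letters12_def set_replicate_conv_if)
      obtain x y where xy: "walk_end p = (x, y)" by (cases "walk_end p")
      have "fst (walk_end ?p) = 0" using F2(1) by (auto simp: walk_end_append xy)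
      from Rel_base_free[OF lp' F_crit_intros(4)[OF this] rs(2)]
      have "Rel (?p @ P1 # s) (?p @ P2 # s)" by simp
      moreover have "canon (?p @ P1 # s) = canon z" using cz u2 inside(3) by simp
      ultimately have "Rel z (?p @ P2 # s)" using Rel_cong by blast
      moreover have "FP (?p @ L1 # s) (?p @ P2 # s)" by (rule FP_I[OF lp' rs(2)])
      then have "FP v (?p @ P2 # s)" using FP_cong[of "?p @ L1 # s" v] cv F2(3) by simp
      ultimately show ?thesis by (rule compatibleI)
    next
      case F3
      have cu: "?u = [L1]" by (simp add: F3(2))
      then have "u1 = []" using u1 by auto
      then have u2: "u2 = []" "?q = p" using inside cu by auto
      then have "canon v = canon (p @ L2 # r)" "canon z = canon (p @ P2 # r)"
        using cv F3(3) inside(3) cz by auto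
      then show ?thesis using compatible_axis[OF lp F3(1) r] compatible_cong by blast
    next
      case F4
      have "1 \<notin> val ` set p"
      proof
        assume "1 \<in> val ` set p"
        then have "?u = [P1]" by (simp add: F4(2))
        then show False using inside(1) by (auto simp: append_eq_Cons_conv)
      qed
      moreover from this have "?u = [L1]" by (simp add: F4(2))
      then have "u2 = []" "?q = p" using inside by (auto simp: append_eq_Cons_conv)
      then have "canon v = canon (p @ P2 # r)" "canon z = canon (p @ P2 # r)"
        using cv F4(3) inside(3) cz by auto
      ultimately show ?thesis using compatible_collapse[OF lp _ r] compatible_cong by blast
    qed
  qed
qed

section \<open>\<open>Rel\<close> and \<open>FP\<close> as partial injections on words\<close>

lemma Rel_functional:
  assumes "Rel w v" "Rel w v'" shows "canon v = canon v'"
proof -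
  have "opF w = Some (canon v)" "opF w = Some (canon v')"
    using opF_iff[of w] assms Rel_letters12 Rel_cong[of w w v "canon v"] Rel_cong[of w w v' "canon v'"]
    by auto
  then show ?thesis by simp
qed

lemma Rel_injective:
  assumes "Rel v w" "Rel v' w" shows "canon v = canon v'"
proof -
  have l: "set v \<subseteq> letters12" "set v' \<subseteq> letters12" using assms Rel_letters12 by auto
  have "canon (etas v) = canon (etas v')"
    using Rel_functional Rel_etas assms by blast
  from canon_etas_cong[OF this etas_letters12] show ?thesis
    unfolding etas_invol[OF l(1)] etas_invol[OF l(2)] .
qed

lemma FP_functional:
  assumes "FP w v" "FP w v'" shows "canon v = canon v'"
proof -
  have l: "set w \<subseteq> letters12" using assms FP_letters12 by auto
  then have lc: "set (canon w) \<subseteq> letters12" using canon_letters12[of w "canon w"] by simp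
  have "opF' (canon w) = Some (canon v)" "opF' (canon w) = Some (canon v')"
    using opF'_iff[OF is_word_canon lc] assms FP_cong[of w "canon w" v "canon v"]
      FP_cong[of w "canon w" v' "canon v'"] by auto
  then show ?thesis by simp
qed

lemma FP_injective:
  assumes "FP v w" "FP v' w" shows "canon v = canon v'"
proof -
  have l: "set v \<subseteq> letters12" "set v' \<subseteq> letters12" using assms FP_letters12 by auto
  have "canon (etas v) = canon (etas v')"
    using FP_functional FP_etas assms by blast
  from canon_etas_cong[OF this etas_letters12] show ?thesis
    unfolding etas_invol[OF l(1)] etas_invol[OF l(2)] .
qed

section \<open>Rows and columns\<close>

definition rowrel :: "letter \<Rightarrow> letter \<Rightarrow> bool" where
  "rowrel a b \<longleftrightarrow> a < b \<or> a = b \<and> \<not> is_Primed a"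

definition colrel :: "letter \<Rightarrow> letter \<Rightarrow> bool" where
  "colrel a b \<longleftrightarrow> a < b \<or> a = b \<and> is_Primed a"

lemma rowrel_simps [simp]:
  "\<not> rowrel P1 P1" "rowrel P1 L1" "rowrel P1 P2" "rowrel P1 L2"
  "\<not> rowrel L1 P1" "rowrel L1 L1" "rowrel L1 P2" "rowrel L1 L2"
  "\<not> rowrel P2 P1" "\<not> rowrel P2 L1" "\<not> rowrel P2 P2" "rowrel P2 L2"
  "\<not> rowrel L2 P1" "\<not> rowrel L2 L1" "\<not> rowrel L2 P2" "rowrel L2 L2"
  by (simp_all add: rowrel_def less_letter_def)

lemma colrel_simps [simp]:
  "colrel P1 P1" "colrel P1 L1" "colrel P1 P2" "colrel P1 L2"
  "\<not> colrel L1 P1" "\<not> colrel L1 L1" "colrel L1 P2" "colrel L1 L2"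
  "\<not> colrel P2 P1" "\<not> colrel P2 L1" "colrel P2 P2" "colrel P2 L2"
  "\<not> colrel L2 P1" "\<not> colrel L2 L1" "\<not> colrel L2 P2" "\<not> colrel L2 L2"
  by (simp_all add: colrel_def less_letter_def)

lemma letters12_cases: "a \<in> letters12 \<Longrightarrow> a = P1 \<or> a = L1 \<or> a = P2 \<or> a = L2"
  by (auto simp: letters12_def)

section \<open>Bounding the height of the walk by counting letters\<close>

abbreviation walk_at :: "letter list \<Rightarrow> nat \<Rightarrow> nat \<times> nat" where
  "walk_at w k \<equiv> walk_end (take k w)"

lemma walk_at_Suc: "k < length w \<Longrightarrow> walk_at w (Suc k) = walk_step (walk_at w k) (w ! k)"
  by (simp add: take_Suc_conv_app_nth walk_end_append)

lemma card_Collect_step: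
  fixes j k :: nat
  assumes "j \<le> k"
  shows "card {m. j \<le> m \<and> m < Suc k \<and> P m} = card {m. j \<le> m \<and> m < k \<and> P m} + (if P k then 1 else 0)"
proof (cases "P k")
  case True
  then have "{m. j \<le> m \<and> m < Suc k \<and> P m} = insert k {m. j \<le> m \<and> m < k \<and> P m}"
    using assms by (auto simp: less_Suc_eq)
  then show ?thesis using True by simp
next
  case False
  then have "{m. j \<le> m \<and> m < Suc k \<and> P m} = {m. j \<le> m \<and> m < k \<and> P m}"
    by (auto simp: less_Suc_eq)
  then show ?thesis using False by simp
qed

lemma Collect_empty_interval: "{m. j \<le> m \<and> m < (j::nat) \<and> P m} = {}"
  by auto

text \<open>A letter 2 always raises the height by one, and only a letter 1 read at x \<ge> 1 can
  lower it.\<close>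

lemma walk_count_ge:
  assumes "set w \<subseteq> letters12" "j \<le> k" "k \<le> length w"
  shows "snd (walk_at w j) + card {m. j \<le> m \<and> m < k \<and> w ! m = L2} \<le>
    snd (walk_at w k) + card {m. j \<le> m \<and> m < k \<and> w ! m = L1 \<and> fst (walk_at w m) \<ge> 1}"
  using assms(2,3)
proof (induction k rule: dec_induct)
  case (step k)
  obtain x y where xy: "walk_at w k = (x, y)" by (cases "walk_at w k")
  have a: "w ! k \<in> letters12" using assms(1) step by (meson Suc_le_lessD nth_mem subsetD)
  have "walk_at w (Suc k) = walk_step (x, y) (w ! k)"
    using step xy by (simp add: walk_at_Suc)
  then have "y + (if w ! k = L2 then 1 else 0) \<le> snd (walk_at w (Suc k))
      + (if w ! k = L1 \<and> fst (walk_at w k) \<ge> 1 then 1 else 0)"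
    using letters12_cases[OF a] xy by auto
  moreover note card_Collect_step[OF step(1), of "\<lambda>m. w ! m = L2"]
    card_Collect_step[OF step(1), of "\<lambda>m. w ! m = L1 \<and> fst (walk_at w m) \<ge> 1"]
  ultimately show ?case using step xy by (simp split: if_splits)
qed (simp add: Collect_empty_interval)

text \<open>Off the axes a 2' moves sideways and every 1 lowers the height, so the count of
  \<open>walk_count_ge\<close> becomes sharp.\<close>

lemma walk_count_le:
  assumes "set w \<subseteq> letters12" "j \<le> k" "k \<le> length w"
    and "\<And>m. j \<le> m \<Longrightarrow> m < k \<Longrightarrow> w ! m = L1 \<or> w ! m = P2 \<Longrightarrow>
      fst (walk_at w m) \<ge> 2 \<and> snd (walk_at w m) \<ge> 1"
  shows "snd (walk_at w k) + card {m. j \<le> m \<and> m < k \<and> w ! m = L1} \<le>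
    snd (walk_at w j) + card {m. j \<le> m \<and> m < k \<and> w ! m = L2}"
  using assms(2,3,4)
proof (induction k rule: dec_induct)
  case (step k)
  obtain x y where xy: "walk_at w k = (x, y)" by (cases "walk_at w k")
  have a: "w ! k \<in> letters12" using assms(1) step.prems by (meson Suc_le_lessD nth_mem subsetD)
  have ok: "x \<ge> 2 \<and> y \<ge> 1" if "w ! k = L1 \<or> w ! k = P2"
    using step.prems(2)[of k] step.hyps that xy by simp
  have "walk_at w (Suc k) = walk_step (x, y) (w ! k)"
    using step.prems xy by (simp add: walk_at_Suc)
  then have "snd (walk_at w (Suc k)) + (if w ! k = L1 then 1 else 0) \<le> y
      + (if w ! k = L2 then 1 else 0)"
    using letters12_cases[OF a] ok by auto
  moreover note card_Collect_step[OF step.hyps(1), of "\<lambda>m. w ! m = L2"]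
    card_Collect_step[OF step.hyps(1), of "\<lambda>m. w ! m = L1"]
  moreover have "snd (walk_at w k) + card {m. j \<le> m \<and> m < k \<and> w ! m = L1} \<le>
    snd (walk_at w j) + card {m. j \<le> m \<and> m < k \<and> w ! m = L2}"
    using step by simp
  ultimately show ?case using xy by (simp split: if_splits)
qed (simp add: Collect_empty_interval)

text \<open>\<open>B\<close> stands for the boxes with entries of value i and i + 1 of a tableau, in
  reading order. Instead of the partitions that bound this region only its convexity is recorded;
  the premise \<open>r \<le> c\<close> keeps corners out of the empty region left of the
  diagonal.\<close>

locale reading =
  fixes B :: "(nat \<times> nat) list"
  assumes sorted: "\<And>j k. j < k \<Longrightarrow> k < length B \<Longrightarrow>
      fst (B ! k) < fst (B ! j) \<or> fst (B ! j) = fst (B ! k) \<and> snd (B ! j) < snd (B ! k)"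
    and convex: "\<And>r1 c1 r2 c2 r c. (r1, c1) \<in> set B \<Longrightarrow> (r2, c2) \<in> set B \<Longrightarrow>
      r1 \<le> r \<Longrightarrow> r \<le> r2 \<Longrightarrow> c1 \<le> c \<Longrightarrow> c \<le> c2 \<Longrightarrow> r \<le> c \<Longrightarrow> (r, c) \<in> set B"
    and diagonal: "\<And>r c. (r, c) \<in> set B \<Longrightarrow> r \<le> c"
begin

definition pos :: "nat \<times> nat \<Rightarrow> nat" where
  "pos b = (THE k. k < length B \<and> B ! k = b)"

lemma nth_B_inj: "j < length B \<Longrightarrow> k < length B \<Longrightarrow> B ! j = B ! k \<Longrightarrow> j = k"
  using sorted[of j k] sorted[of k j] by (metis less_irrefl linorder_neqE_nat)

lemma pos_nth [simp]: "k < length B \<Longrightarrow> pos (B ! k) = k"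
  unfolding pos_def by (rule the_equality) (auto intro: nth_B_inj)

lemma pos_in: "b \<in> set B \<Longrightarrow> pos b < length B \<and> B ! pos b = b"
  by (metis in_set_conv_nth pos_nth)

lemma pos_eq_iff: "b \<in> set B \<Longrightarrow> b' \<in> set B \<Longrightarrow> pos b = pos b' \<longleftrightarrow> b = b'"
  by (metis pos_in)

lemma pos_less:
  assumes "(r, c) \<in> set B" "(r', c') \<in> set B"
  shows "pos (r, c) < pos (r', c') \<longleftrightarrow> r' < r \<or> r = r' \<and> c < c'"
proof -
  have "r' < r \<or> r = r' \<and> c < c'" if "pos (r, c) < pos (r', c')"
    using sorted[OF that] pos_in[OF assms(1)] pos_in[OF assms(2)] by auto
  moreover have "r < r' \<or> r = r' \<and> c' < c" if "pos (r', c') < pos (r, c)"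
    using sorted[OF that] pos_in[OF assms(1)] pos_in[OF assms(2)] by auto
  ultimately show ?thesis using pos_eq_iff[OF assms] by (metis linorder_neqE_nat not_less_iff_gr_or_eq prod.inject)
qed

text \<open>Convexity makes the rows contiguous, so what the walk says about the next letter becomes
  a statement about the right neighbour.\<close>

lemma next_in_row:
  assumes "(r, c) \<in> set B" "(r, c') \<in> set B" "c < c'"
  shows "(r, Suc c) \<in> set B" "pos (r, Suc c) = Suc (pos (r, c))"
proof -
  show s: "(r, Suc c) \<in> set B"
    using convex[OF assms(1,2), of r "Suc c"] assms(3) diagonal[OF assms(1)] by simp
  have lt: "pos (r, c) < pos (r, Suc c)" using pos_less[OF assms(1) s] by simp
  show "pos (r, Suc c) = Suc (pos (r, c))"
  proof (rule ccontr)
    assume "\<not> ?thesis"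
    then have l: "Suc (pos (r, c)) < pos (r, Suc c)" using lt by simp
    define k where "k = Suc (pos (r, c))"
    have k: "k < length B" "pos (r, c) < k" "k < pos (r, Suc c)"
      using l pos_in[OF s] by (auto simp: k_def)
    obtain r' c' where b: "B ! k = (r', c')" by (cases "B ! k")
    then have m: "(r', c') \<in> set B" "pos (r', c') = k" using k(1) by (metis nth_mem) (metis b k(1) pos_nth)
    show False using pos_less[OF assms(1) m(1)] pos_less[OF m(1) s] k m(2) by auto
  qed
qed

lemma prev_in_row:
  assumes "(r, c) \<in> set B" "(r, c') \<in> set B" "c' < c"
  obtains d where "c = Suc d" "(r, d) \<in> set B" "pos (r, c) = Suc (pos (r, d))"
proof -
  obtain d where d: "c = Suc d" using assms(3) by (cases c) auto
  have "(r, d) \<in> set B"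
    using convex[OF assms(2,1), of r d] assms(3) d diagonal[OF assms(2)] by simp
  moreover from next_in_row(2)[OF this assms(1)] d have "pos (r, c) = Suc (pos (r, d))" by simp
  ultimately show ?thesis using that d by blast
qed

lemma below_in:
  assumes "(r, c) \<in> set B" "(r', c) \<in> set B" "r < r'"
  shows "(Suc r, c) \<in> set B"
  using convex[OF assms(1,2), of "Suc r" c] assms(3) diagonal[OF assms(2)] by simp

lemma above_in:
  assumes "(Suc r, c) \<in> set B" "(r', c) \<in> set B" "r' < Suc r"
  shows "(r, c) \<in> set B"
  using convex[OF assms(2,1), of r c] assms(3) diagonal[OF assms(1)] by simp

definition tab :: "letter list \<Rightarrow> bool" where
  "tab w \<longleftrightarrow>
     (\<forall>r c c'. (r, c) \<in> set B \<and> (r, c') \<in> set B \<and> c < c' \<longrightarrow> rowrel (w ! pos (r, c)) (w ! pos (r, c'))) \<and>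
     (\<forall>r r' c. (r, c) \<in> set B \<and> (r', c) \<in> set B \<and> r < r' \<longrightarrow> colrel (w ! pos (r, c)) (w ! pos (r', c)))"

lemma tab_row: "tab w \<Longrightarrow> (r, c) \<in> set B \<Longrightarrow> (r, c') \<in> set B \<Longrightarrow> c < c' \<Longrightarrow>
    rowrel (w ! pos (r, c)) (w ! pos (r, c'))"
  by (auto simp: tab_def)

lemma tab_col: "tab w \<Longrightarrow> (r, c) \<in> set B \<Longrightarrow> (r', c) \<in> set B \<Longrightarrow> r < r' \<Longrightarrow>
    colrel (w ! pos (r, c)) (w ! pos (r', c))"
  by (auto simp: tab_def)

lemma letter_at:
  "set w \<subseteq> letters12 \<Longrightarrow> length w = length B \<Longrightarrow> b \<in> set B \<Longrightarrow>
    w ! pos b = P1 \<or> w ! pos b = L1 \<or> w ! pos b = P2 \<or> w ! pos b = L2"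
  by (metis letters12_cases nth_mem pos_in subsetD)

lemma finite_row: "finite {x. (r, x) \<in> set B}"
proof -
  have "{x. (r, x) \<in> set B} \<subseteq> snd ` set B" by force
  then show ?thesis by (rule finite_subset) simp
qed

lemma card_pos_row:
  assumes "\<And>x. x \<in> X \<Longrightarrow> (r, x) \<in> set B"
  shows "card ((\<lambda>x. pos (r, x)) ` X) = card X"
  by (rule card_image) (auto simp: inj_on_def pos_eq_iff assms)

text \<open>In the row r, the letters 1 from the first one up to column c all have a letter of value 2
  below them, and these are unprimed from the second one on. So at least as many letters 2 have
  been read as letters 1 that lower the walk. If the first 1 is on the diagonal nothing is below
  it, but then it is the first letter of value 1 of the word and does not lower the walk.\<close>

lemma walk_before_two_below:
  assumes tab: "tab w" and lw: "set w \<subseteq> letters12" and len: "length w = length B"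
    and rc: "(r, c) \<in> set B" "w ! pos (r, c) = L1" and d: "d = c \<or> d = Suc c"
    and rd: "(Suc r, d) \<in> set B" "w ! pos (Suc r, d) = P2 \<or> w ! pos (Suc r, d) = L2"
  shows "snd (walk_at w (pos (r, c))) \<ge> 1 + (d - c) \<or>
    d = Suc c \<and> fst (walk_at w (pos (r, c))) = 0 \<and> snd (walk_at w (pos (r, c))) \<ge> 1"
proof -
  note row = tab_row[OF tab] and col = tab_col[OF tab] and let4 = letter_at[OF lw len]
  define x0 where "x0 = (LEAST x. (r, x) \<in> set B \<and> w ! pos (r, x) = L1)"
  have x0: "(r, x0) \<in> set B" "w ! pos (r, x0) = L1"
    using LeastI[of "\<lambda>x. (r, x) \<in> set B \<and> w ! pos (r, x) = L1" c] rc by (auto simp: x0_def)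
  have x0_le: "x0 \<le> x" if "(r, x) \<in> set B" "w ! pos (r, x) = L1" for x
    unfolding x0_def using that by (intro Least_le) simp
  have x0c: "x0 \<le> c" using x0_le rc by simp
  have mid: "(r, x) \<in> set B \<and> w ! pos (r, x) = L1" if "x0 \<le> x" "x \<le> c" for x
  proof -
    have D: "(r, x) \<in> set B"
      using convex[OF x0(1) rc(1), of r x] that diagonal[OF x0(1)] by simp
    have "w ! pos (r, x) = L1"
    proof (cases "x = x0 \<or> x = c")
      case False
      then show ?thesis using row[OF x0(1) D] row[OF D rc(1)] that x0(2) rc(2) let4[OF D] by auto
    qed (use x0 rc in auto)
    then show ?thesis using D by simp
  qed
  define e where "e = max x0 (Suc r)"
  have ed: "e \<le> d" using x0c d diagonal[OF rd(1)] by (auto simp: e_def)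
  have lower: "(Suc r, x) \<in> set B" if "e \<le> x" "x \<le> d" for x
    using convex[OF x0(1) rd(1), of "Suc r" x] that by (simp add: e_def)
  have eD: "(Suc r, e) \<in> set B" using lower ed by simp
  have e2: "w ! pos (Suc r, e) = P2 \<or> w ! pos (Suc r, e) = L2"
  proof (cases "e \<le> c")
    case True
    then have "colrel L1 (w ! pos (Suc r, e))"
      using mid[of e] col[of r e "Suc r"] eD by (auto simp: e_def)
    then show ?thesis using let4[OF eD] by auto
  next
    case False
    then have "e = d" using ed d by auto
    then show ?thesis using rd by simp
  qed
  have two: "w ! pos (Suc r, x) = L2" if "e < x" "(Suc r, x) \<in> set B" for x
    using row[OF eD that(2,1)] e2 let4[OF that(2)] by auto
  \<comment> \<open>The count starts just after the leftmost box of the lower run: its letter, 2' or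
    2, has already made the height positive, which is the \<open>1 +\<close> of the claim.\<close>
  define j0 where "j0 = Suc (pos (Suc r, e))"
  define k where "k = pos (r, c)"
  have jk: "j0 \<le> k" using pos_less[OF eD rc(1)] by (simp add: j0_def k_def)
  have kl: "k < length w" using pos_in[OF rc(1)] len by (simp add: k_def)
  have j0y: "snd (walk_at w j0) \<ge> 1"
  proof -
    obtain x y where xy: "walk_at w (pos (Suc r, e)) = (x, y)" by (cases "walk_at w (pos (Suc r, e))")
    have "walk_at w j0 = walk_step (x, y) (w ! pos (Suc r, e))"
      using pos_in[OF eD] len xy by (simp add: j0_def walk_at_Suc)
    then show ?thesis using e2 by auto
  qed
  \<comment> \<open>A letter of value 1 read before the diagonal box would lie at or below a box of
    row \<open>Suc r\<close>, and that box has value 2.\<close>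
  have diag0: "fst (walk_at w (pos (r, r))) = 0" if "x0 = r"
  proof -
    have rr: "(r, r) \<in> set B" using x0 that by simp
    have er: "e = Suc r" using that by (simp add: e_def)
    have "1 \<notin> val ` set (take (pos (r, r)) w)"
    proof
      assume "1 \<in> val ` set (take (pos (r, r)) w)"
      then obtain m where m: "m < pos (r, r)" "m < length w" "val (w ! m) = 1"
        by (auto simp: in_set_conv_nth)
      obtain r' c' where b: "B ! m = (r', c')" by (cases "B ! m")
      have mB: "m < length B" using m len by simp
      then have D': "(r', c') \<in> set B" "pos (r', c') = m"
        using b by (metis nth_mem) (metis b mB pos_nth)
      then have "r < r'" using pos_less[OF D'(1) rr] m(1) diagonal[OF D'(1)] by auto
      then have c': "Suc r \<le> c'" using diagonal[OF D'(1)] by simp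
      then have D2: "(Suc r, c') \<in> set B"
        using convex[OF eD D'(1), of "Suc r" c'] \<open>r < r'\<close> er by simp
      then have "w ! pos (Suc r, c') = P2 \<or> w ! pos (Suc r, c') = L2"
        using e2 two[OF _ D2] er c' by (cases "c' = Suc r") auto
      then show False
        using col[OF D2 D'(1)] let4[OF D'(1)] D'(2) m(3) \<open>r < r'\<close> by (cases "r' = Suc r") auto
    qed
    then show ?thesis using walk_end_no_val(1)[of "take (pos (r, r)) w"] lw
      by (meson order_trans set_take_subset)
  qed
  have "(\<lambda>x. pos (Suc r, x)) ` {e<..d} \<subseteq> {m. j0 \<le> m \<and> m < k \<and> w ! m = L2}"
  proof
    fix m assume "m \<in> (\<lambda>x. pos (Suc r, x)) ` {e<..d}"
    then obtain x where x: "e < x" "x \<le> d" "m = pos (Suc r, x)" by auto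
    have D: "(Suc r, x) \<in> set B" using lower x by simp
    show "m \<in> {m. j0 \<le> m \<and> m < k \<and> w ! m = L2}"
      using two[OF x(1) D] pos_less[OF eD D] pos_less[OF D rc(1)] x by (simp add: j0_def k_def)
  qed
  then have "card ((\<lambda>x. pos (Suc r, x)) ` {e<..d}) \<le> card {m. j0 \<le> m \<and> m < k \<and> w ! m = L2}"
    by (intro card_mono) auto
  moreover have "card ((\<lambda>x. pos (Suc r, x)) ` {e<..d}) = card {e<..d}"
    by (rule card_pos_row) (use lower in auto)
  ultimately have twos: "d - e \<le> card {m. j0 \<le> m \<and> m < k \<and> w ! m = L2}" by simp
  have "{m. j0 \<le> m \<and> m < k \<and> w ! m = L1 \<and> fst (walk_at w m) \<ge> 1} \<subseteq> (\<lambda>x. pos (r, x)) ` {e..<c}"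
  proof
    fix m assume "m \<in> {m. j0 \<le> m \<and> m < k \<and> w ! m = L1 \<and> fst (walk_at w m) \<ge> 1}"
    then have m: "j0 \<le> m" "m < k" "w ! m = L1" "fst (walk_at w m) \<ge> 1" by auto
    have mB: "m < length B" using m kl len by simp
    obtain r' c' where b: "B ! m = (r', c')" by (cases "B ! m")
    have D': "(r', c') \<in> set B" "pos (r', c') = m"
      using b mB by (metis nth_mem) (metis b mB pos_nth)
    have "r' < Suc r \<or> Suc r = r' \<and> e < c'"
      using pos_less[OF eD D'(1)] m(1) D'(2) by (auto simp: j0_def)
    moreover have "\<not> (Suc r = r' \<and> e < c')" using two D' m(3) by auto
    moreover have "r < r' \<or> r' = r \<and> c' < c"
      using pos_less[OF D'(1) rc(1)] m(2) D'(2) by (auto simp: k_def)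
    ultimately have rr: "r' = r" "c' < c" by auto
    have "x0 \<le> c'" using x0_le D' rr m(3) by simp
    moreover have "\<not> (c' = r \<and> x0 = r)" using diag0 m(4) D' rr by auto
    moreover have "r \<le> c'" using diagonal D' rr by simp
    moreover have "r \<le> x0" using diagonal x0 by simp
    ultimately have "e \<le> c'" by (auto simp: e_def)
    then show "m \<in> (\<lambda>x. pos (r, x)) ` {e..<c}" using rr D' by force
  qed
  then have "card {m. j0 \<le> m \<and> m < k \<and> w ! m = L1 \<and> fst (walk_at w m) \<ge> 1} \<le> card ((\<lambda>x. pos (r, x)) ` {e..<c})"
    by (intro card_mono) auto
  also have "\<dots> \<le> card {e..<c}" by (rule card_image_le) simp
  finally have ones: "card {m. j0 \<le> m \<and> m < k \<and> w ! m = L1 \<and> fst (walk_at w m) \<ge> 1} \<le> c - e"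
    by simp
  have "1 + (d - e) \<le> snd (walk_at w k) + (c - e)"
    using walk_count_ge[OF lw jk] kl j0y twos ones by simp
  \<comment> \<open>If \<open>e > c\<close>, the letter 1 is itself the diagonal box; the height is
    then only known to be positive, but x = 0.\<close>
  moreover have "e \<le> c \<or> e = Suc c \<and> d = Suc c \<and> x0 = r \<and> c = r"
    using ed d x0c diagonal[OF rc(1)] diagonal[OF x0(1)] by (auto simp: e_def)
  ultimately show ?thesis using diag0 d ed by (auto simp: k_def)
qed

text \<open>The counterpart for inverting F: if the box above (Suc r, c) violates the column condition
  after the letter at (Suc r, c) has been lowered, then the letters 1 of row r up to column c1
  use up all of the height of the walk, but the last one still requires positive height.\<close>

lemma walk_two_below_converse:
  assumes tab: "tab v" and lv: "set v \<subseteq> letters12" and lenv: "length v = length B"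
    and lw: "set w \<subseteq> letters12" and len: "length w = length B"
    and wv: "\<And>m. j < m \<Longrightarrow> w ! m = v ! m"
    and ext: "\<And>m. j < m \<Longrightarrow> m < length w \<Longrightarrow> w ! m = L1 \<or> w ! m = P2 \<Longrightarrow>
      fst (walk_at w m) \<ge> 2 \<and> snd (walk_at w m) \<ge> 1"
    and lo: "(Suc r, c) \<in> set B" "v ! pos (Suc r, c) = P2 \<or> v ! pos (Suc r, c) = L2" "pos (Suc r, c) \<le> j"
    and up: "(r, c) \<in> set B" "v ! pos (r, c) = L1 \<or> v ! pos (r, c) = P2" "j < pos (r, c)"
    and c1: "(Suc r, c1) \<in> set B" "\<And>x. (Suc r, x) \<in> set B \<Longrightarrow> x \<le> c1"
  shows "1 + (c1 - c) \<le> snd (walk_at w (Suc j)) + card {x. c < x \<and> x \<le> c1 \<and> j < pos (Suc r, x)}"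
proof -
  note row = tab_row[OF tab] and col = tab_col[OF tab] and let4 = letter_at[OF lv lenv]
  have cc1: "c \<le> c1" using c1(2) lo(1) by simp
  have rc: "Suc r \<le> c" using diagonal[OF lo(1)] .
  have loD: "(Suc r, x) \<in> set B" if "c \<le> x" "x \<le> c1" for x
    using convex[OF lo(1) c1(1), of "Suc r" x] that rc by simp
  have upD: "(r, x) \<in> set B" if "c \<le> x" "x \<le> c1" for x
    using convex[OF up(1) c1(1), of r x] that rc by simp
  have lo2: "v ! pos (Suc r, x) = L2" if "c < x" "x \<le> c1" for x
    using row[OF lo(1) loD[of x]] lo(2) let4[OF loD[of x]] that by auto
  have up2: "v ! pos (r, x) = L1 \<or> v ! pos (r, x) = P2" if "c \<le> x" "x \<le> c1" for x
  proof (cases "x = c")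
    case False
    then show ?thesis
      using row[OF up(1) upD[of x]] col[OF upD[of x] loD[of x]] lo2[of x] up(2) let4[OF upD[of x]] that
      by auto
  qed (use up in simp)
  have up1: "v ! pos (r, x) = L1" if "c \<le> x" "x < c1" for x
    using row[OF upD[of x] upD[of c1]] up2[of x] up2[of c1] that by auto
  \<comment> \<open>The box above the right end of the lower row. The boxes of row \<open>r\<close>
    from column \<open>c\<close> up to it contribute \<open>c1 - c\<close> letters 1, and its own
    letter, 1 or 2', is still read at positive height.\<close>
  let ?k = "pos (r, c1)"
  have fD: "(r, c1) \<in> set B" using upD cc1 by simp
  have k: "?k < length w" using pos_in[OF fD] len by simp
  have jk: "j < ?k" using up(3) pos_less[OF up(1) fD] cc1 by (cases "c = c1") auto
  have yk: "snd (walk_at w ?k) \<ge> 1" using ext[OF jk k] wv[OF jk] up2[of c1] cc1 by auto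
  have count: "snd (walk_at w ?k) + card {m. Suc j \<le> m \<and> m < ?k \<and> w ! m = L1} \<le>
      snd (walk_at w (Suc j)) + card {m. Suc j \<le> m \<and> m < ?k \<and> w ! m = L2}"
    by (rule walk_count_le) (use lw jk k ext in auto)
  have "(\<lambda>x. pos (r, x)) ` {c..<c1} \<subseteq> {m. Suc j \<le> m \<and> m < ?k \<and> w ! m = L1}"
  proof
    fix m assume "m \<in> (\<lambda>x. pos (r, x)) ` {c..<c1}"
    then obtain x where x: "c \<le> x" "x < c1" "m = pos (r, x)" by auto
    have D: "(r, x) \<in> set B" using upD x by simp
    have "j < m" using up(3) pos_less[OF up(1) D] x by (cases "x = c") auto
    then show "m \<in> {m. Suc j \<le> m \<and> m < ?k \<and> w ! m = L1}"
      using up1[OF x(1,2)] pos_less[OF D fD] x wv[of m] by simp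
  qed
  then have "card ((\<lambda>x. pos (r, x)) ` {c..<c1}) \<le> card {m. Suc j \<le> m \<and> m < ?k \<and> w ! m = L1}"
    by (intro card_mono) auto
  moreover have "card ((\<lambda>x. pos (r, x)) ` {c..<c1}) = card {c..<c1}"
    by (rule card_pos_row) (use upD in auto)
  ultimately have ones: "c1 - c \<le> card {m. Suc j \<le> m \<and> m < ?k \<and> w ! m = L1}" by simp
  let ?X = "{x. c < x \<and> x \<le> c1 \<and> j < pos (Suc r, x)}"
  \<comment> \<open>Row \<open>r\<close> has no letter 2 to the left of \<open>c1\<close>, so all
    letters 2 of the interval come from row \<open>Suc r\<close>, to the right of column
    \<open>c\<close>.\<close>
  have "{m. Suc j \<le> m \<and> m < ?k \<and> w ! m = L2} \<subseteq> (\<lambda>x. pos (Suc r, x)) ` ?X"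
  proof
    fix m assume "m \<in> {m. Suc j \<le> m \<and> m < ?k \<and> w ! m = L2}"
    then have m: "j < m" "m < ?k" "v ! m = L2" using wv by auto
    have mB: "m < length B" using m k len by simp
    obtain r' c' where b: "B ! m = (r', c')" by (cases "B ! m")
    have D': "(r', c') \<in> set B" "pos (r', c') = m"
      using b mB by (metis nth_mem) (metis b mB pos_nth)
    have "r' < Suc r \<or> Suc r = r' \<and> c < c'"
      using pos_less[OF lo(1) D'(1)] m(1) lo(3) D'(2) by auto
    moreover have "r < r' \<or> r' = r \<and> c' < c1"
      using pos_less[OF D'(1) fD] m(2) D'(2) by auto
    moreover have "\<not> (r' = r \<and> c' < c1)"
      using row[of r c' c1] D' fD m(3) up2[of c1] cc1 by auto
    ultimately have "r' = Suc r" "c < c'" by auto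
    then show "m \<in> (\<lambda>x. pos (Suc r, x)) ` ?X" using D' c1(2) m(1) by force
  qed
  then have "card {m. Suc j \<le> m \<and> m < ?k \<and> w ! m = L2} \<le> card ((\<lambda>x. pos (Suc r, x)) ` ?X)"
    by (intro card_mono) auto
  also have "\<dots> \<le> card ?X" by (rule card_image_le) simp
  finally show ?thesis using ones count yk by simp
qed

end

lemma walk_x_mono:
  assumes "set w \<subseteq> letters12" "j \<le> k" "k \<le> length w"
    and "\<And>m. j \<le> m \<Longrightarrow> m < k \<Longrightarrow> w ! m \<noteq> P2"
  shows "fst (walk_at w j) \<le> fst (walk_at w k)"
  using assms(2,3,4)
proof (induction k rule: dec_induct)
  case (step k)
  obtain x y where xy: "walk_at w k = (x, y)" by (cases "walk_at w k")
  have a: "w ! k \<in> letters12" using assms(1) step.prems by (meson Suc_le_lessD nth_mem subsetD)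
  have "walk_at w (Suc k) = walk_step (x, y) (w ! k)"
    using step.prems xy by (simp add: walk_at_Suc)
  moreover have "w ! k \<noteq> P2" using step by simp
  ultimately have "x \<le> fst (walk_at w (Suc k))" using letters12_cases[OF a] by auto
  then show ?case using step xy by simp
qed simp

lemma walk_y_le:
  assumes "set w \<subseteq> letters12" "k \<le> length w"
  shows "snd (walk_at w k) \<le> card {m. m < k \<and> (w ! m = P2 \<or> w ! m = L2)}"
  using assms(2)
proof (induction k)
  case (Suc k)
  obtain x y where xy: "walk_at w k = (x, y)" by (cases "walk_at w k")
  have a: "w ! k \<in> letters12" using assms(1) Suc.prems by (meson Suc_le_lessD nth_mem subsetD)
  have "walk_at w (Suc k) = walk_step (x, y) (w ! k)"
    using Suc.prems xy by (simp add: walk_at_Suc)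
  then have "snd (walk_at w (Suc k)) \<le> y + (if w ! k = P2 \<or> w ! k = L2 then 1 else 0)"
    using letters12_cases[OF a] by auto
  moreover have "y \<le> card {m. m < k \<and> (w ! m = P2 \<or> w ! m = L2)}" using Suc xy by simp
  moreover note card_Collect_step[of 0 k "\<lambda>m. w ! m = P2 \<or> w ! m = L2"]
  ultimately show ?case by (simp split: if_splits)
qed simp

lemma walk_after_val1:
  "k < length w \<Longrightarrow> w ! k = P1 \<or> w ! k = L1 \<Longrightarrow> fst (walk_at w (Suc k)) \<ge> 1"
  by (cases "walk_at w k") (auto simp: walk_at_Suc)

lemma walk_after_val2:
  "k < length w \<Longrightarrow> w ! k = P2 \<or> w ! k = L2 \<Longrightarrow> snd (walk_at w (Suc k)) \<ge> 1"
  by (cases "walk_at w k") (auto simp: walk_at_Suc)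

section \<open>Checking the row and column conditions box by box\<close>

context reading
begin

definition box_ok :: "letter list \<Rightarrow> nat \<times> nat \<Rightarrow> bool" where
  "box_ok v b \<longleftrightarrow>
     (\<forall>c'. (fst b, c') \<in> set B \<and> snd b < c' \<longrightarrow> rowrel (v ! pos b) (v ! pos (fst b, c'))) \<and>
     (\<forall>c'. (fst b, c') \<in> set B \<and> c' < snd b \<longrightarrow> rowrel (v ! pos (fst b, c')) (v ! pos b)) \<and>
     (\<forall>r'. (r', snd b) \<in> set B \<and> fst b < r' \<longrightarrow> colrel (v ! pos b) (v ! pos (r', snd b))) \<and>
     (\<forall>r'. (r', snd b) \<in> set B \<and> r' < fst b \<longrightarrow> colrel (v ! pos (r', snd b)) (v ! pos b))"

lemma box_okI:
  assumes "\<And>c'. (r, c') \<in> set B \<Longrightarrow> c < c' \<Longrightarrow> rowrel (v ! pos (r, c)) (v ! pos (r, c'))"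
    and "\<And>c'. (r, c') \<in> set B \<Longrightarrow> c' < c \<Longrightarrow> rowrel (v ! pos (r, c')) (v ! pos (r, c))"
    and "\<And>r'. (r', c) \<in> set B \<Longrightarrow> r < r' \<Longrightarrow> colrel (v ! pos (r, c)) (v ! pos (r', c))"
    and "\<And>r'. (r', c) \<in> set B \<Longrightarrow> r' < r \<Longrightarrow> colrel (v ! pos (r', c)) (v ! pos (r, c))"
  shows "box_ok v (r, c)"
  using assms by (simp add: box_ok_def)

lemma tab_update:
  assumes "tab w" and agree: "\<And>b. b \<in> set B \<Longrightarrow> pos b \<noteq> i \<Longrightarrow> pos b \<noteq> j \<Longrightarrow> v ! pos b = w ! pos b"
    and ok: "\<And>b. b \<in> set B \<Longrightarrow> pos b = i \<or> pos b = j \<Longrightarrow> box_ok v b"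
  shows "tab v"
  unfolding tab_def
proof (intro conjI allI impI; elim conjE)
  fix r c c' assume D: "(r, c) \<in> set B" "(r, c') \<in> set B" "c < c'"
  show "rowrel (v ! pos (r, c)) (v ! pos (r, c'))"
    using ok[OF D(1)] ok[OF D(2)] agree[OF D(1)] agree[OF D(2)] tab_row[OF assms(1) D] D
    unfolding box_ok_def by (metis fst_conv snd_conv)
next
  fix r r' c assume D: "(r, c) \<in> set B" "(r', c) \<in> set B" "r < r'"
  show "colrel (v ! pos (r, c)) (v ! pos (r', c))"
    using ok[OF D(1)] ok[OF D(2)] agree[OF D(1)] agree[OF D(2)] tab_col[OF assms(1) D] D
    unfolding box_ok_def by (metis fst_conv snd_conv)
qed

lemma box_at:
  assumes "i < length B" obtains r c where "(r, c) \<in> set B" "pos (r, c) = i"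
  using assms by (metis nth_mem pos_nth surj_pair)

lemma between:
  assumes D: "(r, c) \<in> set B" "(r', c') \<in> set B"
    and m: "pos (r, c) < m" "m < pos (r', c')" and r: "r = r' \<or> r = Suc r'"
  obtains x where "(r, x) \<in> set B" "pos (r, x) = m" "c < x" "r = r' \<longrightarrow> x < c'"
    | x where "r = Suc r'" "(r', x) \<in> set B" "pos (r', x) = m" "x < c'"
proof -
  have "m < length B" using m(2) pos_in[OF D(2)] by simp
  then obtain a x where ax: "(a, x) \<in> set B" "pos (a, x) = m" by (rule box_at)
  have "a < r \<or> r = a \<and> c < x" using pos_less[OF D(1) ax(1)] m(1) ax(2) by simp
  moreover have "r' < a \<or> a = r' \<and> x < c'" using pos_less[OF ax(1) D(2)] m(2) ax(2) by simp
  ultimately show ?thesis using that ax r by force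
qed

end

text \<open>What is used of a chain: \<open>i\<close> and \<open>j\<close> are the first and the
  last position of the critical substring, the only ones that change, and \<open>ext\<close> is what
  \<open>ext_ok\<close> says about later letters 1 and 2'.\<close>

locale reading_update = reading +
  fixes w v :: "letter list" and i j :: nat
  assumes lw: "set w \<subseteq> letters12" and lv: "set v \<subseteq> letters12"
    and lenw: "length w = length B" and lenv: "length v = length B"
    and ij: "i \<le> j" "j < length B"
    and agree: "\<And>m. m \<noteq> i \<Longrightarrow> m \<noteq> j \<Longrightarrow> v ! m = w ! m"
    and ext: "\<And>m. j < m \<Longrightarrow> m < length w \<Longrightarrow> w ! m = L1 \<or> w ! m = P2 \<Longrightarrow>
      fst (walk_at w m) \<ge> 2 \<and> snd (walk_at w m) \<ge> 1"
begin

section \<open>Applying F keeps a filling semistandard\<close>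

lemma agree_letters: "w ! m \<noteq> w ! i \<Longrightarrow> w ! m \<noteq> w ! j \<Longrightarrow> v ! m = w ! m"
  using agree[of m] by auto

lemma w_at: "b \<in> set B \<Longrightarrow> w ! pos b = P1 \<or> w ! pos b = L1 \<or> w ! pos b = P2 \<or> w ! pos b = L2"
  by (rule letter_at[OF lw lenw])

lemma v_at: "b \<in> set B \<Longrightarrow> v ! pos b = P1 \<or> v ! pos b = L1 \<or> v ! pos b = P2 \<or> v ! pos b = L2"
  by (rule letter_at[OF lv lenv])

text \<open>Height 0 at the changed letter settles both directions: the right neighbour is also read
  at height 0, hence is neither 1 nor 2', and a box below would force positive height by
  \<open>walk_before_two_below\<close>.\<close>

lemma forward_F3:
  assumes tab: "tab w" and e: "i = j" "w ! i = L1" "v ! i = L2" "snd (walk_at w i) = 0"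
  shows "tab v"
proof (rule tab_update[OF tab, of i j])
  fix b assume "b \<in> set B" "pos b = i \<or> pos b = j"
  moreover obtain r c where b: "b = (r, c)" by (cases b)
  ultimately have rc: "(r, c) \<in> set B" "pos (r, c) = i" using e(1) by auto
  note row = tab_row[OF tab] and col = tab_col[OF tab]
  have vpos: "v ! pos b = w ! pos b" if "pos b \<noteq> i" for b using agree e(1) that by simp
  have ne: "pos (r', c') \<noteq> i" if "(r', c') \<in> set B" "(r', c') \<noteq> (r, c)" for r' c'
    using pos_eq_iff[OF that(1) rc(1)] rc(2) that(2) by simp
  have ysuc: "snd (walk_at w (Suc i)) = 0"
    using e(2,4) ij lenw e(1) by (cases "walk_at w i") (auto simp: walk_at_Suc)
  have "box_ok v (r, c)"
  proof (rule box_okI)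
    fix c' assume D: "(r, c') \<in> set B" "c < c'"
    note s = next_in_row[OF rc(1) D]
    have "Suc i < length w" using pos_in[OF s(1)] s(2) rc(2) lenw by simp
    then have "w ! Suc i \<noteq> L1 \<and> w ! Suc i \<noteq> P2" using ext[of "Suc i"] ysuc e(1) by auto
    then have L2: "w ! pos (r, Suc c) = L2"
      using row[OF rc(1) s(1)] e(2) s(2) rc(2) w_at[OF s(1)] by auto
    have "w ! pos (r, c') = L2"
      using L2 row[OF s(1) D(1)] D(2) w_at[OF D(1)] by (cases "c' = Suc c") auto
    then show "rowrel (v ! pos (r, c)) (v ! pos (r, c'))"
      using vpos[OF ne[OF D(1)]] D(2) rc(2) e(3) by simp
  next
    fix c' assume D: "(r, c') \<in> set B" "c' < c"
    show "rowrel (v ! pos (r, c')) (v ! pos (r, c))"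
      using v_at[OF D(1)] rc(2) e(3) by auto
  next
    fix r' assume D: "(r', c) \<in> set B" "r < r'"
    have bD: "(Suc r, c) \<in> set B" by (rule below_in[OF rc(1) D])
    have "w ! pos (Suc r, c) = P2 \<or> w ! pos (Suc r, c) = L2"
      using col[OF rc(1) bD] e(2) rc(2) w_at[OF bD] by auto
    from walk_before_two_below[OF tab lw lenw rc(1) _ _ bD this] e(2,4) rc(2)
    show "colrel (v ! pos (r, c)) (v ! pos (r', c))" by simp
  next
    fix r' assume D: "(r', c) \<in> set B" "r' < r"
    have "w ! pos (r', c) = P1" using col[OF D(1) rc(1) D(2)] e(2) rc(2) w_at[OF D(1)] by auto
    then show "colrel (v ! pos (r', c)) (v ! pos (r, c))"
      using vpos[OF ne[OF D(1)]] D(2) rc(2) e(3) by simp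
  qed
  then show "box_ok v b" using b by simp
qed (use agree in auto)

text \<open>The danger is a letter of value 1 below. Reading it gives x \<ge> 1, and only a 2' can
  bring x back to 0; this 2' lies in the row below, further right, under a box of the changed row.
  But the changed row continues with letters 2, which cannot stand above 2'.\<close>

lemma forward_F4:
  assumes tab: "tab w" and e: "i = j" "w ! i = P1" "v ! i = P2" "fst (walk_at w i) = 0"
  shows "tab v"
proof (rule tab_update[OF tab, of i j])
  fix b assume "b \<in> set B" "pos b = i \<or> pos b = j"
  moreover obtain r c where b: "b = (r, c)" by (cases b)
  ultimately have rc: "(r, c) \<in> set B" "pos (r, c) = i" using e(1) by auto
  note row = tab_row[OF tab] and col = tab_col[OF tab]
  have vpos: "v ! pos b = w ! pos b" if "pos b \<noteq> i" for b using agree e(1) that by simp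
  have ne: "pos (r', c') \<noteq> i" if "(r', c') \<in> set B" "(r', c') \<noteq> (r, c)" for r' c'
    using pos_eq_iff[OF that(1) rc(1)] rc(2) that(2) by simp
  have xsuc: "fst (walk_at w (Suc i)) = 1"
    using e(2,4) ij lenw e(1) by (cases "walk_at w i") (auto simp: walk_at_Suc)
  have nxt: "w ! pos (r, Suc c) = L2" if s: "(r, Suc c) \<in> set B" "pos (r, Suc c) = Suc i"
  proof -
    have "Suc i < length w" using pos_in[OF s(1)] s(2) lenw by simp
    then have "w ! Suc i \<noteq> L1 \<and> w ! Suc i \<noteq> P2" using ext[of "Suc i"] xsuc e(1) by auto
    then show ?thesis using row[OF rc(1) s(1)] e(2) s(2) rc(2) w_at[OF s(1)] by auto
  qed
  have "box_ok v (r, c)"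
  proof (rule box_okI)
    fix c' assume D: "(r, c') \<in> set B" "c < c'"
    note s = next_in_row[OF rc(1) D]
    have L2: "w ! pos (r, Suc c) = L2" using nxt s rc(2) by simp
    have "w ! pos (r, c') = L2"
      using L2 row[OF s(1) D(1)] D(2) w_at[OF D(1)] by (cases "c' = Suc c") auto
    then show "rowrel (v ! pos (r, c)) (v ! pos (r, c'))"
      using vpos[OF ne[OF D(1)]] D(2) rc(2) e(3) by simp
  next
    fix c' assume D: "(r, c') \<in> set B" "c' < c"
    then show "rowrel (v ! pos (r, c')) (v ! pos (r, c))"
      using row[OF D(1) rc(1)] w_at[OF D(1)] rc(2) e(2) by auto
  next
    fix r' assume D: "(r', c) \<in> set B" "r < r'"
    have "w ! pos (r', c) = P2 \<or> w ! pos (r', c) = L2"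
    proof (rule ccontr)
      assume "\<not> ?thesis"
      then have x: "w ! pos (r', c) = P1 \<or> w ! pos (r', c) = L1" using w_at[OF D(1)] by auto
      have bD: "(Suc r, c) \<in> set B" by (rule below_in[OF rc(1) D])
      have z: "w ! pos (Suc r, c) = P1 \<or> w ! pos (Suc r, c) = L1"
        using x col[OF bD D(1)] D(2) w_at[OF bD] by (cases "r' = Suc r") auto
      let ?k = "pos (Suc r, c)"
      have k: "?k < i" using pos_less[OF bD rc(1)] rc(2) by simp
      have il: "i < length w" using ij e(1) lenw by simp
      have "fst (walk_at w (Suc ?k)) \<ge> 1" using walk_after_val1[of ?k w] z k il by simp
      then have "\<not> fst (walk_at w (Suc ?k)) \<le> fst (walk_at w i)" using e(4) by simp
      then obtain m where m: "Suc ?k \<le> m" "m < i" "w ! m = P2"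
        using walk_x_mono[OF lw, of "Suc ?k" i] k il by fastforce
      have "?k < m" "m < pos (r, c)" using m rc(2) by auto
      then obtain x where x: "(Suc r, x) \<in> set B" "pos (Suc r, x) = m" "c < x"
      proof (rule between[OF bD rc(1)])
        fix x assume "(r, x) \<in> set B" "pos (r, x) = m" "x < c"
        then have False using row[of r x c] rc e(2) m(3) by simp
        then show ?thesis ..
      qed auto
      have xD: "(r, x) \<in> set B" using convex[OF rc(1) x(1), of r x] x(3) diagonal[OF rc(1)] by simp
      note s = next_in_row[OF rc(1) xD x(3)]
      have "w ! pos (r, x) \<noteq> L2" using col[OF xD x(1)] x(2) m(3) by auto
      moreover have "w ! pos (r, Suc c) = L2" using nxt s rc(2) by simp
      ultimately show False
        using row[OF s(1) xD] x(3) w_at[OF xD] by (cases "x = Suc c") auto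
    qed
    then show "colrel (v ! pos (r, c)) (v ! pos (r', c))"
      using vpos[OF ne[OF D(1)]] D(2) rc(2) e(3) by auto
  next
    fix r' assume D: "(r', c) \<in> set B" "r' < r"
    have "w ! pos (r', c) = P1" using col[OF D(1) rc(1) D(2)] e(2) rc(2) w_at[OF D(1)] by auto
    then show "colrel (v ! pos (r', c)) (v ! pos (r, c))"
      using vpos[OF ne[OF D(1)]] D(2) rc(2) e(3) by simp
  qed
  then show "box_ok v b" using b by simp
qed (use agree in auto)

text \<open>The critical case is a letter of value 2 below the closing 2', which becomes 2. Then the
  whole substring lies in the row of this 2', where 1 cannot precede 1'; so it is just 1 2' in
  adjacent boxes, and \<open>walk_before_two_below\<close> with \<open>d = Suc c\<close> contradicts
  the location.\<close>

lemma forward_F1: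
  assumes tab: "tab w" and e: "i < j" "w ! i = L1" "w ! j = P2" "v ! i = P2" "v ! j = L2"
    and mid: "\<And>m. i < m \<Longrightarrow> m < j \<Longrightarrow> w ! m = P1"
    and st: "snd (walk_at w i) = 0 \<or> snd (walk_at w i) = 1 \<and> fst (walk_at w i) \<ge> 1"
  shows "tab v"
proof (rule tab_update[OF tab, of i j])
  note row = tab_row[OF tab] and col = tab_col[OF tab]
  have iB: "i < length B" using ij by simp
  obtain r c where rc: "(r, c) \<in> set B" "pos (r, c) = i" using iB by (rule box_at)
  obtain r2 c2 where rc2: "(r2, c2) \<in> set B" "pos (r2, c2) = j" using ij(2) by (rule box_at)
  have ok1: "box_ok v (r, c)"
  proof (rule box_okI)
    fix c' assume D: "(r, c') \<in> set B" "c < c'"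
    note s = next_in_row[OF rc(1) D]
    have "Suc i = j"
      using mid[of "Suc i"] row[OF rc(1) s(1)] s(2) rc(2) e(1,2) by (cases "Suc i < j") auto
    then have P2: "w ! pos (r, Suc c) = P2" "pos (r, Suc c) = j" using s rc(2) e(3) by auto
    have "v ! pos (r, c') = L2"
    proof (cases "c' = Suc c")
      case False
      then have "w ! pos (r, c') = L2"
        using P2 row[OF s(1) D(1)] D(2) w_at[OF D(1)] by auto
      then show ?thesis using agree_letters[of "pos (r, c')"] e(2,3) by simp
    qed (use P2 e in simp)
    then show "rowrel (v ! pos (r, c)) (v ! pos (r, c'))" using rc(2) e(4) by simp
  next
    fix c' assume D: "(r, c') \<in> set B" "c' < c"
    have "w ! pos (r, c') = P1 \<or> w ! pos (r, c') = L1"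
      using row[OF D(1) rc(1) D(2)] rc(2) e(2) w_at[OF D(1)] by auto
    moreover have "pos (r, c') < i" using pos_less[OF D(1) rc(1)] D(2) rc(2) by simp
    ultimately show "rowrel (v ! pos (r, c')) (v ! pos (r, c))"
      using agree[of "pos (r, c')"] e(1,4) rc(2) by auto
  next
    fix r' assume D: "(r', c) \<in> set B" "r < r'"
    have "w ! pos (r', c) = P2 \<or> w ! pos (r', c) = L2"
      using col[OF rc(1) D] rc(2) e(2) w_at[OF D(1)] by auto
    moreover have "pos (r', c) < i" using pos_less[OF D(1) rc(1)] D(2) rc(2) by simp
    ultimately show "colrel (v ! pos (r, c)) (v ! pos (r', c))"
      using agree[of "pos (r', c)"] e(1,4) rc(2) by auto
  next
    fix r' assume D: "(r', c) \<in> set B" "r' < r"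
    have "w ! pos (r', c) = P1" using col[OF D(1) rc(1) D(2)] e(2) rc(2) w_at[OF D(1)] by auto
    then show "colrel (v ! pos (r', c)) (v ! pos (r, c))"
      using agree_letters[of "pos (r', c)"] e(2,3,4) rc(2) by simp
  qed
  have ok2: "box_ok v (r2, c2)"
  proof (rule box_okI)
    fix c' assume D: "(r2, c') \<in> set B" "c2 < c'"
    have "w ! pos (r2, c') = L2" using row[OF rc2(1) D] rc2(2) e(3) w_at[OF D(1)] by auto
    then show "rowrel (v ! pos (r2, c2)) (v ! pos (r2, c'))"
      using agree_letters[of "pos (r2, c')"] e(2,3,5) rc2(2) by simp
  next
    fix c' assume D: "(r2, c') \<in> set B" "c' < c2"
    show "rowrel (v ! pos (r2, c')) (v ! pos (r2, c2))" using v_at[OF D(1)] rc2(2) e(5) by auto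
  next
    fix r' assume D: "(r', c2) \<in> set B" "r2 < r'"
    have bD: "(Suc r2, c2) \<in> set B" by (rule below_in[OF rc2(1) D])
    have z: "w ! pos (Suc r2, c2) = P2 \<or> w ! pos (Suc r2, c2) = L2"
      using col[OF rc2(1) bD] rc2(2) e(3) w_at[OF bD] by auto
    let ?k = "pos (Suc r2, c2)"
    have kj: "?k < j" using pos_less[OF bD rc2(1)] rc2(2) by simp
    have ki: "?k < i" using z kj mid[of ?k] e(2) by (cases "?k = i"; cases "i < ?k") auto
    have left: "\<exists>x. (r2, x) \<in> set B \<and> pos (r2, x) = m \<and> x < c2"
      if m: "i \<le> m" "m < j" for m
    proof -
      have w1: "w ! m = L1 \<or> w ! m = P1" using mid[of m] m e(2) by (cases "m = i") auto
      have "?k < m" "m < pos (r2, c2)" using m ki rc2(2) by auto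
      then show ?thesis
      proof (rule between[OF bD rc2(1)])
        fix x assume x: "(Suc r2, x) \<in> set B" "pos (Suc r2, x) = m" "c2 < x"
        then have False using row[OF bD x(1,3)] z w1 by auto
        then show ?thesis ..
      qed auto
    qed
    obtain j' where j': "j = Suc j'" using e(1) by (cases j) auto
    obtain d where d: "(r2, d) \<in> set B" "pos (r2, d) = j'" "d < c2"
      using left[of j'] e(1) j' by auto
    have "i = j'"
    proof (rule ccontr)
      assume "i \<noteq> j'"
      then have lt: "i < j'" using e(1) j' by simp
      then obtain d' where d': "(r2, d') \<in> set B" "pos (r2, d') = i" "d' < c2"
        using left[of i] e(1) j' by auto
      have "d' < d" using pos_less[OF d'(1) d(1)] d' d lt by simp
      from row[OF d'(1) d(1) this] show False using mid[of j'] lt j' d(2) d'(2) e(2) by simp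
    qed
    then have "(r2, d) = (r, c)" using pos_eq_iff[OF d(1) rc(1)] d(2) rc(2) by simp
    then have rr: "r2 = r" "d = c" by auto
    have c2: "c2 = Suc c"
    proof -
      obtain d0 where d0: "c2 = Suc d0" "(r2, d0) \<in> set B" "pos (r2, c2) = Suc (pos (r2, d0))"
        using prev_in_row[OF rc2(1) d(1,3)] .
      have "pos (r2, d0) = pos (r2, d)" using d0(3) rc2(2) j' d(2) by simp
      then show ?thesis using pos_eq_iff[OF d0(2) d(1)] d0(1) rr by simp
    qed
    have "w ! pos (r, c) = L1" using rc(2) e(2) by simp
    from walk_before_two_below[OF tab lw lenw rc(1) this, of "Suc c"] bD z
    have False using c2 rr st rc(2) by auto
    then show "colrel (v ! pos (r2, c2)) (v ! pos (r', c2))" ..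
  next
    fix r' assume D: "(r', c2) \<in> set B" "r' < r2"
    have "w ! pos (r', c2) = P1 \<or> w ! pos (r', c2) = L1 \<or> w ! pos (r', c2) = P2"
      using col[OF D(1) rc2(1) D(2)] e(3) rc2(2) w_at[OF D(1)] by auto
    moreover have "j < pos (r', c2)" using pos_less[OF rc2(1) D(1)] D(2) rc2(2) by simp
    ultimately show "colrel (v ! pos (r', c2)) (v ! pos (r2, c2))"
      using agree[of "pos (r', c2)"] e(1,5) rc2(2) by auto
  qed
  fix b assume "b \<in> set B" "pos b = i \<or> pos b = j"
  then show "box_ok v b"
    using ok1 ok2 pos_eq_iff[of b "(r, c)"] pos_eq_iff[of b "(r2, c2)"] rc rc2 by auto
qed (use agree in auto)

text \<open>The critical case is a letter of value 1 below the closing 1', which becomes 1. If the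
  box directly below were read before the substring, the initial 1 would violate a row or column
  condition; inside the substring there are only letters 2. So this box holds the initial 1, which
  becomes 2'.\<close>

lemma forward_F2:
  assumes tab: "tab w" and e: "i < j" "w ! i = L1" "w ! j = P1" "v ! i = P2" "v ! j = L1"
    and mid: "\<And>m. i < m \<Longrightarrow> m < j \<Longrightarrow> w ! m = L2"
  shows "tab v"
proof (rule tab_update[OF tab, of i j])
  note row = tab_row[OF tab] and col = tab_col[OF tab]
  have iB: "i < length B" using ij by simp
  obtain r c where rc: "(r, c) \<in> set B" "pos (r, c) = i" using iB by (rule box_at)
  obtain r2 c2 where rc2: "(r2, c2) \<in> set B" "pos (r2, c2) = j" using ij(2) by (rule box_at)
  have ok1: "box_ok v (r, c)"
  proof (rule box_okI)
    fix c' assume D: "(r, c') \<in> set B" "c < c'"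
    note s = next_in_row[OF rc(1) D]
    have "Suc i \<noteq> j" using row[OF rc(1) s(1)] s(2) rc(2) e(2,3) by auto
    then have sL: "w ! pos (r, Suc c) = L2" using mid[of "Suc i"] s(2) rc(2) e(1) by simp
    then have "w ! pos (r, c') = L2"
      using row[OF s(1) D(1)] D(2) w_at[OF D(1)] by (cases "c' = Suc c") auto
    then show "rowrel (v ! pos (r, c)) (v ! pos (r, c'))"
      using agree_letters[of "pos (r, c')"] rc(2) e(2,3,4) by simp
  next
    fix c' assume D: "(r, c') \<in> set B" "c' < c"
    have "w ! pos (r, c') = P1 \<or> w ! pos (r, c') = L1"
      using row[OF D(1) rc(1) D(2)] rc(2) e(2) w_at[OF D(1)] by auto
    moreover have "pos (r, c') < i" using pos_less[OF D(1) rc(1)] D(2) rc(2) by simp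
    ultimately show "rowrel (v ! pos (r, c')) (v ! pos (r, c))"
      using agree[of "pos (r, c')"] e(1,4) rc(2) by auto
  next
    fix r' assume D: "(r', c) \<in> set B" "r < r'"
    have "w ! pos (r', c) = P2 \<or> w ! pos (r', c) = L2"
      using col[OF rc(1) D] rc(2) e(2) w_at[OF D(1)] by auto
    moreover have "pos (r', c) < i" using pos_less[OF D(1) rc(1)] D(2) rc(2) by simp
    ultimately show "colrel (v ! pos (r, c)) (v ! pos (r', c))"
      using agree[of "pos (r', c)"] e(1,4) rc(2) by auto
  next
    fix r' assume D: "(r', c) \<in> set B" "r' < r"
    have "w ! pos (r', c) = P1" using col[OF D(1) rc(1) D(2)] e(2) rc(2) w_at[OF D(1)] by auto
    moreover from this have "pos (r', c) \<noteq> i" using e(2) by auto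
    ultimately show "colrel (v ! pos (r', c)) (v ! pos (r, c))"
      using agree[of "pos (r', c)"] e(4,5) rc(2) by (cases "pos (r', c) = j") simp_all
  qed
  have ok2: "box_ok v (r2, c2)"
  proof (rule box_okI)
    fix c' assume D: "(r2, c') \<in> set B" "c2 < c'"
    have "w ! pos (r2, c') \<noteq> P1" using row[OF rc2(1) D] rc2(2) e(3) by auto
    moreover have "j < pos (r2, c')" using pos_less[OF rc2(1) D(1)] D(2) rc2(2) by simp
    ultimately show "rowrel (v ! pos (r2, c2)) (v ! pos (r2, c'))"
      using agree[of "pos (r2, c')"] w_at[OF D(1)] e(1,5) rc2(2) by auto
  next
    fix c' assume D: "(r2, c') \<in> set B" "c' < c2"
    then show "rowrel (v ! pos (r2, c')) (v ! pos (r2, c2))"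
      using row[OF D(1) rc2(1)] rc2(2) e(3) w_at[OF D(1)] by auto
  next
    fix r' assume D: "(r', c2) \<in> set B" "r2 < r'"
    have "v ! pos (r', c2) = P2 \<or> v ! pos (r', c2) = L2"
    proof (rule ccontr)
      assume neg: "\<not> ?thesis"
      then have ni: "pos (r', c2) \<noteq> i" using e(4) by auto
      moreover have "pos (r', c2) < j" using pos_less[OF D(1) rc2(1)] D(2) rc2(2) by simp
      ultimately have x: "w ! pos (r', c2) = P1 \<or> w ! pos (r', c2) = L1"
        using neg agree[of "pos (r', c2)"] w_at[OF D(1)] by auto
      have bD: "(Suc r2, c2) \<in> set B" by (rule below_in[OF rc2(1) D])
      have z: "w ! pos (Suc r2, c2) = P1 \<or> w ! pos (Suc r2, c2) = L1"
        using x col[OF bD D(1)] D(2) w_at[OF bD] by (cases "r' = Suc r2") auto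
      let ?k = "pos (Suc r2, c2)"
      have kj: "?k < j" using pos_less[OF bD rc2(1)] rc2(2) by simp
      have "\<not> ?k < i"
      proof
        assume "?k < i"
        moreover have "i < pos (r2, c2)" using rc2(2) e(1) by simp
        ultimately show False
        proof (rule between[OF bD rc2(1)])
          fix x assume x: "(Suc r2, x) \<in> set B" "pos (Suc r2, x) = i" "c2 < x"
          have xD: "(r2, x) \<in> set B"
            using convex[OF rc2(1) x(1), of r2 x] x(3) diagonal[OF rc2(1)] by simp
          show False
            using row[OF rc2(1) xD x(3)] col[OF xD x(1)] x(2) rc2(2) e(2,3) w_at[OF xD] by auto
        next
          fix x assume x: "(r2, x) \<in> set B" "pos (r2, x) = i" "x < c2"
          show False using row[OF x(1) rc2(1) x(3)] x(2) rc2(2) e(2,3) by simp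
        qed auto
      qed
      moreover have "\<not> i < ?k" using mid[of ?k] kj z by auto
      ultimately have k: "?k = i" by simp
      then have "r' \<noteq> Suc r2" using ni by auto
      then have "colrel L1 (w ! pos (r', c2))" using col[OF bD D(1)] D(2) k e(2) by simp
      then show False using x by auto
    qed
    then show "colrel (v ! pos (r2, c2)) (v ! pos (r', c2))" using rc2(2) e(5) by auto
  next
    fix r' assume D: "(r', c2) \<in> set B" "r' < r2"
    have "w ! pos (r', c2) = P1" using col[OF D(1) rc2(1) D(2)] e(3) rc2(2) w_at[OF D(1)] by auto
    moreover have "j < pos (r', c2)" using pos_less[OF rc2(1) D(1)] D(2) rc2(2) by simp
    ultimately show "colrel (v ! pos (r', c2)) (v ! pos (r2, c2))"
      using agree[of "pos (r', c2)"] e(1,5) rc2(2) by auto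
  qed
  fix b assume "b \<in> set B" "pos b = i \<or> pos b = j"
  then show "box_ok v b"
    using ok1 ok2 pos_eq_iff[of b "(r, c)"] pos_eq_iff[of b "(r2, c2)"] rc rc2 by auto
qed (use agree in auto)

end

section \<open>Undoing F keeps a filling semistandard\<close>

context reading_update
begin

lemma row_end:
  assumes "(r, c) \<in> set B"
  obtains c1 where "(r, c1) \<in> set B" "\<And>x. (r, x) \<in> set B \<Longrightarrow> x \<le> c1"
proof -
  have "{x. (r, x) \<in> set B} \<noteq> {}" using assms by blast
  then show ?thesis
    using Max_in[OF finite_row] Max_ge[OF finite_row] by (intro that[of "Max {x. (r, x) \<in> set B}"]) auto
qed

text \<open>A letter 1 or 2' above the changed box is excluded by
  \<open>walk_two_below_converse\<close>: at height 0 its right side is at most the number of boxes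
  to the right, while the left side is one more. A left neighbour of value 2 would make the height
  positive.\<close>

lemma backward_F3:
  assumes tab: "tab v" and e: "i = j" "w ! i = L1" "v ! i = L2" "snd (walk_at w i) = 0"
  shows "tab w"
proof (rule tab_update[OF tab, of i j])
  fix b assume "b \<in> set B" "pos b = i \<or> pos b = j"
  moreover obtain r c where b: "b = (r, c)" by (cases b)
  ultimately have rc: "(r, c) \<in> set B" "pos (r, c) = i" using e(1) by auto
  note row = tab_row[OF tab] and col = tab_col[OF tab]
  have wpos: "w ! pos b = v ! pos b" if "pos b \<noteq> i" for b using agree e(1) that by simp
  have ne: "pos (r', c') \<noteq> i" if "(r', c') \<in> set B" "(r', c') \<noteq> (r, c)" for r' c'
    using pos_eq_iff[OF that(1) rc(1)] rc(2) that(2) by simp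
  have ysuc: "snd (walk_at w (Suc i)) = 0"
    using e(2,4) ij lenw e(1) by (cases "walk_at w i") (auto simp: walk_at_Suc)
  have "box_ok w (r, c)"
  proof (rule box_okI)
    fix c' assume D: "(r, c') \<in> set B" "c < c'"
    have "v ! pos (r, c') = L2" using row[OF rc(1) D] rc(2) e(3) v_at[OF D(1)] by auto
    then show "rowrel (w ! pos (r, c)) (w ! pos (r, c'))"
      using wpos[OF ne[OF D(1)]] D(2) rc(2) e(2) by simp
  next
    fix c' assume D: "(r, c') \<in> set B" "c' < c"
    obtain d where d: "c = Suc d" "(r, d) \<in> set B" "pos (r, c) = Suc (pos (r, d))"
      using prev_in_row[OF rc(1) D] .
    have "w ! pos (r, d) \<noteq> P2 \<and> w ! pos (r, d) \<noteq> L2"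
      using walk_after_val2[of "pos (r, d)" w] d(3) rc(2) e(4) pos_in[OF d(2)] lenw by auto
    then have vd: "v ! pos (r, d) = P1 \<or> v ! pos (r, d) = L1"
      using wpos[OF ne[OF d(2)]] d(1) v_at[OF d(2)] by auto
    have "v ! pos (r, c') = P1 \<or> v ! pos (r, c') = L1"
      using vd row[OF D(1) d(2)] D(2) d(1) v_at[OF D(1)] by (cases "c' = d") auto
    then show "rowrel (w ! pos (r, c')) (w ! pos (r, c))"
      using wpos[OF ne[OF D(1)]] D(2) rc(2) e(2) by auto
  next
    fix r' assume D: "(r', c) \<in> set B" "r < r'"
    show "colrel (w ! pos (r, c)) (w ! pos (r', c))"
      using col[OF rc(1) D] rc(2) e(3) v_at[OF D(1)] by auto
  next
    fix r' assume D: "(r', c) \<in> set B" "r' < r"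
    obtain r0 where r0: "r = Suc r0" using D(2) by (cases r) auto
    have rcS: "(Suc r0, c) \<in> set B" using rc(1) r0 by simp
    have aD: "(r0, c) \<in> set B" using above_in[OF rcS D(1)] D(2) r0 by simp
    have y: "v ! pos (r0, c) = P1"
    proof (rule ccontr)
      assume "v ! pos (r0, c) \<noteq> P1"
      then have y: "v ! pos (r0, c) = L1 \<or> v ! pos (r0, c) = P2"
        using col[OF aD rcS] v_at[OF aD] rc(2) r0 e(3) by auto
      obtain c1 where c1: "(Suc r0, c1) \<in> set B" "\<And>x. (Suc r0, x) \<in> set B \<Longrightarrow> x \<le> c1"
        using row_end[OF rcS] by metis
      have "i < pos (r0, c)" using pos_less[OF rcS aD] rc(2) r0 by simp
      then have "1 + (c1 - c) \<le> snd (walk_at w (Suc j)) + card {x. c < x \<and> x \<le> c1 \<and> j < pos (Suc r0, x)}"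
        using r0 rc(2) e(1,3) y aD rcS c1 agree ext
        by (intro walk_two_below_converse[OF tab lv lenv lw lenw]) auto
      moreover have "card {x. c < x \<and> x \<le> c1 \<and> j < pos (Suc r0, x)} \<le> card {c<..c1}"
        by (rule card_mono) auto
      ultimately show False using ysuc e(1) by simp
    qed
    then have "v ! pos (r', c) = P1"
      using col[OF D(1) aD] D(2) r0 v_at[OF D(1)] by (cases "r' = r0") auto
    then show "colrel (w ! pos (r', c)) (w ! pos (r, c))"
      using wpos[OF ne[OF D(1)]] D(2) rc(2) e(2) by simp
  qed
  then show "box_ok w b" using b by simp
qed (use agree in auto)

text \<open>No box can be to the left, since its letter would make x positive, and only letters 2
  follow in the row. If the box above violates the column condition, its row is entered at x = 1,
  where \<open>ext\<close> forbids 1 and 2'; so that row starts with a 1' on the diagonal, and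
  \<open>ext1\<close> asks for an earlier letter of value 1 in \<open>v\<close>. Such a letter would
  stand below a 2 of row \<open>r\<close>.\<close>

lemma backward_F4:
  assumes tab: "tab v" and e: "i = j" "w ! i = P1" "v ! i = P2" "fst (walk_at w i) = 0"
    and ext1: "\<And>m. j < m \<Longrightarrow> m < length w \<Longrightarrow> w ! m = P1 \<Longrightarrow>
      fst (walk_at w m) \<ge> 2 \<or> 1 \<in> val ` set (take m v)"
  shows "tab w"
proof (rule tab_update[OF tab, of i j])
  fix b assume "b \<in> set B" "pos b = i \<or> pos b = j"
  moreover obtain r c where b: "b = (r, c)" by (cases b)
  ultimately have rc: "(r, c) \<in> set B" "pos (r, c) = i" using e(1) by auto
  note row = tab_row[OF tab] and col = tab_col[OF tab]
  have wpos: "w ! pos b = v ! pos b" if "pos b \<noteq> i" for b using agree e(1) that by simp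
  have ne: "pos (r', c') \<noteq> i" if "(r', c') \<in> set B" "(r', c') \<noteq> (r, c)" for r' c'
    using pos_eq_iff[OF that(1) rc(1)] rc(2) that(2) by simp
  have right: "v ! pos (r, c') = L2" if "(r, c') \<in> set B" "c < c'" for c'
    using row[OF rc(1) that] rc(2) e(3) v_at[OF that(1)] by auto
  have left: "(r, c') \<notin> set B" if lt: "c' < c" for c'
  proof
    assume D: "(r, c') \<in> set B"
    obtain d where d: "c = Suc d" "(r, d) \<in> set B" "pos (r, c) = Suc (pos (r, d))"
      using prev_in_row[OF rc(1) D lt] .
    have "v ! pos (r, d) = P1 \<or> v ! pos (r, d) = L1"
      using row[OF d(2) rc(1)] d(1) rc(2) e(3) v_at[OF d(2)] by auto
    then have "w ! pos (r, d) = P1 \<or> w ! pos (r, d) = L1"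
      using wpos[OF ne[OF d(2)]] d(1) by simp
    then show False
      using walk_after_val1[of "pos (r, d)" w] d(3) rc(2) e(4) pos_in[OF d(2)] lenw by auto
  qed
  have xsuc: "fst (walk_at w (Suc i)) = 1"
    using e(2,4) ij lenw e(1) by (cases "walk_at w i") (auto simp: walk_at_Suc)
  have "box_ok w (r, c)"
  proof (rule box_okI)
    fix c' assume D: "(r, c') \<in> set B" "c < c'"
    then show "rowrel (w ! pos (r, c)) (w ! pos (r, c'))"
      using wpos[OF ne[OF D(1)]] right rc(2) e(2) by simp
  next
    fix c' assume D: "(r, c') \<in> set B" "c' < c"
    then show "rowrel (w ! pos (r, c')) (w ! pos (r, c))" using left by blast
  next
    fix r' assume D: "(r', c) \<in> set B" "r < r'"
    show "colrel (w ! pos (r, c)) (w ! pos (r', c))"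
      using w_at[OF D(1)] rc(2) e(2) by auto
  next
    fix r' assume D: "(r', c) \<in> set B" "r' < r"
    obtain r0 where r0: "r = Suc r0" using D(2) by (cases r) auto
    have rcS: "(Suc r0, c) \<in> set B" using rc(1) r0 by simp
    have aD: "(r0, c) \<in> set B" using above_in[OF rcS D(1)] D(2) r0 by simp
    have y: "v ! pos (r0, c) = P1"
    proof (rule ccontr)
      assume "v ! pos (r0, c) \<noteq> P1"
      then have y: "v ! pos (r0, c) = L1 \<or> v ! pos (r0, c) = P2"
        using col[OF aD rcS] v_at[OF aD] rc(2) r0 e(3) by auto
      have diag: "x = r0 \<and> c = r" if x: "(r0, x) \<in> set B" "x < c" for x
      proof -
        have "x < r"
        proof (rule ccontr)
          assume "\<not> x < r"
          then have "(r, x) \<in> set B" using convex[OF x(1) rc(1), of r x] x(2) r0 by simp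
          then show False using left x(2) by blast
        qed
        then have xr: "x = r0" using diagonal[OF x(1)] r0 by simp
        have "r \<le> c" using diagonal[OF rc(1)] .
        then have "(r, r) \<in> set B" using convex[OF x(1) rc(1), of r r] xr r0 by simp
        then have "\<not> r < c" using left by blast
        then show ?thesis using xr \<open>r \<le> c\<close> by simp
      qed
      \<comment> \<open>The leftmost column of row \<open>r0\<close>: as row \<open>r\<close> has
        nothing left of column \<open>c\<close>, only a diagonal box can precede that
        column.\<close>
      define x1 where "x1 = (if (r0, r0) \<in> set B \<and> r0 < c then r0 else c)"
      have x1: "(r0, x1) \<in> set B" using aD by (simp add: x1_def)
      have x1_min: "x1 \<le> x" if "(r0, x) \<in> set B" for x
        using diag[OF that] that by (cases "x < c") (auto simp: x1_def)
      let ?m0 = "pos (r0, x1)"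
      have im: "i < ?m0" using pos_less[OF rcS x1] rc(2) r0 by simp
      have m0l: "?m0 < length w" using pos_in[OF x1] lenw by simp
      have gap: "w ! m = L2" if m: "i < m" "m < ?m0" for m
      proof -
        have "pos (Suc r0, c) < m" using m(1) rc(2) r0 by simp
        then show ?thesis using m(2)
        proof (rule between[OF rcS x1])
          fix x assume x: "(Suc r0, x) \<in> set B" "pos (Suc r0, x) = m" "c < x"
          then show ?thesis using right[of x] r0 wpos[of "(r, x)"] m(1) by simp
        next
          fix x assume x: "(r0, x) \<in> set B" "x < x1"
          then show ?thesis using x1_min[OF x(1)] by simp
        qed auto
      qed
      have "fst (walk_at w m) = 1" if "Suc i \<le> m" "m \<le> ?m0" for m
        using that
      proof (induction m rule: dec_induct)
        case (step m)
        then have "w ! m = L2" using gap[of m] by simp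
        then show ?case using step m0l by (cases "walk_at w m") (auto simp: walk_at_Suc)
      qed (use xsuc in simp)
      then have x: "fst (walk_at w ?m0) = 1" using im by simp
      have jm: "j < ?m0" using im e(1) by simp
      have wv0: "w ! ?m0 = v ! ?m0" using wpos im by simp
      have no: "v ! ?m0 \<noteq> L1" "v ! ?m0 \<noteq> P2" using ext[OF jm m0l] x wv0 by auto
      then have x1c: "x1 \<noteq> c" using y by auto
      then have x1r: "x1 = r0" "r0 < c" "c = r" using diag[of r0] x1 by (auto simp: x1_def split: if_splits)
      have z: "v ! ?m0 = P1"
        using row[OF x1 aD] x1r y no v_at[OF x1] by auto
      have "1 \<in> val ` set (take ?m0 v)"
        using ext1[OF jm m0l] x wv0 z by simp
      then obtain m where m: "m < ?m0" "m < length v" "val (v ! m) = 1"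
        by (auto simp: in_set_conv_nth)
      have "m < i"
        using m(1,3) gap[of m] e(3) wpos agree[of m] e(1) by (cases "m = i"; cases "i < m") auto
      have mB: "m < length B" using m(2) lenv by simp
      then obtain a x where ax: "(a, x) \<in> set B" "pos (a, x) = m" by (rule box_at)
      have "r < a \<or> a = r \<and> x < c" using pos_less[OF ax(1) rc(1)] ax(2) \<open>m < i\<close> rc(2) by simp
      then have ra: "r < a" using left ax(1) by blast
      then have xr: "c < x" using diagonal[OF ax(1)] x1r(3) by simp
      have rx: "(r, x) \<in> set B" using convex[OF rc(1) ax(1), of r x] ra xr x1r(3) by simp
      have "v ! pos (r, x) = L2" using right[OF rx xr] .
      then show False using col[OF rx ax(1) ra] v_at[OF ax(1)] by auto
    qed
    then have "v ! pos (r', c) = P1"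
      using col[OF D(1) aD] D(2) r0 v_at[OF D(1)] by (cases "r' = r0") auto
    then show "colrel (w ! pos (r', c)) (w ! pos (r, c))"
      using wpos[OF ne[OF D(1)]] D(2) rc(2) e(2) by simp
  qed
  then show "box_ok w b" using b by simp
qed (use agree in auto)

text \<open>If the box above \<open>i\<close> violates the column condition, the rows leave no room
  for a 1' inside the substring, so \<open>j = Suc i\<close>, and the height after \<open>j\<close>
  is 1. When \<open>j\<close> is the right neighbour of \<open>i\<close>, it is missing from the
  count in \<open>walk_two_below_converse\<close>, which offsets this 1; when the row ends at
  \<open>i\<close>, the 2 at \<open>j\<close> stands left of the violating letter.\<close>

lemma backward_F1:
  assumes tab: "tab v" and e: "i < j" "w ! i = L1" "w ! j = P2" "v ! i = P2" "v ! j = L2"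
    and mid: "\<And>m. i < m \<Longrightarrow> m < j \<Longrightarrow> w ! m = P1"
    and st: "snd (walk_at w i) = 0 \<or> snd (walk_at w i) = 1 \<and> fst (walk_at w i) \<ge> 1"
  shows "tab w"
proof (rule tab_update[OF tab, of i j])
  note row = tab_row[OF tab] and col = tab_col[OF tab]
  have iB: "i < length B" using ij by simp
  obtain r c where rc: "(r, c) \<in> set B" "pos (r, c) = i" using iB by (rule box_at)
  obtain r2 c2 where rc2: "(r2, c2) \<in> set B" "pos (r2, c2) = j" using ij(2) by (rule box_at)
  have midv: "v ! m = P1" if "i < m" "m < j" for m using mid[OF that] agree[of m] that by simp
  have ok1: "box_ok w (r, c)"
  proof (rule box_okI)
    fix c' assume D: "(r, c') \<in> set B" "c < c'"
    have "v ! pos (r, c') = L2" using row[OF rc(1) D] rc(2) e(4) v_at[OF D(1)] by auto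
    moreover from this have "pos (r, c') \<noteq> i" using e(4) by auto
    ultimately show "rowrel (w ! pos (r, c)) (w ! pos (r, c'))"
      using agree[of "pos (r, c')"] e(2,3) rc(2) by (cases "pos (r, c') = j") simp_all
  next
    fix c' assume D: "(r, c') \<in> set B" "c' < c"
    have "v ! pos (r, c') = P1 \<or> v ! pos (r, c') = L1"
      using row[OF D(1) rc(1) D(2)] rc(2) e(4) v_at[OF D(1)] by auto
    moreover have "pos (r, c') < i" using pos_less[OF D(1) rc(1)] D(2) rc(2) by simp
    ultimately show "rowrel (w ! pos (r, c')) (w ! pos (r, c))"
      using agree[of "pos (r, c')"] e(1,2) rc(2) by auto
  next
    fix r' assume D: "(r', c) \<in> set B" "r < r'"
    have "v ! pos (r', c) = P2 \<or> v ! pos (r', c) = L2"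
      using col[OF rc(1) D] rc(2) e(4) v_at[OF D(1)] by auto
    moreover have "pos (r', c) < i" using pos_less[OF D(1) rc(1)] D(2) rc(2) by simp
    ultimately show "colrel (w ! pos (r, c)) (w ! pos (r', c))"
      using agree[of "pos (r', c)"] e(1,2) rc(2) by auto
  next
    fix r' assume D: "(r', c) \<in> set B" "r' < r"
    obtain r0 where r0: "r = Suc r0" using D(2) by (cases r) auto
    have rcS: "(Suc r0, c) \<in> set B" using rc(1) r0 by simp
    have aD: "(r0, c) \<in> set B" using above_in[OF rcS D(1)] D(2) r0 by simp
    have y: "v ! pos (r0, c) = P1"
    proof (rule ccontr)
      assume "v ! pos (r0, c) \<noteq> P1"
      then have y: "v ! pos (r0, c) = L1 \<or> v ! pos (r0, c) = P2"
        using col[OF aD rcS] v_at[OF aD] rc(2) r0 e(4) by auto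
      let ?f = "pos (r0, c)"
      have "i < ?f" using pos_less[OF rcS aD] rc(2) r0 by simp
      then have jf: "j < ?f" using midv[of ?f] y e(5) by (cases "?f = j"; cases "?f < j") auto
      have upper: "m < ?f \<Longrightarrow> i < m \<Longrightarrow> v ! m \<noteq> L2 \<Longrightarrow>
          \<exists>x. (r0, x) \<in> set B \<and> pos (r0, x) = m \<and> x < c" for m
      proof -
        assume m: "m < ?f" "i < m" "v ! m \<noteq> L2"
        have "pos (Suc r0, c) < m" using m(2) rc(2) r0 by simp
        then show ?thesis using m(1)
        proof (rule between[OF rcS aD])
          fix x assume x: "(Suc r0, x) \<in> set B" "pos (Suc r0, x) = m" "c < x"
          then show ?thesis using row[OF rcS x(1,3)] m(3) rc(2) r0 e(4) v_at[OF x(1)] by auto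
        qed auto
      qed
      have upL2: False if "(r0, x) \<in> set B" "x < c" "v ! pos (r0, x) = L2" for x
        using row[OF that(1) aD that(2)] that(3) y by auto
      have "Suc i = j"
      proof (rule ccontr)
        assume "Suc i \<noteq> j"
        then have s: "Suc i < j" using e(1) by simp
        then have v1: "v ! Suc i = P1" using midv by simp
        then obtain x where x: "(r0, x) \<in> set B" "pos (r0, x) = Suc i" "x < c"
          using upper[of "Suc i"] s jf by auto
        note n = next_in_row[OF x(1) aD x(3)]
        have n2: "pos (r0, Suc x) = Suc (Suc i)" using n(2) x(2) by simp
        have nc: "Suc x \<noteq> c" using n2 s jf by auto
        have "v ! Suc (Suc i) = P1 \<or> v ! Suc (Suc i) = L2"
          using midv[of "Suc (Suc i)"] e(5) s by (cases "Suc (Suc i) = j") auto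
        then show False
          using row[OF x(1) n(1)] v1 x(2) n2 upL2[OF n(1)] nc x(3) by auto
      qed
      \<comment> \<open>From height 0, or from height 1 off the axes, the letter 1 leads to height
        0, where 2' acts as an upward step.\<close>
      have y1: "snd (walk_at w (Suc j)) = 1"
      proof -
        obtain a b where ab: "walk_at w i = (a, b)" by (cases "walk_at w i")
        have "walk_at w j = walk_step (a, b) L1"
          using \<open>Suc i = j\<close> walk_at_Suc[of i w] e(2) ab ij lenw by simp
        moreover have "walk_at w (Suc j) = walk_step (walk_at w j) P2"
          using walk_at_Suc[of j w] e(3) ij lenw by simp
        ultimately show ?thesis using st ab by (cases a) auto
      qed
      obtain c1 where c1: "(Suc r0, c1) \<in> set B" "\<And>x. (Suc r0, x) \<in> set B \<Longrightarrow> x \<le> c1"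
        using row_end[OF rcS] by metis
      have ineq: "1 + (c1 - c) \<le> snd (walk_at w (Suc j)) + card {x. c < x \<and> x \<le> c1 \<and> j < pos (Suc r0, x)}"
        using r0 rc(2) e(1,4) y aD rcS c1 agree ext jf
        by (intro walk_two_below_converse[OF tab lv lenv lw lenw]) auto
      show False
      proof (cases "c1 = c")
        case True
        have "pos (Suc r0, c) < j" using rc(2) r0 e(1) by simp
        then show False using jf
        proof (rule between[OF rcS aD])
          fix x assume "(Suc r0, x) \<in> set B" "c < x"
          then show False using c1(2) True by fastforce
        next
          fix x assume x: "(r0, x) \<in> set B" "pos (r0, x) = j" "x < c"
          then show False using upL2[OF x(1,3)] e(5) by simp
        qed auto
      next
        case False
        then have lt: "c < c1" using c1(2) rcS by (metis le_neq_implies_less)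
        have sj: "pos (Suc r0, Suc c) = j"
          using next_in_row(2)[OF rcS c1(1) lt] rc(2) r0 \<open>Suc i = j\<close> by simp
        have "{x. c < x \<and> x \<le> c1 \<and> j < pos (Suc r0, x)} \<subseteq> {Suc c<..c1}"
        proof
          fix x assume "x \<in> {x. c < x \<and> x \<le> c1 \<and> j < pos (Suc r0, x)}"
          then have "c < x" "x \<le> c1" "x \<noteq> Suc c" using sj by auto
          then show "x \<in> {Suc c<..c1}" by auto
        qed
        then have "card {x. c < x \<and> x \<le> c1 \<and> j < pos (Suc r0, x)} \<le> card {Suc c<..c1}"
          by (intro card_mono) auto
        then show False using ineq y1 lt by simp
      qed
    qed
    then have "v ! pos (r', c) = P1"
      using col[OF D(1) aD] D(2) r0 v_at[OF D(1)] by (cases "r' = r0") auto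
    moreover from this have "pos (r', c) \<noteq> i" "pos (r', c) \<noteq> j" using e(4,5) by auto
    ultimately show "colrel (w ! pos (r', c)) (w ! pos (r, c))"
      using agree[of "pos (r', c)"] rc(2) e(2) by simp
  qed
  have ok2: "box_ok w (r2, c2)"
  proof (rule box_okI)
    fix c' assume D: "(r2, c') \<in> set B" "c2 < c'"
    have "v ! pos (r2, c') = L2" using row[OF rc2(1) D] rc2(2) e(5) v_at[OF D(1)] by auto
    moreover have "j < pos (r2, c')" using pos_less[OF rc2(1) D(1)] D(2) rc2(2) by simp
    ultimately show "rowrel (w ! pos (r2, c2)) (w ! pos (r2, c'))"
      using agree[of "pos (r2, c')"] e(1,3) rc2(2) by simp
  next
    fix c' assume D: "(r2, c') \<in> set B" "c' < c2"
    obtain d where d: "c2 = Suc d" "(r2, d) \<in> set B" "pos (r2, c2) = Suc (pos (r2, d))"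
      using prev_in_row[OF rc2(1) D] .
    have dj: "Suc (pos (r2, d)) = j" using d(3) rc2(2) by simp
    have vd: "v ! pos (r2, d) = P1 \<and> w ! pos (r2, d) = P1 \<or> v ! pos (r2, d) = P2 \<and> w ! pos (r2, d) = L1"
      using mid[of "pos (r2, d)"] midv[of "pos (r2, d)"] dj e(1,2,4) by (cases "pos (r2, d) = i") auto
    have "w ! pos (r2, c') = P1 \<or> w ! pos (r2, c') = L1"
    proof (cases "c' = d")
      case False
      then have lt: "c' < d" using D(2) d(1) by simp
      have "v ! pos (r2, c') = P1 \<or> v ! pos (r2, c') = L1"
        using row[OF D(1) d(2) lt] vd v_at[OF D(1)] by auto
      moreover from this have "pos (r2, c') \<noteq> i" "pos (r2, c') \<noteq> j" using e(4,5) by auto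
      ultimately show ?thesis using agree[of "pos (r2, c')"] by simp
    qed (use vd in auto)
    then show "rowrel (w ! pos (r2, c')) (w ! pos (r2, c2))" using rc2(2) e(3) by auto
  next
    fix r' assume D: "(r', c2) \<in> set B" "r2 < r'"
    show "colrel (w ! pos (r2, c2)) (w ! pos (r', c2))"
      using col[OF rc2(1) D] rc2(2) e(5) v_at[OF D(1)] by auto
  next
    fix r' assume D: "(r', c2) \<in> set B" "r' < r2"
    have "v ! pos (r', c2) = P1 \<or> v ! pos (r', c2) = L1 \<or> v ! pos (r', c2) = P2"
      using col[OF D(1) rc2(1) D(2)] e(5) rc2(2) v_at[OF D(1)] by auto
    moreover have "j < pos (r', c2)" using pos_less[OF rc2(1) D(1)] D(2) rc2(2) by simp
    ultimately show "colrel (w ! pos (r', c2)) (w ! pos (r2, c2))"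
      using agree[of "pos (r', c2)"] e(1,3) rc2(2) by auto
  qed
  fix b assume "b \<in> set B" "pos b = i \<or> pos b = j"
  then show "box_ok w b"
    using ok1 ok2 pos_eq_iff[of b "(r, c)"] pos_eq_iff[of b "(r2, c2)"] rc rc2 by auto
qed (use agree in auto)

text \<open>If the box above \<open>i\<close> violates the column condition, the 1 at
  \<open>j\<close> lies to its left in the same row. Comparing the two rows column by column leaves
  only the diagonal for it, with \<open>i\<close> in the next diagonal box, and then
  \<open>i\<close> is the first position. So the height after \<open>j\<close> is at most the number
  of boxes to the right of \<open>i\<close>, too small for
  \<open>walk_two_below_converse\<close>.\<close>

lemma backward_F2:
  assumes tab: "tab v" and e: "i < j" "w ! i = L1" "w ! j = P1" "v ! i = P2" "v ! j = L1"
    and mid: "\<And>m. i < m \<Longrightarrow> m < j \<Longrightarrow> w ! m = L2"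
  shows "tab w"
proof (rule tab_update[OF tab, of i j])
  note row = tab_row[OF tab] and col = tab_col[OF tab]
  have iB: "i < length B" using ij by simp
  obtain r c where rc: "(r, c) \<in> set B" "pos (r, c) = i" using iB by (rule box_at)
  obtain r2 c2 where rc2: "(r2, c2) \<in> set B" "pos (r2, c2) = j" using ij(2) by (rule box_at)
  have midv: "v ! m = L2" if "i < m" "m < j" for m using mid[OF that] agree[of m] that by simp
  have right: "v ! pos (r, c') = L2" if "(r, c') \<in> set B" "c < c'" for c'
    using row[OF rc(1) that] rc(2) e(4) v_at[OF that(1)] by auto
  have ok1: "box_ok w (r, c)"
  proof (rule box_okI)
    fix c' assume D: "(r, c') \<in> set B" "c < c'"
    have "v ! pos (r, c') = L2" using right[OF D] .
    moreover from this have "pos (r, c') \<noteq> i" "pos (r, c') \<noteq> j" using e(4,5) by auto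
    ultimately show "rowrel (w ! pos (r, c)) (w ! pos (r, c'))"
      using agree[of "pos (r, c')"] e(2,3) rc(2) by simp
  next
    fix c' assume D: "(r, c') \<in> set B" "c' < c"
    have "v ! pos (r, c') = P1 \<or> v ! pos (r, c') = L1"
      using row[OF D(1) rc(1) D(2)] rc(2) e(4) v_at[OF D(1)] by auto
    moreover have "pos (r, c') < i" using pos_less[OF D(1) rc(1)] D(2) rc(2) by simp
    ultimately show "rowrel (w ! pos (r, c')) (w ! pos (r, c))"
      using agree[of "pos (r, c')"] e(1,2) rc(2) by auto
  next
    fix r' assume D: "(r', c) \<in> set B" "r < r'"
    have "v ! pos (r', c) = P2 \<or> v ! pos (r', c) = L2"
      using col[OF rc(1) D] rc(2) e(4) v_at[OF D(1)] by auto
    moreover have "pos (r', c) < i" using pos_less[OF D(1) rc(1)] D(2) rc(2) by simp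
    ultimately show "colrel (w ! pos (r, c)) (w ! pos (r', c))"
      using agree[of "pos (r', c)"] e(1,2) rc(2) by auto
  next
    fix r' assume D: "(r', c) \<in> set B" "r' < r"
    obtain r0 where r0: "r = Suc r0" using D(2) by (cases r) auto
    have rcS: "(Suc r0, c) \<in> set B" using rc(1) r0 by simp
    have aD: "(r0, c) \<in> set B" using above_in[OF rcS D(1)] D(2) r0 by simp
    let ?f = "pos (r0, c)"
    have y: "v ! ?f = P1 \<or> ?f = j"
    proof (rule ccontr)
      assume neg: "\<not> ?thesis"
      then have y: "v ! ?f = L1 \<or> v ! ?f = P2"
        using col[OF aD rcS] v_at[OF aD] rc(2) r0 e(4) by auto
      have "i < ?f" using pos_less[OF rcS aD] rc(2) r0 by simp
      then have jf: "j < ?f" using midv[of ?f] y neg by (cases "?f < j") auto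
      have "pos (Suc r0, c) < j" using rc(2) r0 e(1) by simp
      then obtain x1 where x1: "(r0, x1) \<in> set B" "pos (r0, x1) = j" "x1 < c"
        using jf
      proof (rule between[OF rcS aD])
        fix x assume "(Suc r0, x) \<in> set B" "pos (Suc r0, x) = j" "c < x"
        then have False using right[of x] r0 e(5) by simp
        then show ?thesis ..
      qed auto
      have nodiag: False if a: "(r, x) \<in> set B" "x < c" "(r0, x) \<in> set B" "x1 \<le> x" for x
      proof -
        have z: "v ! pos (r, x) = P1 \<or> v ! pos (r, x) = L1"
          using row[OF a(1) rc(1) a(2)] rc(2) e(4) v_at[OF a(1)] by auto
        have "v ! pos (r0, x) \<noteq> P1"
          using row[OF x1(1) a(3)] x1(2) e(5) a(4) by (cases "x1 = x") auto
        then show False using z col[OF a(3,1)] r0 v_at[OF a(3)] by auto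
      qed
      have "x1 < r"
      proof (rule ccontr)
        assume "\<not> x1 < r"
        then have "(r, x1) \<in> set B" using convex[OF x1(1) rc(1), of r x1] x1(3) r0 by simp
        then show False using nodiag[of x1] x1 by simp
      qed
      then have xr: "x1 = r0" using diagonal[OF x1(1)] r0 by simp
      have cr: "c = r"
      proof (rule ccontr)
        assume "c \<noteq> r"
        then have lt: "r < c" using diagonal[OF rc(1)] by simp
        have "(r, r) \<in> set B" using convex[OF x1(1) rc(1), of r r] xr r0 lt by simp
        moreover have "(r0, r) \<in> set B" using convex[OF x1(1) aD, of r0 r] xr r0 lt by simp
        ultimately show False using nodiag[of r] lt xr r0 by simp
      qed
      have i0: "i = 0"
      proof (rule ccontr)
        assume "i \<noteq> 0"
        then have "0 < length B" "0 < i" using ij by auto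
        then obtain a x where ax: "(a, x) \<in> set B" "pos (a, x) = 0" by (metis box_at)
        have "r < a \<or> a = r \<and> x < c"
          using pos_less[OF ax(1) rc(1)] ax(2) \<open>0 < i\<close> rc(2) by simp
        then have ra: "r < a" using diagonal[OF ax(1)] cr by auto
        then have xr: "c < x" using diagonal[OF ax(1)] cr by simp
        have rx: "(r, x) \<in> set B" using convex[OF rc(1) ax(1), of r x] ra xr cr by simp
        show False using right[OF rx xr] col[OF rx ax(1) ra] v_at[OF ax(1)] by auto
      qed
      obtain c1 where c1: "(Suc r0, c1) \<in> set B" "\<And>x. (Suc r0, x) \<in> set B \<Longrightarrow> x \<le> c1"
        using row_end[OF rcS] by metis
      have "{m. m < Suc j \<and> (w ! m = P2 \<or> w ! m = L2)} \<subseteq> (\<lambda>x. pos (Suc r0, x)) ` {c<..c1}"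
      proof
        fix m assume "m \<in> {m. m < Suc j \<and> (w ! m = P2 \<or> w ! m = L2)}"
        then have m: "m < Suc j" "w ! m = P2 \<or> w ! m = L2" by auto
        then have "m \<noteq> i" "m \<noteq> j" using e(2,3) by auto
        then have "i < m" "m < j" using m(1) i0 by auto
        then have "pos (Suc r0, c) < m" "m < pos (r0, x1)" using rc(2) r0 x1(2) by auto
        then show "m \<in> (\<lambda>x. pos (Suc r0, x)) ` {c<..c1}"
        proof (rule between[OF rcS x1(1)])
          fix x assume "(Suc r0, x) \<in> set B" "pos (Suc r0, x) = m" "c < x"
          then show ?thesis using c1(2) by force
        next
          fix x assume "(r0, x) \<in> set B" "x < x1"
          then show ?thesis using diagonal[of r0 x] xr by simp
        qed auto
      qed
      then have "card {m. m < Suc j \<and> (w ! m = P2 \<or> w ! m = L2)} \<le> card ((\<lambda>x. pos (Suc r0, x)) ` {c<..c1})"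
        by (intro card_mono) auto
      also have "\<dots> \<le> card {c<..c1}" by (rule card_image_le) simp
      finally have "snd (walk_at w (Suc j)) \<le> c1 - c"
        using walk_y_le[OF lw, of "Suc j"] ij lenw by simp
      moreover have "card {x. c < x \<and> x \<le> c1 \<and> j < pos (Suc r0, x)} = 0"
      proof -
        have "\<not> j < pos (Suc r0, x)" if "c < x" "x \<le> c1" for x
        proof -
          have "(Suc r0, x) \<in> set B"
            using convex[OF rcS c1(1), of "Suc r0" x] that diagonal[OF rcS] by simp
          then show ?thesis using pos_less[OF x1(1), of "Suc r0" x] x1(2) by simp
        qed
        then have "{x. c < x \<and> x \<le> c1 \<and> j < pos (Suc r0, x)} = {}" by blast
        then show ?thesis by (simp only: card.empty)
      qed
      moreover have "1 + (c1 - c) \<le> snd (walk_at w (Suc j)) + card {x. c < x \<and> x \<le> c1 \<and> j < pos (Suc r0, x)}"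
        using r0 rc(2) e(1,4) y aD rcS c1 agree ext jf
        by (intro walk_two_below_converse[OF tab lv lenv lw lenw]) auto
      ultimately show False by simp
    qed
    have "v ! pos (r', c) = P1 \<or> pos (r', c) = j"
    proof (cases "r' = r0")
      case False
      have "v ! ?f = P1 \<or> v ! ?f = L1" using y e(5) by auto
      then show ?thesis using col[OF D(1) aD] D(2) r0 False v_at[OF D(1)] by auto
    qed (use y in simp)
    then show "colrel (w ! pos (r', c)) (w ! pos (r, c))"
    proof
      assume a: "v ! pos (r', c) = P1"
      then have "pos (r', c) \<noteq> i" "pos (r', c) \<noteq> j" using e(4,5) by auto
      then have "w ! pos (r', c) = P1" using agree[of "pos (r', c)"] a by metis
      then show ?thesis using rc(2) e(2) by simp
    qed (use rc(2) e(2,3) in simp)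
  qed
  have ok2: "box_ok w (r2, c2)"
  proof (rule box_okI)
    fix c' assume D: "(r2, c') \<in> set B" "c2 < c'"
    have "v ! pos (r2, c') \<noteq> P1" using row[OF rc2(1) D] rc2(2) e(5) by auto
    moreover have "j < pos (r2, c')" using pos_less[OF rc2(1) D(1)] D(2) rc2(2) by simp
    ultimately show "rowrel (w ! pos (r2, c2)) (w ! pos (r2, c'))"
      using agree[of "pos (r2, c')"] v_at[OF D(1)] e(1,3) rc2(2) by auto
  next
    fix c' assume D: "(r2, c') \<in> set B" "c' < c2"
    obtain d where d: "c2 = Suc d" "(r2, d) \<in> set B" "pos (r2, c2) = Suc (pos (r2, d))"
      using prev_in_row[OF rc2(1) D] .
    have "v ! pos (r2, d) = P2 \<or> v ! pos (r2, d) = L2"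
      using midv[of "pos (r2, d)"] d(3) rc2(2) e(1,4) by (cases "pos (r2, d) = i") auto
    then show "rowrel (w ! pos (r2, c')) (w ! pos (r2, c2))"
      using row[OF d(2) rc2(1)] d(1) rc2(2) e(5) by auto
  next
    fix r' assume D: "(r', c2) \<in> set B" "r2 < r'"
    show "colrel (w ! pos (r2, c2)) (w ! pos (r', c2))"
      using w_at[OF D(1)] rc2(2) e(3) by auto
  next
    fix r' assume D: "(r', c2) \<in> set B" "r' < r2"
    have "v ! pos (r', c2) = P1"
      using col[OF D(1) rc2(1) D(2)] e(5) rc2(2) v_at[OF D(1)] by auto
    moreover have "j < pos (r', c2)" using pos_less[OF rc2(1) D(1)] D(2) rc2(2) by simp
    ultimately show "colrel (w ! pos (r', c2)) (w ! pos (r2, c2))"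
      using agree[of "pos (r', c2)"] e(1,3) rc2(2) by auto
  qed
  fix b assume "b \<in> set B" "pos b = i \<or> pos b = j"
  then show "box_ok w b"
    using ok1 ok2 pos_eq_iff[of b "(r, c)"] pos_eq_iff[of b "(r2, c2)"] rc rc2 by auto
qed (use agree in auto)

end

section \<open>From chains to the relations \<open>Rel\<close> and \<open>FP\<close> on
  fillings\<close>

lemma chain_at:
  assumes "chain p u t s" "length p + length u \<le> m" "m < length (p @ u @ s)"
  shows "ext_ok (take m (p @ u @ s)) (take m (p @ t @ s)) ((p @ u @ s) ! m)"
proof -
  define k where "k = m - length p - length u"
  have k: "k < length s" "m = length p + length u + k" using assms(2,3) by (auto simp: k_def)
  have lt: "length t = length u" using F_crit_length chain_crit[OF assms(1)] by blast
  have "chain p u t (take k s @ s ! k # drop (Suc k) s)"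
    using assms(1) id_take_nth_drop[OF k(1)] by simp
  from chain_ext_ok[OF this] show ?thesis using k lt by (simp add: nth_append)
qed

context reading
begin

lemma chain_tab:
  assumes ch: "chain p u t s" and len: "length (p @ u @ s) = length B"
  shows "tab (p @ u @ s) \<longleftrightarrow> tab (p @ t @ s)"
proof -
  let ?w = "p @ u @ s" and ?v = "p @ t @ s" and ?i = "length p"
  let ?j = "length p + length u - 1"
  have cr: "F_crit (walk_end p) u (Some t)" using chain_crit[OF ch] by simp
  have lt: "length t = length u" "u \<noteq> []" using F_crit_length[OF cr] by auto
  have at: "ext_ok (take m ?w) (take m ?v) (?w ! m)" if "?j < m" "m < length ?w" for m
    using chain_at[OF ch, of m] that by simp
  have agree: "?v ! m = ?w ! m" if "m \<noteq> ?i" "m \<noteq> ?j" for m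
  proof -
    have mid: "t ! k = u ! k" if "0 < k" "k < length u - 1" for k
      using cr
    proof (cases rule: F_crit_cases)
      case (F1 n)
      then show ?thesis using that by (auto simp: nth_append nth_Cons')
    next
      case (F2 n)
      then show ?thesis using that by (auto simp: nth_append nth_Cons')
    qed (use that in auto)
    consider "m < ?i" | "?i < m" "m < ?j" | "?j < m" using \<open>m \<noteq> ?i\<close> \<open>m \<noteq> ?j\<close> by linarith
    then show ?thesis
    proof cases
      case 1
      then show ?thesis by (simp add: nth_append)
    next
      case 2
      then have "0 < m - ?i" "m - ?i < length u - 1" "m - ?i < length u" by linarith+
      then show ?thesis using mid[of "m - ?i"] lt 2 by (simp add: nth_append)
    next
      case 3
      then have "\<not> m - ?i < length u" "\<not> m < ?i" by linarith+
      then show ?thesis using lt by (simp add: nth_append)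
    qed
  qed
  interpret reading_update B ?w ?v ?i ?j
  proof
    show "set ?w \<subseteq> letters12" "set ?v \<subseteq> letters12" using chain_letters12[OF ch] by auto
    show "length ?w = length B" "length ?v = length B" using len lt by auto
    show "?i \<le> ?j" "?j < length B" using lt len by (cases u; simp)+
    show "?v ! m = ?w ! m" if "m \<noteq> ?i" "m \<noteq> ?j" for m using agree that .
    show "2 \<le> fst (walk_at ?w m) \<and> 1 \<le> snd (walk_at ?w m)"
      if "?j < m" "m < length ?w" "?w ! m = L1 \<or> ?w ! m = P2" for m
      using at[OF that(1,2)] that(3) unfolding ext_ok_def by auto
  qed
  have ext1: "fst (walk_at ?w m) \<ge> 2 \<or> 1 \<in> val ` set (take m ?v)"
    if "?j < m" "m < length ?w" "?w ! m = P1" for m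
    using at[OF that(1,2)] that(3) unfolding ext_ok_def by auto
  have wi: "walk_at ?w ?i = walk_end p" by simp
  have first: "?w ! ?i = hd u" "?v ! ?i = hd t" using lt by (cases u; cases t; simp)+
  have last: "?w ! ?j = last u" "?v ! ?j = last t"
    using lt by (cases u rule: rev_cases; cases t rule: rev_cases; simp add: nth_append)+
  have inner: "?w ! m = u ! (m - ?i)" if "?i < m" "m < ?j" for m
  proof -
    have "m - ?i < length u" "\<not> m < ?i" using that by linarith+
    then show ?thesis by (simp add: nth_append)
  qed
  from cr show ?thesis
  proof (cases rule: F_crit_cases)
    case (F1 n)
    have ij: "?i < ?j" by (simp add: F1)
    have mid: "?w ! m = P1" if "?i < m" "m < ?j" for m
      using inner[OF that] that by (auto simp: F1(2) nth_append nth_Cons')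
    have e: "?w ! ?i = L1" "?w ! ?j = P2" "?v ! ?i = P2" "?v ! ?j = L2"
      unfolding first last by (simp_all add: F1)
    show ?thesis
      using forward_F1[OF _ ij e mid] backward_F1[OF _ ij e mid] F1(1) unfolding wi by blast
  next
    case (F2 n)
    have ij: "?i < ?j" by (simp add: F2)
    have mid: "?w ! m = L2" if "?i < m" "m < ?j" for m
      using inner[OF that] that by (auto simp: F2(2) nth_append nth_Cons')
    have e: "?w ! ?i = L1" "?w ! ?j = P1" "?v ! ?i = P2" "?v ! ?j = L1"
      unfolding first last by (simp_all add: F2)
    show ?thesis
      using forward_F2[OF _ ij e mid] backward_F2[OF _ ij e mid] by blast
  next
    case F3
    have ij: "?i = ?j" by (simp add: F3)
    have e: "?w ! ?i = L1" "?v ! ?i = L2" unfolding first by (simp_all add: F3)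
    show ?thesis
      using forward_F3[OF _ ij e] backward_F3[OF _ ij e] F3(1) unfolding wi by blast
  next
    case F4
    have ij: "?i = ?j" by (simp add: F4)
    have e: "?w ! ?i = P1" "?v ! ?i = P2" unfolding first by (simp_all add: F4)
    show ?thesis
      using forward_F4[OF _ ij e] backward_F4[OF _ ij e _ ext1] F4(1) unfolding wi by blast
  qed
qed

text \<open>In a row the left box is read first, in a column the upper box is read last. So the
  equalities allowed in rows (unprimed) and in columns (primed) are those that the standardization
  breaks in the required direction.\<close>

lemma tab_std_before:
  assumes "length w = length B"
  shows "tab w \<longleftrightarrow>
     (\<forall>r c c'. (r, c) \<in> set B \<and> (r, c') \<in> set B \<and> c < c' \<longrightarrow> std_before w (pos (r, c)) (pos (r, c'))) \<and>
     (\<forall>r r' c. (r, c) \<in> set B \<and> (r', c) \<in> set B \<and> r < r' \<longrightarrow> std_before w (pos (r, c)) (pos (r', c)))"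
proof -
  have 1: "rowrel (w ! j) (w ! k) = std_before w j k" if "j < k" for j k
    using that by (auto simp: rowrel_def std_before_def)
  have 2: "colrel (w ! j) (w ! k) = std_before w j k" if "k < j" for j k
    using that by (auto simp: colrel_def std_before_def)
  have "rowrel (w ! pos (r, c)) (w ! pos (r, c')) = std_before w (pos (r, c)) (pos (r, c'))"
    if "(r, c) \<in> set B" "(r, c') \<in> set B" "c < c'" for r c c'
    using that pos_less[of r c r c'] by (intro 1) simp
  moreover have "colrel (w ! pos (r, c)) (w ! pos (r', c)) = std_before w (pos (r, c)) (pos (r', c))"
    if "(r, c) \<in> set B" "(r', c) \<in> set B" "r < r'" for r r' c
    using that pos_less[of r' c r c] by (intro 2) simp
  ultimately show ?thesis unfolding tab_def by blast
qed

lemma tab_std: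
  assumes "std v = std w" "length w = length B"
  shows "tab v \<longleftrightarrow> tab w"
proof -
  have l: "length v = length B" and
    e: "\<And>j k. j < length B \<Longrightarrow> k < length B \<Longrightarrow> std_before v j k = std_before w j k"
    using assms by (auto simp: std_eq_iff)
  have "std_before v (pos b) (pos b') = std_before w (pos b) (pos b')"
    if "b \<in> set B" "b' \<in> set B" for b b'
    using e pos_in that by blast
  then show ?thesis unfolding tab_std_before[OF l] tab_std_before[OF assms(2)] by blast
qed

lemma tab_canon_cong: "canon v = canon w \<Longrightarrow> length w = length B \<Longrightarrow> tab v \<longleftrightarrow> tab w"
  by (rule tab_std) (metis std_canon)+

lemma Rel_tab:
  assumes "Rel w v" "length w = length B"
  shows "tab w \<longleftrightarrow> tab v"
proof -
  obtain p u t s where ch: "chain p u t s" and c: "canon (p @ u @ s) = canon w"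
    "canon (p @ t @ s) = canon v" using assms(1) by (rule RelE)
  have "length (p @ u @ s) = length B" using canon_length_eq[OF c(1)] assms(2) by simp
  moreover have "length v = length B" using Rel_length[OF assms(1)] assms(2) by simp
  ultimately show ?thesis
    using chain_tab[OF ch] tab_canon_cong[OF c(1) assms(2)] tab_canon_cong[OF c(2)] by simp
qed

lemma FP_tab:
  assumes "FP w v" "length w = length B"
  shows "tab w \<longleftrightarrow> tab v"
proof -
  obtain q r where q: "set q \<subseteq> letters12" and r: "set r \<subseteq> {P1, L2}"
    and c: "canon w = canon (q @ L1 # r)" "canon v = canon (q @ P2 # r)"
    using assms(1) by (auto simp: FP_def)
  have "std v = std w"
    using std_FP[OF q r] c std_canon by metis
  from tab_std[OF this assms(2)] show ?thesis ..
qed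

end

section \<open>Weights, and commutation of the operators on words\<close>

lemma Rel_weight:
  assumes "Rel w v"
  shows "weight v = (\<lambda>j. weight w j - alpha 1 j)"
proof -
  obtain p u t s where ch: "chain p u t s" and c: "canon (p @ u @ s) = canon w"
    "canon (p @ t @ s) = canon v" using assms by (rule RelE)
  have cr: "F_crit (walk_end p) u (Some t)" using chain_crit[OF ch] by simp
  have "weight (p @ t @ s) = (\<lambda>j. weight (p @ u @ s) j - alpha 1 j)"
    using cr
  proof (cases rule: F_crit_cases)
    case (F1 m)
    then show ?thesis by (auto simp: weight_def alpha_def)
  next
    case (F2 m)
    then show ?thesis by (auto simp: weight_def alpha_def)
  qed (auto simp: weight_def alpha_def)
  moreover have "weight v = weight (p @ t @ s)" "weight w = weight (p @ u @ s)"
    using weight_canon c by metis+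
  ultimately show ?thesis by simp
qed

lemma FP_weight:
  assumes "FP w v"
  shows "weight v = (\<lambda>j. weight w j - alpha 1 j)"
proof -
  have "FP w (canon v)" using assms FP_cong[of w w v "canon v"] by simp
  then have "F'_cand w (canon v)" by (rule FP_F'_cand) simp
  then show ?thesis by (simp add: F'_cand_def weight_canon)
qed

text \<open>Every step, on or off the axes, changes x - y by 1 for value 1 and by -1 for value 2.
  This becomes (K2).\<close>

lemma walk_weight:
  "set w \<subseteq> letters12 \<Longrightarrow> int (fst (walk_end w)) - int (snd (walk_end w)) = weight w 1 - weight w 2"
proof (induction w rule: rev_induct)
  case (snoc a w)
  obtain x y where xy: "walk_end w = (x, y)" by (cases "walk_end w")
  then show ?case using snoc by (auto simp: weight_def walk_end_append letters12_def)
qed (simp add: weight_def)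

text \<open>For a mixed pair take the corner from which F and F' lead into the square:
  \<open>w\<close> itself, or its image under E or E'. \<open>compatible\<close> at this corner
  completes the square, its second alternative being excluded because one of the remaining arrows
  exists. For E and E' the square is reflected by eta first.\<close>

lemma ops_commute:
  assumes A: "A \<in> {opF, opE, opF', opE'}" and B: "B \<in> {opF, opE, opF', opE'}"
    and w: "is_word w" "set w \<subseteq> letters12"
    and X: "Option.bind (B w) A = Some x" and Y: "Option.bind (A w) B = Some y"
  shows "x = y"
proof -
  have F: "opF u = Some v \<longleftrightarrow> Rel u v \<and> is_word v"
    and E: "opE u = Some v \<longleftrightarrow> Rel v u \<and> is_word v"
    and F': "opF' u = Some v \<longleftrightarrow> FP u v \<and> is_word v"
    and E': "opE' u = Some v \<longleftrightarrow> FP v u \<and> is_word v" if "is_word u" "set u \<subseteq> letters12" for u v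
    using opF_iff opE_iff opF'_iff opE'_iff that by auto
  have good: "is_word v \<and> set v \<subseteq> letters12" if "C w = Some v" "C \<in> {opF, opE, opF', opE'}" for C v
    using that F[OF w] E[OF w] F'[OF w] E'[OF w] Rel_letters12 FP_letters12 by blast
  obtain z where z: "B w = Some z" "A z = Some x" using X by (auto simp: bind_eq_Some_conv)
  obtain v where v: "A w = Some v" "B v = Some y" using Y by (auto simp: bind_eq_Some_conv)
  note gz = good[OF z(1) B, THEN conjunct1] good[OF z(1) B, THEN conjunct2]
  note gv = good[OF v(1) A, THEN conjunct1] good[OF v(1) A, THEN conjunct2]
  note op = F[OF w] E[OF w] F'[OF w] E'[OF w] F[OF gz] E[OF gz] F'[OF gz] E'[OF gz]
    F[OF gv] E[OF gv] F'[OF gv] E'[OF gv]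
  have eqI: "canon a = canon b \<Longrightarrow> is_word a \<Longrightarrow> is_word b \<Longrightarrow> a = b" for a b
    by (simp add: is_word_def)
  have FF': "a = b" if "Rel u p" "FP u q" "Rel q a" "FP p b" "is_word a" "is_word b" for u p q a b
  proof -
    note h = that
    obtain c where "Rel q c" "FP p c"
      using Rel_FP_compatible[OF h(1,2)] h(3) unfolding compatible_def by blast
    then have "canon a = canon b" using Rel_functional h(3) FP_functional h(4) by metis
    then show ?thesis using h(5,6) eqI by blast
  qed
  have FE': "a = b" if "FP u w" "Rel u a" "Rel w p" "FP b p" "is_word a" "is_word b" for u p a b
  proof -
    note h = that
    obtain c where c: "Rel w c" "FP a c"
      using Rel_FP_compatible[OF h(2,1)] h(3) unfolding compatible_def by blast
    have "canon c = canon p" using Rel_functional c(1) h(3) by blast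
    then have "FP a p" using c(2) FP_cong by blast
    then show ?thesis using FP_injective h(4-6) eqI by blast
  qed
  have EF': "a = b" if "Rel u w" "FP u a" "FP w p" "Rel b p" "is_word a" "is_word b" for u p a b
  proof -
    note h = that
    obtain c where c: "Rel a c" "FP w c"
      using Rel_FP_compatible[OF h(1,2)] h(3) unfolding compatible_def by blast
    have "canon c = canon p" using FP_functional c(2) h(3) by blast
    then have "Rel a p" using c(1) Rel_cong by blast
    then show ?thesis using Rel_injective h(4-6) eqI by blast
  qed
  have EE': "a = b" if "Rel p w" "FP q w" "Rel a q" "FP b p" "is_word a" "is_word b" for p q a b
  proof -
    note h = that
    have e: "Rel (etas w) (etas p)" "FP (etas w) (etas q)" "Rel (etas q) (etas a)" "FP (etas p) (etas b)"
      using Rel_etas FP_etas h by auto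
    obtain c where c: "Rel (etas q) c" "FP (etas p) c"
      using Rel_FP_compatible[OF e(1,2)] e(3) unfolding compatible_def by blast
    have "canon (etas a) = canon (etas b)"
      using Rel_functional[OF c(1) e(3)] FP_functional[OF c(2) e(4)] by simp
    moreover have "set a \<subseteq> letters12" "set b \<subseteq> letters12"
      using h Rel_letters12 FP_letters12 by auto
    ultimately show ?thesis
      using canon_etas_cong[of "etas a" "etas b"] etas_invol[of a] etas_invol[of b] h(5,6) eqI
      by (metis etas_letters12)
  qed
  have Rinv: "a = w" if "Rel u a" "Rel u w" "is_word a" for u a
    using Rel_functional[OF that(1,2)] that(3) w(1) eqI by blast
  have Rinv': "a = w" if "Rel a u" "Rel w u" "is_word a" for u a
    using Rel_injective[OF that(1,2)] that(3) w(1) eqI by blast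
  have Finv: "a = w" if "FP u a" "FP u w" "is_word a" for u a
    using FP_functional[OF that(1,2)] that(3) w(1) eqI by blast
  have Finv': "a = w" if "FP a u" "FP w u" "is_word a" for u a
    using FP_injective[OF that(1,2)] that(3) w(1) eqI by blast
  consider "A = B" | "A = opF" "B = opE" | "A = opE" "B = opF" | "A = opF'" "B = opE'" | "A = opE'" "B = opF'"
    | "A = opF" "B = opF'" | "A = opF'" "B = opF" | "A = opF" "B = opE'" | "A = opE'" "B = opF"
    | "A = opE" "B = opF'" | "A = opF'" "B = opE" | "A = opE" "B = opE'" | "A = opE'" "B = opE"
    using A B by blast
  then show ?thesis
  proof cases
    case 1
    then show ?thesis using z v by simp
  next
    case 2
    then show ?thesis using z v Rinv[of z x] Rinv'[of y v] by (simp add: op)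
  next
    case 3
    then show ?thesis using z v Rinv[of v y] Rinv'[of x z] by (simp add: op)
  next
    case 4
    then show ?thesis using z v Finv[of z x] Finv'[of y v] by (simp add: op)
  next
    case 5
    then show ?thesis using z v Finv[of v y] Finv'[of x z] by (simp add: op)
  next
    case 6
    then show ?thesis using z v FF'[of w v z x y] by (simp add: op)
  next
    case 7
    then show ?thesis using z v FF'[of w z v y x] by (simp add: op)
  next
    case 8
    then show ?thesis using z v FE'[of z x v y] by (simp add: op)
  next
    case 9
    then show ?thesis using z v FE'[of v y z x] by (simp add: op)
  next
    case 10
    then show ?thesis using z v EF'[of v y z x] by (simp add: op)
  next
    case 11
    then show ?thesis using z v EF'[of z x v y] by (simp add: op)
  next
    case 12
    then show ?thesis using z v EE'[of v z x y] by (simp add: op)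
  next
    case 13
    then show ?thesis using z v EE'[of z v y x] by (simp add: op)
  qed
qed

section \<open>Tableaux\<close>

lemma sorted_wrt_concat_map:
  assumes "\<And>x. x \<in> set xs \<Longrightarrow> sorted_wrt R (f x)"
    and "sorted_wrt (\<lambda>x y. \<forall>a\<in>set (f x). \<forall>b\<in>set (f y). R a b) xs"
  shows "sorted_wrt R (concat (map f xs))"
  using assms by (induction xs) (auto simp: sorted_wrt_append)

lemma strict_partition_nth:
  assumes "strict_partition l" "b < length l" "a \<le> b"
  shows "l ! b + (b - a) \<le> l ! a"
  using assms(3,2)
proof (induction b rule: dec_induct)
  case (step b)
  have "l ! Suc b < l ! b"
    using assms(1) step.prems sorted_wrt_nth_less[of "(>)" l b "Suc b"]
    by (simp add: strict_partition_def)
  then show ?case using step by simp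
qed simp

section \<open>Shifted diagrams and their reading order\<close>

lemma shifted_diagram_iff:
  assumes "strict_partition l"
  shows "(r, c) \<in> shifted_diagram l \<longleftrightarrow> 1 \<le> r \<and> r \<le> length l \<and> r \<le> c \<and> c < r + l ! (r - 1)"
proof (cases "1 \<le> r \<and> r \<le> length l")
  case True
  then have "l ! (r - 1) > 0" using assms by (auto simp: strict_partition_def)
  then show ?thesis by (auto simp: shifted_diagram_def)
qed (auto simp: shifted_diagram_def)

text \<open>The strict decrease of the parts compensates the shift of the rows, so the right ends of
  the rows weakly decrease downwards.\<close>

lemma shifted_diagram_ideal:
  assumes l: "strict_partition l" and D: "(r2, c2) \<in> shifted_diagram l"
    and "1 \<le> r" "r \<le> r2" "r \<le> c" "c \<le> c2"
  shows "(r, c) \<in> shifted_diagram l"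
proof -
  have r2: "r2 \<le> length l" "c2 < r2 + l ! (r2 - 1)" using D shifted_diagram_iff[OF l] by auto
  have "l ! (r2 - 1) + ((r2 - 1) - (r - 1)) \<le> l ! (r - 1)"
    using assms(3,4) r2(1) by (intro strict_partition_nth[OF l]) auto
  then have "c < r + l ! (r - 1)" using r2(2) assms(3,4,6) by linarith
  then show ?thesis using shifted_diagram_iff[OF l] assms r2(1) by simp
qed

lemma set_reading_boxes:
  assumes "shifted_skew_shape lam mu"
  shows "set (reading_boxes lam mu) = skew_diagram lam mu"
proof -
  have l: "strict_partition lam" using assms by (simp add: shifted_skew_shape_def)
  have "(r, c) \<in> set (reading_boxes lam mu) \<longleftrightarrow> (r, c) \<in> skew_diagram lam mu \<and>
      1 \<le> r \<and> r \<le> length lam \<and> r \<le> c \<and> c < r + lam ! (r - 1)" for r c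
    by (auto simp: reading_boxes_def intro!: bexI[of _ r])
  then show ?thesis by (auto simp: skew_diagram_def shifted_diagram_iff[OF l])
qed

lemma skew_diagram_convex:
  assumes s: "shifted_skew_shape lam mu"
    and D: "(r1, c1) \<in> skew_diagram lam mu" "(r2, c2) \<in> skew_diagram lam mu"
    and le: "r1 \<le> r" "r \<le> r2" "c1 \<le> c" "c \<le> c2" "r \<le> c"
  shows "(r, c) \<in> skew_diagram lam mu"
proof -
  have l: "strict_partition lam" and m: "strict_partition mu"
    using s by (auto simp: shifted_skew_shape_def)
  have r1: "1 \<le> r1" "r1 \<le> c1" using D(1) by (auto simp: skew_diagram_def shifted_diagram_def)
  have "(r, c) \<in> shifted_diagram lam"
    using shifted_diagram_ideal[OF l, of r2 c2 r c] D(2) le r1 by (auto simp: skew_diagram_def)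
  moreover have "(r, c) \<notin> shifted_diagram mu"
    using shifted_diagram_ideal[OF m, of r c r1 c1] D(1) le r1 by (auto simp: skew_diagram_def)
  ultimately show ?thesis by (simp add: skew_diagram_def)
qed

lemma skew_diagram_diagonal: "(r, c) \<in> skew_diagram lam mu \<Longrightarrow> r \<le> c"
  by (auto simp: skew_diagram_def shifted_diagram_def)

lemma sorted_reading_boxes:
  "sorted_wrt (\<lambda>b b'. fst b' < fst b \<or> fst b = fst b' \<and> snd b < snd b') (reading_boxes lam mu)"
  unfolding reading_boxes_def
proof (rule sorted_wrt_concat_map)
  fix r
  show "sorted_wrt (\<lambda>b b'. fst b' < fst b \<or> fst b = fst b' \<and> snd b < snd b')
      (filter (\<lambda>b. b \<in> skew_diagram lam mu) (map (Pair r) [r..<r + lam ! (r - 1)]))"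
    by (intro sorted_wrt_filter) (simp add: sorted_wrt_map)
next
  have "sorted_wrt (<) [1..<length lam + 1]" by simp
  then have "sorted_wrt (\<lambda>x y. y < x) (rev [1..<length lam + 1])" by (simp only: sorted_wrt_rev)
  then show "sorted_wrt (\<lambda>x y. \<forall>a\<in>set (filter (\<lambda>b. b \<in> skew_diagram lam mu) (map (Pair x) [x..<x + lam ! (x - 1)])).
      \<forall>b\<in>set (filter (\<lambda>b. b \<in> skew_diagram lam mu) (map (Pair y) [y..<y + lam ! (y - 1)])).
        fst b < fst a \<or> fst a = fst b \<and> snd a < snd b) (rev [1..<length lam + 1])"
    by (rule sorted_wrt_mono_rel[rotated]) auto
qed

lemma semistandard_iff:
  "semistandard lam mu T \<longleftrightarrow> dom T = skew_diagram lam mu \<and>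
     (\<forall>r c c'. (r, c) \<in> skew_diagram lam mu \<and> (r, c') \<in> skew_diagram lam mu \<and> c < c' \<longrightarrow>
        rowrel (the (T (r, c))) (the (T (r, c')))) \<and>
     (\<forall>r r' c. (r, c) \<in> skew_diagram lam mu \<and> (r', c) \<in> skew_diagram lam mu \<and> r < r' \<longrightarrow>
        colrel (the (T (r, c))) (the (T (r', c)))) \<and>
     is_word (reading_word lam mu T)"
proof -
  have r: "rowrel a b \<longleftrightarrow> a \<le> b \<and> (a = b \<longrightarrow> \<not> is_Primed a)" for a b
    by (auto simp: rowrel_def)
  have c: "colrel a b \<longleftrightarrow> a \<le> b \<and> (a = b \<longrightarrow> is_Primed a)" for a b
    by (auto simp: colrel_def)
  show ?thesis
  proof (cases "dom T = skew_diagram lam mu")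
    case True
    have pair: "(\<forall>a a'. T b = Some a \<and> T b' = Some a' \<and> Q \<longrightarrow> P a a') \<longleftrightarrow>
        (b \<in> dom T \<and> b' \<in> dom T \<and> Q \<longrightarrow> P (the (T b)) (the (T b')))" for b b' P Q
      by auto
    show ?thesis unfolding semistandard_def r c True[symmetric] pair by (rule refl)
  qed (simp add: semistandard_def)
qed

lemma canon_from_fixed_iff:
  "canon_from S w = w \<longleftrightarrow>
     (\<forall>p a s. w = p @ a # s \<longrightarrow> is_Primed a \<longrightarrow> val a \<in> S \<union> val ` set p)"
proof (induction w arbitrary: S)
  case (Cons b w)
  have "(if val b \<in> S then b else Unprimed (val b)) = b \<longleftrightarrow> (is_Primed b \<longrightarrow> val b \<in> S)"
    by (cases b) auto
  then have "canon_from S (b # w) = b # w \<longleftrightarrow> (is_Primed b \<longrightarrow> val b \<in> S) \<and>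
      (\<forall>p a s. w = p @ a # s \<longrightarrow> is_Primed a \<longrightarrow> val a \<in> insert (val b) S \<union> val ` set p)"
    using Cons.IH by simp
  also have "\<dots> \<longleftrightarrow> (\<forall>p a s. b # w = p @ a # s \<longrightarrow> is_Primed a \<longrightarrow> val a \<in> S \<union> val ` set p)"
    (is "?L \<longleftrightarrow> ?R")
  proof
    assume L: ?L
    show ?R
    proof (intro allI impI)
      fix p a s assume "b # w = p @ a # s" "is_Primed a"
      then show "val a \<in> S \<union> val ` set p" using L by (cases p) auto
    qed
  next
    assume R: ?R
    have "is_Primed b \<longrightarrow> val b \<in> S" using R[rule_format, of "[]" b w] by auto
    moreover have "val a \<in> insert (val b) S \<union> val ` set p" if "w = p @ a # s" "is_Primed a" for p a s
      using R[rule_format, of "b # p" a s] that by auto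
    ultimately show ?L by blast
  qed
  finally show ?case .
qed simp

text \<open>Canonicity as one condition per primed letter: it passes to subwords and can be checked
  separately for letters with values in {i, i + 1} and for the others.\<close>

lemma is_word_iff:
  "is_word w \<longleftrightarrow> (\<forall>p a s. w = p @ a # s \<longrightarrow> is_Primed a \<longrightarrow> val a \<in> val ` set p)"
  by (simp add: is_word_def canon_conv canon_from_fixed_iff)

lemma is_word_map_iff:
  "is_word (map f bs) \<longleftrightarrow> (\<forall>us b vs. bs = us @ b # vs \<longrightarrow> is_Primed (f b) \<longrightarrow>
     (\<exists>b'\<in>set us. val (f b') = val (f b)))"
proof
  assume a: "is_word (map f bs)"
  show "\<forall>us b vs. bs = us @ b # vs \<longrightarrow> is_Primed (f b) \<longrightarrow> (\<exists>b'\<in>set us. val (f b') = val (f b))"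
  proof (intro allI impI)
    fix us b vs assume "bs = us @ b # vs" "is_Primed (f b)"
    then have "val (f b) \<in> val ` set (map f us)"
      using a unfolding is_word_iff by (metis list.simps(9) map_append)
    then show "\<exists>b'\<in>set us. val (f b') = val (f b)" by auto
  qed
next
  assume a: "\<forall>us b vs. bs = us @ b # vs \<longrightarrow> is_Primed (f b) \<longrightarrow> (\<exists>b'\<in>set us. val (f b') = val (f b))"
  show "is_word (map f bs)"
    unfolding is_word_iff
  proof (intro allI impI)
    fix p x s assume e: "map f bs = p @ x # s" and x: "is_Primed x"
    from e obtain us b vs where "bs = us @ b # vs" "p = map f us" "x = f b"
      by (auto simp: map_eq_append_conv map_eq_Cons_conv)
    moreover from this obtain b' where "b' \<in> set us" "val (f b') = val (f b)" using a x by blast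
    ultimately have "f b' \<in> set p" "val x = val (f b')" by auto
    then show "val x \<in> val ` set p" by blast
  qed
qed

lemma filter_eq_append_Cons:
  "filter P bs = us' @ b # vs' \<Longrightarrow> \<exists>us vs. bs = us @ b # vs \<and> us' = filter P us \<and> P b"
proof (induction bs arbitrary: us')
  case (Cons x bs)
  show ?case
  proof (cases "P x \<and> us' = []")
    case True
    then show ?thesis using Cons.prems by (intro exI[of _ "[]"] exI[of _ bs]) auto
  next
    case False
    define us'' where "us'' = (if P x then tl us' else us')"
    have "filter P bs = us'' @ b # vs'"
      using Cons.prems False by (cases us') (auto simp: us''_def split: if_splits)
    then obtain us vs where u: "bs = us @ b # vs" "us'' = filter P us" "P b"
      using Cons.IH by blast
    have "us' = filter P (x # us)"
      using u(2) Cons.prems False by (cases us') (auto simp: us''_def split: if_splits)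
    then show ?thesis using u by (intro exI[of _ "x # us"] exI[of _ vs]) auto
  qed
qed simp

lemma replace_subword_map:
  "replace_subword i (map f bs) (map g (filter (\<lambda>b. val (f b) \<in> {i, i + 1}) bs)) =
     map (\<lambda>b. if val (f b) \<in> {i, i + 1} then shift_up i (g b) else f b) bs"
  by (induction bs) auto

section \<open>Passing between a tableau and its subword of values i and i + 1\<close>

locale crystal_index =
  fixes lam mu :: "nat list" and n i :: nat
  assumes shape: "shifted_skew_shape lam mu" and i: "1 \<le> i" "i < n"
begin

text \<open>The values are related additively because \<open>shift_down\<close> uses truncated
  subtraction.\<close>

lemma shift_down_cases:
  assumes "val a \<in> {i, i + 1}"
  shows "shift_down i a \<in> letters12" "shift_up i (shift_down i a) = a"
    "is_Primed (shift_down i a) = is_Primed a" "val (shift_down i a) + i = val a + 1"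
  using assms i by (cases a; auto simp: letters12_iff)+

lemma shift_up_cases:
  assumes "a \<in> letters12"
  shows "val (shift_up i a) \<in> {i, i + 1}" "shift_down i (shift_up i a) = a"
    "is_Primed (shift_up i a) = is_Primed a"
  using assms i by (cases a; auto simp: letters12_iff)+

lemma rel_shift_down:
  assumes "val a \<in> {i, i + 1}" "val b \<in> {i, i + 1}"
  shows "rowrel (shift_down i a) (shift_down i b) = rowrel a b"
    "colrel (shift_down i a) (shift_down i b) = colrel a b"
  using assms i by (cases a; cases b; auto simp: rowrel_def colrel_def less_letter_def)+

text \<open>A letter of another value lies on the same side of all four letters of value i and i +
  1, so exchanging these does not disturb a comparison with it.\<close>

lemma rel_outside:
  assumes "val a \<notin> {i, i + 1}" "val b \<in> {i, i + 1}" "val b' \<in> {i, i + 1}"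
  shows "rowrel a b = rowrel a b'" "rowrel b a = rowrel b' a"
    "colrel a b = colrel a b'" "colrel b a = colrel b' a"
proof -
  have *: "a < b \<longleftrightarrow> val a < val b" "b < a \<longleftrightarrow> val b < val a" "a \<noteq> b"
    if "val b \<in> {i, i + 1}" for b
  proof -
    have ne: "val a \<noteq> val b" using that assms(1) by auto
    show "a < b \<longleftrightarrow> val a < val b"
      using val_less[of a b] less_val[of a b] ne by (cases "a < b") auto
    show "b < a \<longleftrightarrow> val b < val a"
      using val_less[of b a] less_val[of b a] ne by (cases "b < a") auto
    show "a \<noteq> b" using ne by auto
  qed
  show "rowrel a b = rowrel a b'" "rowrel b a = rowrel b' a"
    "colrel a b = colrel a b'" "colrel b a = colrel b' a"
    using *[OF assms(2)] *[OF assms(3)] assms unfolding rowrel_def colrel_def by auto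
qed

abbreviation Bf :: "(nat \<times> nat) list" where "Bf \<equiv> reading_boxes lam mu"

definition active :: "filling \<Rightarrow> nat \<times> nat \<Rightarrow> bool" where
  "active T b \<longleftrightarrow> val (the (T b)) \<in> {i, i + 1}"

definition Bi :: "filling \<Rightarrow> (nat \<times> nat) list" where
  "Bi T = filter (active T) Bf"

definition sub :: "filling \<Rightarrow> letter list" where
  "sub T = subword i (reading_word lam mu T)"

definition upd :: "filling \<Rightarrow> letter list \<Rightarrow> filling" where
  "upd T v = map_of (zip Bf (replace_subword i (reading_word lam mu T) v))"

lemma sub_conv: "sub T = map (\<lambda>b. shift_down i (the (T b))) (Bi T)"
  by (simp add: sub_def subword_def reading_word_def filter_map Bi_def active_def[abs_def] comp_def)

lemma length_sub: "length (sub T) = length (Bi T)"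
  by (simp add: sub_conv)

lemma set_Bf: "set Bf = skew_diagram lam mu"
  by (rule set_reading_boxes[OF shape])

lemma set_Bi: "b \<in> set (Bi T) \<longleftrightarrow> b \<in> skew_diagram lam mu \<and> active T b"
  by (auto simp: Bi_def set_Bf)

lemma sub_letters12: "set (sub T) \<subseteq> letters12"
  by (auto simp: sub_conv set_Bi active_def intro!: shift_down_cases(1))

context
  fixes T assumes T: "T \<in> ShST lam mu n"
begin

lemma T_dom: "dom T = skew_diagram lam mu"
  using T by (simp add: ShST_def semistandard_iff)

lemma T_Some: "b \<in> skew_diagram lam mu \<Longrightarrow> T b = Some (the (T b))"
  using T_dom by (metis domD option.sel)

lemma T_row: "(r, c) \<in> skew_diagram lam mu \<Longrightarrow> (r, c') \<in> skew_diagram lam mu \<Longrightarrow> c < c' \<Longrightarrow>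
    rowrel (the (T (r, c))) (the (T (r, c')))"
  using T unfolding ShST_def semistandard_iff by blast

lemma T_col: "(r, c) \<in> skew_diagram lam mu \<Longrightarrow> (r', c) \<in> skew_diagram lam mu \<Longrightarrow> r < r' \<Longrightarrow>
    colrel (the (T (r, c))) (the (T (r', c)))"
  using T unfolding ShST_def semistandard_iff by blast

lemma T_word: "is_word (map (\<lambda>b. the (T b)) Bf)"
  using T unfolding ShST_def semistandard_iff reading_word_def by blast

text \<open>Go right along row \<open>r\<close> and then down column \<open>c'\<close>; the corner
  belongs to the shape by convexity.\<close>

lemma T_val_mono:
  assumes D: "(r, c) \<in> skew_diagram lam mu" "(r', c') \<in> skew_diagram lam mu"
    and le: "r \<le> r'" "c \<le> c'" "r' \<le> c'" "r \<le> c'"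
  shows "val (the (T (r, c))) \<le> val (the (T (r', c')))"
proof -
  have m: "(r, c') \<in> skew_diagram lam mu"
    using skew_diagram_convex[OF shape D, of r c'] le by simp
  have "val (the (T (r, c))) \<le> val (the (T (r, c')))"
    using T_row[OF D(1) m] le(2) less_val by (cases "c = c'") (auto simp: rowrel_def)
  also have "\<dots> \<le> val (the (T (r', c')))"
    using T_col[OF m D(2)] le(1) less_val by (cases "r = r'") (auto simp: colrel_def)
  finally show ?thesis .
qed

text \<open>Values increase weakly to the lower right, so those in {i, i + 1} occupy a convex part
  of the skew diagram.\<close>

lemma reading_Bi: "reading (Bi T)"
proof
  fix j k assume "j < k" "k < length (Bi T)"
  then show "fst (Bi T ! k) < fst (Bi T ! j) \<or> fst (Bi T ! j) = fst (Bi T ! k) \<and> snd (Bi T ! j) < snd (Bi T ! k)"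
    using sorted_wrt_nth_less[OF sorted_wrt_filter[OF sorted_reading_boxes]] unfolding Bi_def by blast
next
  fix r1 c1 r2 c2 r c
  assume D: "(r1, c1) \<in> set (Bi T)" "(r2, c2) \<in> set (Bi T)"
    and le: "r1 \<le> r" "r \<le> r2" "c1 \<le> c" "c \<le> c2" "r \<le> c"
  have D': "(r1, c1) \<in> skew_diagram lam mu" "(r2, c2) \<in> skew_diagram lam mu"
    and act: "val (the (T (r1, c1))) \<in> {i, i + 1}" "val (the (T (r2, c2))) \<in> {i, i + 1}"
    using D by (auto simp: set_Bi active_def)
  have m: "(r, c) \<in> skew_diagram lam mu" by (rule skew_diagram_convex[OF shape D' le])
  have d2: "r2 \<le> c2" by (rule skew_diagram_diagonal[OF D'(2)])
  have "val (the (T (r1, c1))) \<le> val (the (T (r, c)))"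
    using le by (intro T_val_mono D' m) auto
  moreover have "val (the (T (r, c))) \<le> val (the (T (r2, c2)))"
    using le d2 by (intro T_val_mono D' m) auto
  ultimately have "val (the (T (r, c))) \<in> {i, i + 1}" using act by auto
  then show "(r, c) \<in> set (Bi T)" using m by (simp add: set_Bi active_def)
next
  show "r \<le> c" if "(r, c) \<in> set (Bi T)" for r c
    using that skew_diagram_diagonal by (auto simp: set_Bi)
qed

interpretation reading "Bi T" by (rule reading_Bi)

lemma map_nth_pos: "length v = length (Bi T) \<Longrightarrow> map (\<lambda>b. v ! pos b) (Bi T) = v"
  by (rule nth_equalityI) auto

lemma replace_conv:
  assumes "length v = length (Bi T)"
  shows "replace_subword i (reading_word lam mu T) v =
    map (\<lambda>b. if active T b then shift_up i (v ! pos b) else the (T b)) Bf"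
  using replace_subword_map[of i "\<lambda>b. the (T b)" Bf "\<lambda>b. v ! pos b"] map_nth_pos[OF assms]
  by (simp add: reading_word_def Bi_def active_def[abs_def])

lemma upd_conv:
  assumes "length v = length (Bi T)"
  shows "upd T v = (\<lambda>b. if b \<in> skew_diagram lam mu
    then Some (if active T b then shift_up i (v ! pos b) else the (T b)) else None)"
  unfolding upd_def replace_conv[OF assms] by (simp add: map_of_zip_map set_Bf)

lemma upd_sub: "upd T (sub T) = T"
proof
  fix b
  show "upd T (sub T) b = T b"
  proof (cases "b \<in> skew_diagram lam mu")
    case True
    note s = T_Some[OF True]
    have "shift_up i (sub T ! pos b) = the (T b)" if "active T b"
    proof -
      have "b \<in> set (Bi T)" using True that by (simp add: set_Bi)
      from pos_in[OF this] have "sub T ! pos b = shift_down i (the (T b))" by (simp add: sub_conv)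
      then show ?thesis using shift_down_cases(2) that by (simp add: active_def)
    qed
    then show ?thesis using True s by (simp add: upd_conv[OF length_sub])
  next
    case False
    then have "T b = None" using T_dom by auto
    then show ?thesis using False by (simp add: upd_conv[OF length_sub])
  qed
qed

lemma tab_sub: "tab (sub T)"
proof -
  have s: "sub T ! pos b = shift_down i (the (T b))" "val (the (T b)) \<in> {i, i + 1}"
    "b \<in> skew_diagram lam mu" if "b \<in> set (Bi T)" for b
    using pos_in[OF that] that by (auto simp: sub_conv set_Bi active_def)
  show ?thesis
    unfolding tab_def using s rel_shift_down T_row T_col by simp
qed

lemma is_word_sub: "is_word (sub T)"
  unfolding sub_conv is_word_map_iff
proof (intro allI impI)
  fix us' b vs'
  assume e: "Bi T = us' @ b # vs'" and p: "is_Primed (shift_down i (the (T b)))"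
  obtain us vs where u: "Bf = us @ b # vs" "us' = filter (active T) us" "active T b"
    using filter_eq_append_Cons e unfolding Bi_def by metis
  have v: "val (the (T b)) \<in> {i, i + 1}" using u(3) by (simp add: active_def)
  then have "is_Primed (the (T b))" using p shift_down_cases(3) by simp
  then obtain b' where b': "b' \<in> set us" "val (the (T b')) = val (the (T b))"
    using T_word u(1) unfolding is_word_map_iff by blast
  then have "active T b'" using v by (simp add: active_def)
  moreover from this have "val (shift_down i (the (T b'))) = val (shift_down i (the (T b)))"
    using shift_down_cases(4)[of "the (T b')"] shift_down_cases(4)[OF v] b'(2) v by simp
  ultimately show "\<exists>b'\<in>set us'. val (shift_down i (the (T b'))) = val (shift_down i (the (T b)))"
    using b'(1) u(2) by (intro bexI[of _ b']) auto
qed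

context
  fixes v
  assumes lv: "set v \<subseteq> letters12" and len: "length v = length (Bi T)"
begin

lemma v_letter: "b \<in> skew_diagram lam mu \<Longrightarrow> active T b \<Longrightarrow> v ! pos b \<in> letters12"
  using pos_in[of b] lv len by (metis nth_mem set_Bi subsetD)

lemma upd_at: "b \<in> skew_diagram lam mu \<Longrightarrow>
    the (upd T v b) = (if active T b then shift_up i (v ! pos b) else the (T b))"
  by (simp add: upd_conv[OF len])

lemma active_upd: "b \<in> skew_diagram lam mu \<Longrightarrow> active (upd T v) b = active T b"
  using shift_up_cases(1)[OF v_letter, of b] upd_at[of b]
  by (auto simp: active_def)

lemma Bi_upd: "Bi (upd T v) = Bi T"
  unfolding Bi_def using active_upd set_Bf by (intro filter_cong) auto

lemma sub_upd: "sub (upd T v) = v"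
proof -
  have "sub (upd T v) = map (\<lambda>b. v ! pos b) (Bi T)"
    unfolding sub_conv Bi_upd
    by (rule map_cong) (auto simp: set_Bi upd_at shift_up_cases(2)[OF v_letter])
  then show ?thesis using map_nth_pos[OF len] by simp
qed

text \<open>Pairs of active boxes are governed by \<open>tab v\<close>, pairs of inactive boxes are
  unchanged, and mixed pairs do not notice the update by \<open>rel_outside\<close>. The canonical
  form splits in the same way, since it compares only letters of equal value.\<close>

lemma upd_ShST:
  assumes wv: "is_word v" and tab: "tab v"
  shows "upd T v \<in> ShST lam mu n"
proof -
  let ?f = "\<lambda>b. if active T b then shift_up i (v ! pos b) else the (T b)"
  have dm: "dom (upd T v) = skew_diagram lam mu" by (auto simp: upd_conv[OF len] split: if_splits)
  have vat: "val (?f b) \<in> {i, i + 1}" "shift_down i (?f b) = v ! pos b"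
    if "b \<in> skew_diagram lam mu" "active T b" for b
    using shift_up_cases[OF v_letter[OF that]] that(2) by auto
  have rel: "rowrel (?f b) (?f b')" if D: "b \<in> skew_diagram lam mu" "b' \<in> skew_diagram lam mu"
    and r: "rowrel (the (T b)) (the (T b'))"
    and a: "active T b \<Longrightarrow> active T b' \<Longrightarrow> rowrel (v ! pos b) (v ! pos b')" for b b'
  proof -
    consider "active T b" "active T b'" | "active T b" "\<not> active T b'"
      | "\<not> active T b" "active T b'" | "\<not> active T b" "\<not> active T b'" by blast
    then show ?thesis
    proof cases
      case 1
      then show ?thesis
        using a rel_shift_down(1)[OF vat(1)[OF D(1) 1(1)] vat(1)[OF D(2) 1(2)]]
          vat(2)[OF D(1) 1(1)] vat(2)[OF D(2) 1(2)] by simp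
    next
      case 2
      then show ?thesis
        using r rel_outside(2)[of "the (T b')" "the (T b)" "?f b"] vat(1)[OF D(1) 2(1)]
        by (simp add: active_def)
    next
      case 3
      then show ?thesis
        using r rel_outside(1)[of "the (T b)" "the (T b')" "?f b'"] vat(1)[OF D(2) 3(2)]
        by (simp add: active_def)
    qed (use r in simp)
  qed
  have rel': "colrel (?f b) (?f b')" if D: "b \<in> skew_diagram lam mu" "b' \<in> skew_diagram lam mu"
    and r: "colrel (the (T b)) (the (T b'))"
    and a: "active T b \<Longrightarrow> active T b' \<Longrightarrow> colrel (v ! pos b) (v ! pos b')" for b b'
  proof -
    consider "active T b" "active T b'" | "active T b" "\<not> active T b'"
      | "\<not> active T b" "active T b'" | "\<not> active T b" "\<not> active T b'" by blast
    then show ?thesis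
    proof cases
      case 1
      then show ?thesis
        using a rel_shift_down(2)[OF vat(1)[OF D(1) 1(1)] vat(1)[OF D(2) 1(2)]]
          vat(2)[OF D(1) 1(1)] vat(2)[OF D(2) 1(2)] by simp
    next
      case 2
      then show ?thesis
        using r rel_outside(4)[of "the (T b')" "the (T b)" "?f b"] vat(1)[OF D(1) 2(1)]
        by (simp add: active_def)
    next
      case 3
      then show ?thesis
        using r rel_outside(3)[of "the (T b)" "the (T b')" "?f b'"] vat(1)[OF D(2) 3(2)]
        by (simp add: active_def)
    qed (use r in simp)
  qed
  have rows: "rowrel (the (upd T v (r, c))) (the (upd T v (r, c')))"
    if D: "(r, c) \<in> skew_diagram lam mu" "(r, c') \<in> skew_diagram lam mu" "c < c'" for r c c'
    unfolding upd_at[OF D(1)] upd_at[OF D(2)]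
    by (rule rel[OF D(1,2) T_row[OF D]]) (use tab_row[OF tab] D in \<open>auto simp: set_Bi\<close>)
  have cols: "colrel (the (upd T v (r, c))) (the (upd T v (r', c)))"
    if D: "(r, c) \<in> skew_diagram lam mu" "(r', c) \<in> skew_diagram lam mu" "r < r'" for r r' c
    unfolding upd_at[OF D(1)] upd_at[OF D(2)]
    by (rule rel'[OF D(1,2) T_col[OF D]]) (use tab_col[OF tab] D in \<open>auto simp: set_Bi\<close>)
  have rw: "reading_word lam mu (upd T v) = map ?f Bf"
    unfolding reading_word_def using upd_at set_Bf by (intro map_cong) auto
  have "is_word (map ?f Bf)"
    unfolding is_word_map_iff
  proof (intro allI impI)
    fix us b vs
    assume e: "Bf = us @ b # vs" and p: "is_Primed (?f b)"
    have D: "x \<in> skew_diagram lam mu" if "x \<in> set (us @ b # vs)" for x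
      using that unfolding set_Bf[symmetric] e .
    have bD: "b \<in> skew_diagram lam mu" using D by simp
    show "\<exists>b'\<in>set us. val (?f b') = val (?f b)"
    proof (cases "active T b")
      case True
      have "Bi T = filter (active T) us @ b # filter (active T) vs" using e True by (simp add: Bi_def)
      moreover have "is_Primed (v ! pos b)"
        using p True shift_up_cases(3)[OF v_letter[OF bD True]] by simp
      moreover have "is_word (map (\<lambda>b. v ! pos b) (Bi T))" using map_nth_pos[OF len] wv by simp
      ultimately obtain b' where b': "b' \<in> set (filter (active T) us)" "val (v ! pos b') = val (v ! pos b)"
        unfolding is_word_map_iff by blast
      have "val (shift_up i a) = val a + i - 1" for a by (cases a) auto
      then show ?thesis using b' True by (intro bexI[of _ b']) auto
    next
      case False
      then have "is_Primed (the (T b))" using p by simp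
      then obtain b' where b': "b' \<in> set us" "val (the (T b')) = val (the (T b))"
        using T_word e unfolding is_word_map_iff by blast
      then show ?thesis using False by (intro bexI[of _ b']) (auto simp: active_def)
    qed
  qed
  moreover have "1 \<le> val a \<and> val a \<le> n" if "a \<in> ran (upd T v)" for a
  proof -
    obtain b where b: "b \<in> skew_diagram lam mu" "a = ?f b"
      using \<open>a \<in> ran (upd T v)\<close> by (auto simp: ran_def upd_conv[OF len] split: if_splits)
    show ?thesis
    proof (cases "active T b")
      case True
      then show ?thesis using vat(1)[OF b(1) True] b(2) i by auto
    next
      case False
      have "the (T b) \<in> ran T" using T_Some[OF b(1)] by (metis ranI)
      then show ?thesis using False b(2) T by (auto simp: ShST_def)
    qed
  qed
  ultimately show ?thesis
    using dm rows cols rw unfolding ShST_def semistandard_iff by auto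
qed

end

text \<open>An update leaves the set of active boxes as it was, so a second one overwrites the first
  entirely. Composites on tableaux thus become composites on words.\<close>

lemma upd_upd:
  assumes "set v \<subseteq> letters12" "length v = length (Bi T)" "is_word v" "tab v" "length v' = length (Bi T)"
  shows "upd (upd T v) v' = upd T v'"
proof
  fix b
  have r: "reading (Bi T)" by (rule reading_Bi)
  note c = crystal_index.upd_conv[OF crystal_index_axioms upd_ShST[OF assms(1-4)], of v']
  show "upd (upd T v) v' b = upd T v' b"
    using c assms active_upd[OF assms(1,2), of b] upd_at[OF assms(1,2), of b]
    by (simp add: Bi_upd[OF assms(1,2)] upd_conv[OF assms(5)])
qed

end

end

text \<open>What the crystal axioms on tableaux use of a pair of operators with graph
  \<open>R\<close>. Both (E, F) with \<open>Rel\<close> and (E', F') with \<open>FP\<close> qualify,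
  so the tableau part is done once.\<close>

definition crystal_ops ::
  "(letter list \<Rightarrow> letter list option) \<Rightarrow> (letter list \<Rightarrow> letter list option) \<Rightarrow>
   (letter list \<Rightarrow> letter list \<Rightarrow> bool) \<Rightarrow> bool" where
  "crystal_ops e f R \<longleftrightarrow>
     (\<forall>w v. is_word w \<and> set w \<subseteq> letters12 \<longrightarrow>
        (f w = Some v \<longleftrightarrow> R w v \<and> is_word v) \<and> (e w = Some v \<longleftrightarrow> R v w \<and> is_word v)) \<and>
     (\<forall>w v. R w v \<longrightarrow> set w \<subseteq> letters12 \<and> set v \<subseteq> letters12 \<and> length v = length w \<and>
        (\<exists>x y. walk_end w = (Suc x, y) \<and> walk_end v = (x, Suc y)) \<and>
        weight v = (\<lambda>j. weight w j - alpha 1 j) \<and>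
        (\<forall>B. reading B \<longrightarrow> length w = length B \<longrightarrow> reading.tab B w = reading.tab B v))"

lemma crystal_ops_Rel: "crystal_ops opE opF Rel"
  unfolding crystal_ops_def
  using opF_iff opE_iff Rel_letters12 Rel_length Rel_walk Rel_weight reading.Rel_tab by blast

lemma crystal_ops_FP: "crystal_ops opE' opF' FP"
  unfolding crystal_ops_def
  using opF'_iff opE'_iff FP_letters12 FP_length FP_walk FP_weight reading.FP_tab by blast

section \<open>The operators on tableaux\<close>

context crystal_index
begin

lemma tab_op_conv: "tab_op A lam mu i T = map_option (upd T) (A (sub T))"
  by (simp add: tab_op_def word_op_def upd_def[abs_def] sub_def option.map_comp comp_def)

lemma op_result:
  assumes T: "T \<in> ShST lam mu n" and ops: "crystal_ops e f R"
    and v: "f (sub T) = Some v \<or> e (sub T) = Some v"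
  shows "is_word v \<and> set v \<subseteq> letters12 \<and> length v = length (Bi T) \<and> reading.tab (Bi T) v"
proof -
  have "R (sub T) v \<and> is_word v \<or> R v (sub T) \<and> is_word v"
    using ops v is_word_sub[OF T] sub_letters12[of T] unfolding crystal_ops_def by blast
  then show ?thesis
    using ops tab_sub[OF T] reading_Bi[OF T] length_sub[of T] unfolding crystal_ops_def by metis
qed

text \<open>The equation \<open>X = upd T (sub X)\<close> says that \<open>X\<close> agrees with
  \<open>T\<close> outside the active boxes. By \<open>upd_sym\<close> the roles of \<open>T\<close>
  and \<open>X\<close> can be exchanged, which yields (K1).\<close>

lemma f_iff:
  assumes T: "T \<in> ShST lam mu n" and ops: "crystal_ops e f R"
  shows "tab_op f lam mu i T = Some X \<longleftrightarrow> X \<in> ShST lam mu n \<and> X = upd T (sub X) \<and> R (sub T) (sub X)"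
proof
  assume "tab_op f lam mu i T = Some X"
  then obtain v where v: "f (sub T) = Some v" "X = upd T v" by (auto simp: tab_op_conv)
  have g: "is_word v" "set v \<subseteq> letters12" "length v = length (Bi T)" "reading.tab (Bi T) v"
    using op_result[OF T ops] v by auto
  have "R (sub T) v" using ops v is_word_sub[OF T] sub_letters12[of T] unfolding crystal_ops_def by blast
  then show "X \<in> ShST lam mu n \<and> X = upd T (sub X) \<and> R (sub T) (sub X)"
    using upd_ShST[OF T g(2,3,1,4)] sub_upd[OF T g(2,3)] v(2) by simp
next
  assume X: "X \<in> ShST lam mu n \<and> X = upd T (sub X) \<and> R (sub T) (sub X)"
  then have "f (sub T) = Some (sub X)"
    using ops is_word_sub[OF T] is_word_sub[of X] sub_letters12[of T] unfolding crystal_ops_def by blast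
  then show "tab_op f lam mu i T = Some X" using X by (simp add: tab_op_conv)
qed

lemma e_iff:
  assumes T: "T \<in> ShST lam mu n" and ops: "crystal_ops e f R"
  shows "tab_op e lam mu i T = Some X \<longleftrightarrow> X \<in> ShST lam mu n \<and> X = upd T (sub X) \<and> R (sub X) (sub T)"
proof
  assume "tab_op e lam mu i T = Some X"
  then obtain v where v: "e (sub T) = Some v" "X = upd T v" by (auto simp: tab_op_conv)
  have g: "is_word v" "set v \<subseteq> letters12" "length v = length (Bi T)" "reading.tab (Bi T) v"
    using op_result[OF T ops] v by auto
  have "R v (sub T)" using ops v is_word_sub[OF T] sub_letters12[of T] unfolding crystal_ops_def by blast
  then show "X \<in> ShST lam mu n \<and> X = upd T (sub X) \<and> R (sub X) (sub T)"
    using upd_ShST[OF T g(2,3,1,4)] sub_upd[OF T g(2,3)] v(2) by simp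
next
  assume X: "X \<in> ShST lam mu n \<and> X = upd T (sub X) \<and> R (sub X) (sub T)"
  then have "e (sub T) = Some (sub X)"
    using ops is_word_sub[OF T] is_word_sub[of X] sub_letters12[of T] unfolding crystal_ops_def by blast
  then show "tab_op e lam mu i T = Some X" using X by (simp add: tab_op_conv)
qed

lemma upd_sym:
  assumes T: "T \<in> ShST lam mu n" and X: "X \<in> ShST lam mu n" and u: "X = upd T (sub X)"
    and len: "length (sub X) = length (sub T)"
  shows "T = upd X (sub T)"
proof -
  have lX: "length (sub X) = length (Bi T)" using len length_sub by simp
  have "Bi X = Bi T" using Bi_upd[OF T sub_letters12 lX] u by simp
  then have "reading.tab (Bi T) (sub X)" using tab_sub[OF X] by simp
  from upd_upd[OF T sub_letters12 lX is_word_sub[OF X] this length_sub] upd_sub[OF T] u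
  show ?thesis by simp
qed

lemma ef_inverse:
  assumes X: "X \<in> ShST lam mu n" and Y: "Y \<in> ShST lam mu n" and ops: "crystal_ops e f R"
  shows "tab_op e lam mu i X = Some Y \<longleftrightarrow> tab_op f lam mu i Y = Some X"
proof -
  have "length (sub X) = length (sub Y)" if "R (sub Y) (sub X)"
    using ops that unfolding crystal_ops_def by blast
  then show ?thesis
    unfolding e_iff[OF X ops] f_iff[OF Y ops] using upd_sym[OF X Y] upd_sym[OF Y X] X Y by metis
qed

lemma weight_sub:
  "weight (reading_word lam mu T) i = weight (sub T) 1"
  "weight (reading_word lam mu T) (i + 1) = weight (sub T) 2"
proof -
  have v: "val (shift_down i (the (T b))) + i = val (the (T b)) + 1" if "active T b" for b
    using that shift_down_cases(4) unfolding active_def by blast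
  have "(val (the (T b)) = i) = (val (shift_down i (the (T b))) = 1 \<and> active T b)" for b
    using v[of b] by (auto simp: active_def)
  moreover have "(val (the (T b)) = i + 1) = (val (shift_down i (the (T b))) = 2 \<and> active T b)" for b
    using v[of b] by (auto simp: active_def)
  ultimately show "weight (reading_word lam mu T) i = weight (sub T) 1"
    "weight (reading_word lam mu T) (i + 1) = weight (sub T) 2"
    by (simp_all add: weight_def reading_word_def sub_conv Bi_def filter_map comp_def conj_commute)
qed

lemma weight_upd:
  assumes T: "T \<in> ShST lam mu n" and v: "set v \<subseteq> letters12" "length v = length (Bi T)"
    and j: "j \<notin> {i, i + 1}"
  shows "weight (reading_word lam mu (upd T v)) j = weight (reading_word lam mu T) j"
proof -
  have "(val (the (upd T v b)) = j) = (val (the (T b)) = j)" if "b \<in> set Bf" for b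
  proof (cases "active T b")
    case True
    then show ?thesis
      using active_upd[OF T v, of b] that set_Bf j by (auto simp: active_def)
  next
    case False
    then show ?thesis using upd_at[OF T v, of b] that set_Bf by simp
  qed
  then have "filter (\<lambda>b. val (the (upd T v b)) = j) Bf = filter (\<lambda>b. val (the (T b)) = j) Bf"
    by (intro filter_cong) auto
  then show ?thesis by (simp add: weight_def reading_word_def filter_map comp_def)
qed

lemma e_step:
  assumes X: "X \<in> ShST lam mu n" and ops: "crystal_ops e f R"
    and e: "tab_op e lam mu i X = Some Y"
  shows "tab_eps lam mu i Y = tab_eps lam mu i X - 1" "tab_phi lam mu i Y = tab_phi lam mu i X + 1"
    "tab_weight lam mu Y = (\<lambda>j. tab_weight lam mu X j + alpha i j)"
proof -
  have Y: "Y \<in> ShST lam mu n" "Y = upd X (sub Y)" "R (sub Y) (sub X)"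
    using e e_iff[OF X ops] by auto
  have R: "length (sub X) = length (sub Y)"
    "weight (sub X) = (\<lambda>j. weight (sub Y) j - alpha 1 j)"
    and "\<exists>x y. walk_end (sub Y) = (Suc x, y) \<and> walk_end (sub X) = (x, Suc y)"
    using ops Y(3) unfolding crystal_ops_def by blast+
  then obtain x y where w: "walk_end (sub Y) = (Suc x, y)" "walk_end (sub X) = (x, Suc y)" by blast
  show "tab_eps lam mu i Y = tab_eps lam mu i X - 1" "tab_phi lam mu i Y = tab_phi lam mu i X + 1"
    using w by (simp_all add: tab_eps_def tab_phi_def sub_def[symmetric] one_extended_def)
  have lY: "length (sub Y) = length (Bi X)" using R(1) length_sub[of X] by simp
  have w12: "weight (sub X) 1 = weight (sub Y) 1 - 1" "weight (sub X) 2 = weight (sub Y) 2 + 1"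
    using R(2) by (simp_all add: alpha_def)
  show "tab_weight lam mu Y = (\<lambda>j. tab_weight lam mu X j + alpha i j)"
  proof
    fix j
    show "tab_weight lam mu Y j = tab_weight lam mu X j + alpha i j"
    proof (cases "j \<in> {i, i + 1}")
      case True
      then show ?thesis
        using weight_sub[of X] weight_sub[of Y] w12 by (auto simp: tab_weight_def alpha_def)
    next
      case False
      have "weight (reading_word lam mu Y) j = weight (reading_word lam mu X) j"
        using weight_upd[OF X sub_letters12 lY False] Y(2) by simp
      then show ?thesis using False by (simp add: tab_weight_def alpha_def)
    qed
  qed
qed

lemma phi_eps:
  "tab_phi lam mu i X = Fin (\<Sum>j\<in>{1..n}. tab_weight lam mu X j * alpha i j) + tab_eps lam mu i X"
proof -
  let ?w = "tab_weight lam mu X"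
  have "(\<Sum>j\<in>{1..n}. ?w j * alpha i j) = (\<Sum>j\<in>{i, i + 1}. ?w j * alpha i j)"
    using i by (intro sum.mono_neutral_right) (auto simp: alpha_def)
  also have "\<dots> = ?w i - ?w (i + 1)" by (simp add: alpha_def)
  also have "\<dots> = weight (sub X) 1 - weight (sub X) 2"
    using weight_sub[of X] by (simp add: tab_weight_def)
  also have "\<dots> = int (fst (walk_end (sub X))) - int (snd (walk_end (sub X)))"
    using walk_weight[OF sub_letters12] by simp
  finally show ?thesis by (simp add: tab_phi_def tab_eps_def sub_def[symmetric])
qed

lemma tab_ops_commute:
  assumes T: "T \<in> ShST lam mu n"
    and A: "A \<in> {opF, opE, opF', opE'}" and B: "B \<in> {opF, opE, opF', opE'}"
    and X: "Option.bind (tab_op B lam mu i T) (tab_op A lam mu i) = Some X"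
    and Y: "Option.bind (tab_op A lam mu i T) (tab_op B lam mu i) = Some Y"
  shows "X = Y"
proof -
  \<comment> \<open>A composite on tableaux is a single update of \<open>T\<close> by the composite
    on words, so commutation is inherited.\<close>
  have lift: "\<exists>x. Option.bind (D (sub T)) C = Some x \<and> Z = upd T x"
    if C: "C \<in> {opF, opE, opF', opE'}" and D: "D \<in> {opF, opE, opF', opE'}"
      and Z: "Option.bind (tab_op D lam mu i T) (tab_op C lam mu i) = Some Z" for C D Z
  proof -
    obtain v where v: "D (sub T) = Some v" and Z': "tab_op C lam mu i (upd T v) = Some Z"
      using Z by (auto simp: tab_op_conv bind_eq_Some_conv)
    have g: "is_word v" "set v \<subseteq> letters12" "length v = length (Bi T)" "reading.tab (Bi T) v"
      using op_result[OF T crystal_ops_Rel, of v] op_result[OF T crystal_ops_FP, of v] D v by auto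
    note s = sub_upd[OF T g(2,3)] and S = upd_ShST[OF T g(2,3,1,4)]
    obtain x where x: "C v = Some x" "Z = upd (upd T v) x" using Z' s by (auto simp: tab_op_conv)
    have "length x = length (Bi (upd T v))"
      using op_result[OF S crystal_ops_Rel, of x] op_result[OF S crystal_ops_FP, of x] C x(1) s by auto
    then have "length x = length (Bi T)" using Bi_upd[OF T g(2,3)] by simp
    then have "Z = upd T x" using upd_upd[OF T g(2,3,1,4)] x(2) by simp
    then show ?thesis using v x(1) by auto
  qed
  obtain x where x: "Option.bind (B (sub T)) A = Some x" "X = upd T x" using lift[OF A B X] by blast
  obtain y where y: "Option.bind (A (sub T)) B = Some y" "Y = upd T y" using lift[OF B A Y] by blast
  have "x = y" by (rule ops_commute[OF A B is_word_sub[OF T] sub_letters12 x(1) y(1)])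
  then show ?thesis using x y by simp
qed

end

section \<open>Assembling the crystal axioms\<close>

lemma tab_weight_outside:
  assumes "shifted_skew_shape lam mu" "X \<in> ShST lam mu n" "j \<notin> {1..n}"
  shows "tab_weight lam mu X j = 0"
proof -
  have "val a \<in> {1..n}" if a: "a \<in> set (reading_word lam mu X)" for a
  proof -
    obtain b where b: "b \<in> skew_diagram lam mu" "a = the (X b)"
      using a set_reading_boxes[OF assms(1)] by (auto simp: reading_word_def)
    have "b \<in> dom X" using assms(2) b(1) by (simp add: ShST_def semistandard_iff)
    then have "a \<in> ran X" using b(2) by (auto intro: ranI)
    then show ?thesis using assms(2) by (simp add: ShST_def)
  qed
  then show ?thesis using assms(3) by (auto simp: tab_weight_def weight_zero_iff)
qed

lemma kashiwara_crystal:
  assumes shape: "shifted_skew_shape lam mu" and ne: "ShST lam mu n \<noteq> {}" and ops: "crystal_ops e f R"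
  shows "kashiwara_crystal_GL n (ShST lam mu n) (tab_op e lam mu) (tab_op f lam mu)
    (tab_eps lam mu) (tab_phi lam mu) (tab_weight lam mu)"
proof -
  have ci: "crystal_index lam mu n i" if "i \<in> {1..<n}" for i
    using shape that by unfold_locales auto
  have fin: "tab_eps lam mu i X \<noteq> Pinf" "tab_phi lam mu i X \<noteq> Pinf"
      "tab_eps lam mu i X \<noteq> Minf" "tab_phi lam mu i X \<noteq> Minf" for i X
    by (simp_all add: tab_eps_def tab_phi_def)
  have maps: "set_option (tab_op e lam mu i X) \<subseteq> ShST lam mu n"
    "set_option (tab_op f lam mu i X) \<subseteq> ShST lam mu n"
    if "i \<in> {1..<n}" "X \<in> ShST lam mu n" for i X
    using crystal_index.e_iff[OF ci[OF that(1)] that(2) ops]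
      crystal_index.f_iff[OF ci[OF that(1)] that(2) ops] by auto
  show ?thesis
    unfolding kashiwara_crystal_GL_def
  proof (intro conjI ballI allI impI)
    fix i X Y
    assume i: "i \<in> {1..<n}" and X: "X \<in> ShST lam mu n" and Y: "Y \<in> ShST lam mu n"
    show "(tab_op e lam mu i X = Some Y) = (tab_op f lam mu i Y = Some X)"
      by (rule crystal_index.ef_inverse[OF ci[OF i] X Y ops])
    assume "tab_op e lam mu i X = Some Y"
    note step = crystal_index.e_step[OF ci[OF i] X ops this]
    show "tab_eps lam mu i Y = tab_eps lam mu i X - 1" by (rule step)
    show "tab_phi lam mu i Y = tab_phi lam mu i X + 1" by (rule step)
    show "tab_weight lam mu Y = (\<lambda>j. tab_weight lam mu X j + alpha i j)" by (rule step)
  next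
    fix i X
    assume "i \<in> {1..<n}" "X \<in> ShST lam mu n"
    then show "tab_phi lam mu i X =
        Fin (\<Sum>j\<in>{1..n}. tab_weight lam mu X j * alpha i j) + tab_eps lam mu i X"
      by (intro crystal_index.phi_eps ci)
  \<comment> \<open>What remains are the codomain conditions and (K3), where neither function ever
    takes the value minus infinity.\<close>
  qed (use ne tab_weight_outside[OF shape] maps fin in \<open>simp_all\<close>)
qed

theorem theorem1p2:
  fixes lam mu :: "nat list" and n :: nat
  assumes "shifted_skew_shape lam mu"
    and "n \<ge> 1"
    and "ShST lam mu n \<noteq> {}"
  shows "(\<forall>i\<in>{1..<n}.
            \<forall>A\<in>{tabF lam mu i, tabE lam mu i, tabF' lam mu i, tabE' lam mu i}.
            \<forall>B\<in>{tabF lam mu i, tabE lam mu i, tabF' lam mu i, tabE' lam mu i}.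
            \<forall>T\<in>ShST lam mu n. \<forall>X Y.
              Option.bind (B T) A = Some X \<longrightarrow> Option.bind (A T) B = Some Y \<longrightarrow> X = Y)
       \<and> kashiwara_crystal_GL n (ShST lam mu n) (tabE lam mu) (tabF lam mu)
            (tab_eps lam mu) (tab_phi lam mu) (tab_weight lam mu)
       \<and> kashiwara_crystal_GL n (ShST lam mu n) (tabE' lam mu) (tabF' lam mu)
            (tab_eps lam mu) (tab_phi lam mu) (tab_weight lam mu)"
proof (intro conjI ballI allI impI)
  fix i A B T X Y
  assume i: "i \<in> {1..<n}"
    and A: "A \<in> {tabF lam mu i, tabE lam mu i, tabF' lam mu i, tabE' lam mu i}"
    and B: "B \<in> {tabF lam mu i, tabE lam mu i, tabF' lam mu i, tabE' lam mu i}"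
    and T: "T \<in> ShST lam mu n"
    and XY: "Option.bind (B T) A = Some X" "Option.bind (A T) B = Some Y"
  interpret crystal_index lam mu n i using assms(1) i by unfold_locales auto
  have word_op: "\<exists>A'\<in>{opF, opE, opF', opE'}. C = tab_op A' lam mu i"
    if "C \<in> {tabF lam mu i, tabE lam mu i, tabF' lam mu i, tabE' lam mu i}" for C
    using that by (auto simp: tabF_def tabE_def tabF'_def tabE'_def)
  obtain A' B' where "A' \<in> {opF, opE, opF', opE'}" "A = tab_op A' lam mu i"
    "B' \<in> {opF, opE, opF', opE'}" "B = tab_op B' lam mu i"
    using word_op[OF A] word_op[OF B] by blast
  then show "X = Y" using tab_ops_commute[OF T] XY by metis
next
  show "kashiwara_crystal_GL n (ShST lam mu n) (tabE lam mu) (tabF lam mu)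
      (tab_eps lam mu) (tab_phi lam mu) (tab_weight lam mu)"
    unfolding tabE_def tabF_def by (rule kashiwara_crystal[OF assms(1,3) crystal_ops_Rel])
next
  show "kashiwara_crystal_GL n (ShST lam mu n) (tabE' lam mu) (tabF' lam mu)
      (tab_eps lam mu) (tab_phi lam mu) (tab_weight lam mu)"
    unfolding tabE'_def tabF'_def by (rule kashiwara_crystal[OF assms(1,3) crystal_ops_FP])
qed

end
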